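(* Let $n\ge 1$ and let $\mathscr A$ be an arrangement of $d\geq\binom{n+2}{2}$ hyperplanes in the complex projective space $\mathbb P^n$, in general position with respect to hyperplanes and to quadrics. Then the logarithmic cotangent bundle $\Omega(\mathbb P^n,\mathscr A)=\Omega_{\mathbb P^n}(\log\mathscr A)$ is ample modulo $\mathscr A$; that is, writing $p\colon X'=\mathbb P(\Omega(\mathbb P^n,\mathscr A))\to\mathbb P^n$ for the projectivized bundle of rank one quotients, $$p\big(\mathbf B_+(\mathcal O_{X'}(1))\big)\subseteq \mathscr A .$$
   Context: Everything is over $\mathbb C$. General position: each hyperplane of $\mathbb P^n$ is viewed as a point of the dual projective space. The arrangement is in general position with respect to hyperplanes if no $n+1$ of the corresponding $d$ points lie in a single hyperplane of the dual space; it is in general position with respect to quadrics if no $\binom{n+2}{2}$ of these points lie in a single quadric hypersurface of the dual space. We also write $\mathscr A$ for the divisor given by the union of the hyperplanes (it has simple normal crossings by general position). Augmented base locus: for a line bundle $L$ on a projective variety $X$, the stable base locus $\mathbf B(L)$ is the intersection of the base loci of all positive multiples of $L$, and $\mathbf B_+(L)=\bigcap_{q\in\mathbb N}\mathbf B(qL-A)$, for any ample line bundle $A$ on $X$ (the result does not depend on $A$). *)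

theory Defs
  imports "HOL-Analysis.Analysis"
begin

section \<open>Varieties as spaces with functions\<close>

text \<open>
  Varieties over the complex numbers are treated classically: a set of closed points with its
  Zariski topology and, for every open set, its complex-valued regular functions. Functions are
  total in HOL; whether a function belongs to \<open>regular X U\<close> is only meaningful for open \<open>U\<close>,
  and, for all spaces constructed below, only depends on its values on \<open>U\<close>.
\<close>

record 'a fun_space =
  zariski :: "'a topology"
  regular :: "'a set \<Rightarrow> ('a \<Rightarrow> complex) set"

abbreviation points :: "'a fun_space \<Rightarrow> 'a set" where
  "points X \<equiv> topspace (zariski X)"

abbreviation zopen :: "'a fun_space \<Rightarrow> 'a set \<Rightarrow> bool" where
  "zopen X \<equiv> openin (zariski X)"

text \<open>
  The last two conjuncts say that pullback of functions is defined, and that it is surjective from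
  the local ring at \<open>\<phi> x\<close> to the local ring at \<open>x\<close>.
\<close>

definition closed_immersion :: "'a fun_space \<Rightarrow> 'b fun_space \<Rightarrow> ('a \<Rightarrow> 'b) \<Rightarrow> bool" where
  "closed_immersion X Y \<phi> \<longleftrightarrow>
     embedding_map (zariski X) (zariski Y) \<phi> \<and>
     closedin (zariski Y) (\<phi> ` points X) \<and>
     (\<forall>V h. zopen Y V \<and> h \<in> regular Y V \<longrightarrow> h \<circ> \<phi> \<in> regular X {x \<in> points X. \<phi> x \<in> V}) \<and>
     (\<forall>U f x. zopen X U \<and> f \<in> regular X U \<and> x \<in> U \<longrightarrow>
        (\<exists>V h. zopen Y V \<and> \<phi> x \<in> V \<and> h \<in> regular Y V \<and> (\<forall>y\<in>U. \<phi> y \<in> V \<longrightarrow> f y = h (\<phi> y))))"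


section \<open>Line bundles and base loci\<close>

text \<open>
  A line bundle is given by a cocycle for a trivialising open cover. The cover is indexed by the
  points of the space (\<open>nbd L x\<close> is a neighbourhood of \<open>x\<close>), which is no restriction, since every
  point has a neighbourhood on which a given line bundle is trivial. A section \<open>s\<close> has the
  expression \<open>s x\<close> in the trivialisation over \<open>nbd L x\<close>; in particular \<open>s x x\<close> is its value at \<open>x\<close>.
\<close>

record 'a cocycle =
  nbd :: "'a \<Rightarrow> 'a set"
  trans :: "'a \<Rightarrow> 'a \<Rightarrow> 'a \<Rightarrow> complex"

definition line_bundle :: "'a fun_space \<Rightarrow> 'a cocycle \<Rightarrow> bool" where
  "line_bundle X L \<longleftrightarrow>
     (\<forall>x\<in>points X. zopen X (nbd L x) \<and> x \<in> nbd L x) \<and>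
     (\<forall>x\<in>points X. \<forall>y\<in>points X.
        trans L x y \<in> regular X (nbd L x \<inter> nbd L y) \<and>
        (\<forall>z \<in> nbd L x \<inter> nbd L y. trans L x y z \<noteq> 0)) \<and>
     (\<forall>x\<in>points X. \<forall>y\<in>points X. \<forall>w\<in>points X. \<forall>z \<in> nbd L x \<inter> nbd L y \<inter> nbd L w.
        trans L x y z * trans L y w z = trans L x w z)"

definition is_section :: "'a fun_space \<Rightarrow> 'a cocycle \<Rightarrow> ('a \<Rightarrow> 'a \<Rightarrow> complex) \<Rightarrow> bool" where
  "is_section X L s \<longleftrightarrow>
     (\<forall>x\<in>points X. s x \<in> regular X (nbd L x)) \<and>
     (\<forall>x\<in>points X. \<forall>y\<in>points X. \<forall>z \<in> nbd L x \<inter> nbd L y. s x z = trans L x y z * s y z)"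

definition lb_tensor :: "'a cocycle \<Rightarrow> 'a cocycle \<Rightarrow> 'a cocycle" where
  "lb_tensor L M = \<lparr>nbd = (\<lambda>x. nbd L x \<inter> nbd M x), trans = (\<lambda>x y z. trans L x y z * trans M x y z)\<rparr>"

definition lb_dual :: "'a cocycle \<Rightarrow> 'a cocycle" where
  "lb_dual L = \<lparr>nbd = nbd L, trans = (\<lambda>x y z. inverse (trans L x y z))\<rparr>"

definition lb_power :: "'a cocycle \<Rightarrow> nat \<Rightarrow> 'a cocycle" where
  "lb_power L k = \<lparr>nbd = nbd L, trans = (\<lambda>x y z. trans L x y z ^ k)\<rparr>"

definition base_locus :: "'a fun_space \<Rightarrow> 'a cocycle \<Rightarrow> 'a set" where
  "base_locus X L = {x \<in> points X. \<forall>s. is_section X L s \<longrightarrow> s x x = 0}"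

definition stable_base_locus :: "'a fun_space \<Rightarrow> 'a cocycle \<Rightarrow> 'a set" where
  "stable_base_locus X L = (\<Inter>m\<in>{1..}. base_locus X (lb_power L m))"

text \<open>The augmented base locus of \<open>L\<close>, computed with the auxiliary ample line bundle \<open>A\<close>.\<close>

definition augmented_base_locus :: "'a fun_space \<Rightarrow> 'a cocycle \<Rightarrow> 'a cocycle \<Rightarrow> 'a set" where
  "augmented_base_locus X L A = (\<Inter>q. stable_base_locus X (lb_tensor (lb_power L q) (lb_dual A)))"


section \<open>The Proj construction\<close>

text \<open>
  Points of a projectivisation are equivalence classes of representatives under rescaling. The
  parameter \<open>S\<close> lists, in every degree, the available homogeneous functions: \<open>(D, F) \<in> S m\<close> means
  that \<open>F\<close> is a function of degree \<open>m\<close> of the representatives of the points in \<open>D\<close>.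
\<close>

inductive homogeneous ::
    "('r \<Rightarrow> complex) set \<Rightarrow> ('r \<Rightarrow> complex) set \<Rightarrow> nat \<Rightarrow> ('r \<Rightarrow> complex) \<Rightarrow> bool"
  for C G where
  degree_zero: "c \<in> C \<Longrightarrow> homogeneous C G 0 c"
| degree_one: "g \<in> G \<Longrightarrow> homogeneous C G 1 g"
| add: "homogeneous C G m F \<Longrightarrow> homogeneous C G m F' \<Longrightarrow> homogeneous C G m (\<lambda>r. F r + F' r)"
| mult: "homogeneous C G m F \<Longrightarrow> homogeneous C G k F' \<Longrightarrow> homogeneous C G (m + k) (\<lambda>r. F r * F' r)"

definition nonvanishing :: "'r set set \<Rightarrow> ('r \<Rightarrow> complex) \<Rightarrow> 'r set set" where
  "nonvanishing D F = {\<xi> \<in> D. \<forall>r\<in>\<xi>. F r \<noteq> 0}"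

definition Proj :: "(nat \<Rightarrow> ('r set set \<times> ('r \<Rightarrow> complex)) set) \<Rightarrow> 'r set fun_space" where
  "Proj S =
     \<lparr>zariski = topology_generated_by {nonvanishing D F | D F m. (D, F) \<in> S m},
      regular = (\<lambda>W. {\<phi>. \<forall>\<xi>\<in>W. \<exists>m D F G. (D, F) \<in> S m \<and> (D, G) \<in> S m \<and> \<xi> \<in> nonvanishing D G \<and>
                          (\<forall>\<eta> \<in> W \<inter> nonvanishing D G. \<forall>r\<in>\<eta>. \<phi> \<eta> = F r / G r)})\<rparr>"

text \<open>
  The cocycle of \<open>\<O>(1)\<close>: near \<open>\<xi>\<close> it is trivialised by some homogeneous function of degree one
  that does not vanish at \<open>\<xi>\<close>, so that a global function \<open>F\<close> of degree one defines the section
  with local expressions \<open>F / G\<^sub>\<xi>\<close>.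
\<close>

definition degree_one_frame ::
    "(nat \<Rightarrow> ('r set set \<times> ('r \<Rightarrow> complex)) set) \<Rightarrow> 'r set \<Rightarrow> 'r set set \<times> ('r \<Rightarrow> complex)" where
  "degree_one_frame S \<xi> = (SOME (D, G). (D, G) \<in> S 1 \<and> \<xi> \<in> nonvanishing D G)"

definition twisting_bundle :: "(nat \<Rightarrow> ('r set set \<times> ('r \<Rightarrow> complex)) set) \<Rightarrow> 'r set cocycle" where
  "twisting_bundle S =
     \<lparr>nbd = (\<lambda>\<xi>. case degree_one_frame S \<xi> of (D, G) \<Rightarrow> nonvanishing D G),
      trans = (\<lambda>\<xi> \<eta> \<zeta>. snd (degree_one_frame S \<eta>) (SOME r. r \<in> \<zeta>) /
                       snd (degree_one_frame S \<xi>) (SOME r. r \<in> \<zeta>))\<rparr>"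


section \<open>Projective space\<close>

text \<open>
  Coordinates are indexed by \<open>0, \<dots>, n\<close>, and vectors vanish beyond index \<open>n\<close>. A point is the set of
  nonzero multiples of a nonzero vector. The dual projective space is \<open>proj_points n\<close> as well, with
  the pairing \<open>lin n\<close>.
\<close>

type_synonym vec = "nat \<Rightarrow> complex"

definition vecs :: "nat \<Rightarrow> vec set" where
  "vecs n = {v. \<forall>i>n. v i = 0}"

definition lin :: "nat \<Rightarrow> vec \<Rightarrow> vec \<Rightarrow> complex" where
  "lin n a v = (\<Sum>i\<le>n. a i * v i)"

definition pclass :: "vec \<Rightarrow> vec set" where
  "pclass v = {\<lambda>i. c * v i | c. c \<noteq> 0}"

definition proj_points :: "nat \<Rightarrow> vec set set" where
  "proj_points n = pclass ` (vecs n - {\<lambda>_. 0})"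

definition hom_poly :: "nat \<Rightarrow> nat \<Rightarrow> (vec \<Rightarrow> complex) \<Rightarrow> bool" where
  "hom_poly n = homogeneous {\<lambda>_. c | c. True} {\<lambda>v. v i | i. i \<le> n}"

definition proj_space :: "nat \<Rightarrow> vec set fun_space" where
  "proj_space n = Proj (\<lambda>m. {(proj_points n, F) | F. hom_poly n m F})"


section \<open>Ample line bundles\<close>

definition very_ample :: "'a fun_space \<Rightarrow> 'a cocycle \<Rightarrow> bool" where
  "very_ample X L \<longleftrightarrow>
     (\<exists>N s. (\<forall>i\<le>N. is_section X L (s i)) \<and> (\<forall>x\<in>points X. \<exists>i\<le>N. s i x x \<noteq> 0) \<and>
            closed_immersion X (proj_space N) (\<lambda>x. pclass (\<lambda>i. if i \<le> N then s i x x else 0)))"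

definition ample :: "'a fun_space \<Rightarrow> 'a cocycle \<Rightarrow> bool" where
  "ample X L \<longleftrightarrow> line_bundle X L \<and> (\<exists>m\<ge>1. very_ample X (lb_power L m))"


section \<open>Hyperplane arrangements\<close>

text \<open>
  An arrangement is a finite set of points of the dual projective space. The same function
  \<open>hyperplane\<close> gives the hyperplanes of the dual space.
\<close>

definition hyperplane :: "nat \<Rightarrow> vec set \<Rightarrow> vec set set" where
  "hyperplane n H = {x \<in> proj_points n. \<forall>a\<in>H. \<forall>v\<in>x. lin n a v = 0}"

definition arr_union :: "nat \<Rightarrow> vec set set \<Rightarrow> vec set set" where
  "arr_union n \<A> = (\<Union>H\<in>\<A>. hyperplane n H)"

definition is_hyperplane :: "nat \<Rightarrow> vec set set \<Rightarrow> bool" where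
  "is_hyperplane n Z \<longleftrightarrow> (\<exists>b \<in> proj_points n. Z = hyperplane n b)"

definition is_quadric :: "nat \<Rightarrow> vec set set \<Rightarrow> bool" where
  "is_quadric n Z \<longleftrightarrow>
     (\<exists>Q. hom_poly n 2 Q \<and> (\<exists>v \<in> vecs n. Q v \<noteq> 0) \<and> Z = {x \<in> proj_points n. \<forall>v\<in>x. Q v = 0})"

definition general_position_hyperplanes :: "nat \<Rightarrow> vec set set \<Rightarrow> bool" where
  "general_position_hyperplanes n \<A> \<longleftrightarrow>
     \<not> (\<exists>T Z. T \<subseteq> \<A> \<and> card T = n + 1 \<and> is_hyperplane n Z \<and> T \<subseteq> Z)"

definition general_position_quadrics :: "nat \<Rightarrow> vec set set \<Rightarrow> bool" where
  "general_position_quadrics n \<A> \<longleftrightarrow>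
     \<not> (\<exists>T Z. T \<subseteq> \<A> \<and> card T = (n + 2) choose 2 \<and> is_quadric n Z \<and> T \<subseteq> Z)"


section \<open>Logarithmic one-forms\<close>

text \<open>
  The tangent space of projective space at \<open>pclass v\<close> is the space of vectors \<open>w\<close> modulo \<open>v\<close>, where
  \<open>w\<close> is the velocity at \<open>t = 0\<close> of the curve \<open>pclass (v + t w)\<close>. A one-form is a function of such
  \<open>v\<close> and \<open>w\<close>.
\<close>

type_synonym form = "vec \<Rightarrow> vec \<Rightarrow> complex"

definition differential :: "(vec set \<Rightarrow> complex) \<Rightarrow> form" where
  "differential g v w = deriv (\<lambda>t. g (pclass (\<lambda>i. v i + t * w i))) 0"

definition dlog :: "(vec set \<Rightarrow> complex) \<Rightarrow> form" where
  "dlog g v w = differential g v w / g (pclass v)"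

definition forms_agree_on :: "nat \<Rightarrow> vec set set \<Rightarrow> form \<Rightarrow> form \<Rightarrow> bool" where
  "forms_agree_on n W \<omega> \<omega>' \<longleftrightarrow> (\<forall>v. pclass v \<in> W \<longrightarrow> (\<forall>w \<in> vecs n. \<omega> v w = \<omega>' v w))"

text \<open>A local equation of the hyperplane \<open>H\<close> where the linear form \<open>b\<close> does not vanish.\<close>

definition local_equation :: "nat \<Rightarrow> vec set \<Rightarrow> vec \<Rightarrow> vec set \<Rightarrow> complex" where
  "local_equation n H b x = lin n (SOME a. a \<in> H) (SOME v. v \<in> x) / lin n b (SOME v. v \<in> x)"

text \<open>
  Sections over \<open>U\<close> of the logarithmic cotangent sheaf of a simple normal crossings arrangement: the
  one-forms on \<open>U\<close> minus the arrangement that are locally sums of regular forms \<open>f dg\<close> and regular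
  multiples of \<open>dt / t\<close>, where \<open>t\<close> is a local equation of one of the hyperplanes. Where \<open>H\<close> does not
  pass, its local equation is a unit and \<open>dt / t\<close> is regular.
\<close>

definition log_forms :: "nat \<Rightarrow> vec set set \<Rightarrow> vec set set \<Rightarrow> form set" where
  "log_forms n \<A> U =
     {\<omega>. \<forall>x\<in>U. \<exists>V. zopen (proj_space n) V \<and> x \<in> V \<and> V \<subseteq> U \<and>
           (\<exists>(N::nat) f g h b.
              (\<forall>k<N. f k \<in> regular (proj_space n) V \<and> g k \<in> regular (proj_space n) V) \<and>
              (\<forall>H\<in>\<A>. h H \<in> regular (proj_space n) V) \<and>
              (\<forall>y\<in>V. \<forall>v\<in>y. lin n b v \<noteq> 0) \<and>
              forms_agree_on n (V - arr_union n \<A>) \<omega>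
                (\<lambda>v w. (\<Sum>k<N. f k (pclass v) * differential (g k) v w) +
                       (\<Sum>H\<in>\<A>. h H (pclass v) * dlog (local_equation n H b) v w)))}"

definition log_stalk :: "nat \<Rightarrow> vec set set \<Rightarrow> vec set \<Rightarrow> form set" where
  "log_stalk n \<A> x = (\<Union>U \<in> {U. zopen (proj_space n) U \<and> x \<in> U}. log_forms n \<A> U)"


section \<open>The projectivised logarithmic cotangent bundle\<close>

text \<open>
  The dual of the fibre at \<open>x\<close> (the stalk modulo the maximal ideal of \<open>x\<close>): the functions of germs
  that are additive and kill multiples of germs by functions vanishing at \<open>x\<close>. The value
  outside the stalk is fixed to be \<open>0\<close>.
\<close>

definition log_fibre_dual :: "nat \<Rightarrow> vec set set \<Rightarrow> vec set \<Rightarrow> (form \<Rightarrow> complex) set" where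
  "log_fibre_dual n \<A> x =
     {l. (\<forall>\<omega> \<in> log_stalk n \<A> x. \<forall>\<omega>' \<in> log_stalk n \<A> x. l (\<lambda>v w. \<omega> v w + \<omega>' v w) = l \<omega> + l \<omega>') \<and>
         (\<forall>\<omega> \<in> log_stalk n \<A> x. \<forall>U f. zopen (proj_space n) U \<and> x \<in> U \<and> f \<in> regular (proj_space n) U \<longrightarrow>
            l (\<lambda>v w. f (pclass v) * \<omega> v w) = f x * l \<omega>) \<and>
         (\<forall>\<omega> \<in> log_stalk n \<A> x. \<forall>\<omega>' \<in> log_stalk n \<A> x. \<forall>U. zopen (proj_space n) U \<and> x \<in> U \<and>
            forms_agree_on n (U - arr_union n \<A>) \<omega> \<omega>' \<longrightarrow> l \<omega> = l \<omega>') \<and>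
         (\<forall>\<omega>. \<omega> \<notin> log_stalk n \<A> x \<longrightarrow> l \<omega> = 0)}"

text \<open>Rank one quotients of the fibres over \<open>U\<close>, that is, nonzero functionals up to scaling.\<close>

definition log_quotients :: "nat \<Rightarrow> vec set set \<Rightarrow> vec set set \<Rightarrow> (vec set \<times> (form \<Rightarrow> complex)) set set" where
  "log_quotients n \<A> U =
     {{(x, \<lambda>\<omega>. c * l \<omega>) | c. c \<noteq> 0} | x l. x \<in> U \<and> l \<in> log_fibre_dual n \<A> x \<and> l \<noteq> (\<lambda>_. 0)}"

text \<open>
  The symmetric algebra of the logarithmic cotangent sheaf over \<open>U\<close>, acting as homogeneous functions
  on the dual bundle.
\<close>

definition log_symmetric ::
    "nat \<Rightarrow> vec set set \<Rightarrow> nat \<Rightarrow>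
       ((vec set \<times> (form \<Rightarrow> complex)) set set \<times> (vec set \<times> (form \<Rightarrow> complex) \<Rightarrow> complex)) set" where
  "log_symmetric n \<A> m =
     {(log_quotients n \<A> U, F) | U F. zopen (proj_space n) U \<and>
        homogeneous {\<lambda>(x, l). f x | f. f \<in> regular (proj_space n) U}
                    {\<lambda>(x, l). l \<omega> | \<omega>. \<omega> \<in> log_forms n \<A> U} m F}"

definition proj_log_cotangent ::
    "nat \<Rightarrow> vec set set \<Rightarrow> (vec set \<times> (form \<Rightarrow> complex)) set fun_space" where
  "proj_log_cotangent n \<A> = Proj (log_symmetric n \<A>)"

definition log_O1 :: "nat \<Rightarrow> vec set set \<Rightarrow> (vec set \<times> (form \<Rightarrow> complex)) set cocycle" where
  "log_O1 n \<A> = twisting_bundle (log_symmetric n \<A>)"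

definition bundle_proj :: "(vec set \<times> (form \<Rightarrow> complex)) set \<Rightarrow> vec set" where
  "bundle_proj \<xi> = the_elem (fst ` \<xi>)"

end

theory Submission
  imports Defs "HOL-Computational_Algebra.Fundamental_Theorem_Algebra"
begin

text \<open>
  A functional on a fibre is determined by its values \<open>Y H\<close> on the global forms
  \<open>dlog (l\<^sub>H / l\<^sub>H\<^sub>0)\<close>. This embeds the projectivised bundle in a product of projective spaces as
  the set of pairs \<open>([v], [Y])\<close> with \<open>Y H0 = 0\<close> for which some \<open>w\<close> satisfies
  \<open>l\<^sub>H(w) = l\<^sub>H(v) Y H\<close> for all hyperplanes \<open>H\<close>.
  If \<open>v\<close> is not on the arrangement and \<open>(v', w')\<close> is another solution for the same \<open>Y\<close>, then the
  quadric \<open>a(w') a(v) - a(w) a(v')\<close> in the dual space contains all hyperplanes of the arrangement,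
  hence vanishes, and \<open>(v', w')\<close> is a multiple of \<open>(v, w)\<close>. So the linear system can be solved for
  \<open>(v, w)\<close> near this point with coefficients that are polynomials in \<open>Y\<close>, and every neighbourhood
  of the point contains the complement of the zeros of a section \<open>F\<close> of some power of \<open>O(1)\<close>
  that does not vanish at the point. A local trivialisation of \<open>A\<^sup>-\<^sup>1\<close>, multiplied by a high power
  of \<open>F\<close>, extends to a global section by the Nullstellensatz.
\<close>

section \<open>Nullstellensatz\<close>

text \<open>The number binom(n+2,2) is the dimension of the space of quadratic forms in n+1
  variables; general position implies that no nonzero quadric contains the whole arrangement. The
  quadric of the overview is the difference of two products of linear forms, w' v - w v'. Its
  vanishing is an identity in a polynomial ring, and unique factorisation makes (v', w')
  proportional to (v, w) unless w is a multiple of v. That exception would make all Y H equal, hence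
  0 because Y H0 = 0; this is where v has to lie off the arrangement. The fibres are defined by
  germs of forms, without coordinates. Two facts make them explicit: as far as functionals can see,
  every logarithmic form is locally a regular combination of the forms dlog (l_H / l_H0), and every
  solution Y of the equations does come from a functional. As \<open>A\<close> is given by a
  cocycle, a section of q L - A has to be produced from transition functions. Their poles along the
  zeros of F must be bounded uniformly, which rests on quasi-compactness of affine charts and on the
  shape of regular functions on principal open sets; both follow from the Nullstellensatz.\<close>

lemma homogeneous_system_nontrivial_solution:
  fixes c :: "'r \<Rightarrow> 'j \<Rightarrow> complex"
  assumes "finite I" "finite J" "card I < card J"
  shows "\<exists>x. (\<exists>j\<in>J. x j \<noteq> 0) \<and> (\<forall>j. j \<notin> J \<longrightarrow> x j = 0) \<and> (\<forall>i\<in>I. (\<Sum>j\<in>J. c i j * x j) = 0)"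
  using assms
proof (induction I arbitrary: J c rule: finite_induct)
  case empty
  then obtain j where "j \<in> J" by fastforce
  then show ?case by (intro exI[of _ "\<lambda>i. if i = j then 1 else 0"]) auto
next
  case (insert i0 I)
  show ?case
  proof (cases "\<forall>j\<in>J. c i0 j = 0")
    case True
    have "card I < card J" using insert by simp
    from insert.IH[OF insert.prems(1) this] obtain x where
      "(\<exists>j\<in>J. x j \<noteq> 0)" "\<forall>j. j \<notin> J \<longrightarrow> x j = 0" "\<forall>i\<in>I. (\<Sum>j\<in>J. c i j * x j) = 0" by blast
    with True show ?thesis by (intro exI[of _ x]) auto
  next
    case False
    \<comment> \<open>Gaussian elimination: row \<open>i0\<close> is solved for the pivot unknown
      \<open>p\<close>, which is substituted into the remaining rows, so that one equation and one
      unknown disappear together.\<close>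
    then obtain p where p: "p \<in> J" "c i0 p \<noteq> 0" by blast
    define J' where "J' = J - {p}"
    have J: "J = insert p J'" "p \<notin> J'" "finite J'" using p insert.prems unfolding J'_def by auto
    have "card I < card J'" using insert J by auto
    from insert.IH[OF J(3) this, of "\<lambda>i j. c i j - c i p * c i0 j / c i0 p"] obtain x where x:
      "\<exists>j\<in>J'. x j \<noteq> 0" "\<forall>j. j \<notin> J' \<longrightarrow> x j = 0"
      "\<forall>i\<in>I. (\<Sum>j\<in>J'. (c i j - c i p * c i0 j / c i0 p) * x j) = 0" by blast
    define x' where "x' = x(p := - (\<Sum>j\<in>J'. c i0 j * x j) / c i0 p)"
    have sum: "(\<Sum>j\<in>J. c i j * x' j) = c i p * x' p + (\<Sum>j\<in>J'. c i j * x j)" for i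
    proof -
      have "(\<Sum>j\<in>J'. c i j * x' j) = (\<Sum>j\<in>J'. c i j * x j)"
        using J by (intro sum.cong) (auto simp: x'_def)
      then show ?thesis using J by simp
    qed
    have "(\<Sum>j\<in>J. c i j * x' j) = 0" if "i \<in> insert i0 I" for i
    proof (cases "i = i0")
      case True
      then show ?thesis using p by (simp add: sum) (simp add: x'_def)
    next
      case False
      then have "(\<Sum>j\<in>J'. (c i j - c i p * c i0 j / c i0 p) * x j) = 0" using x that by auto
      then have "(\<Sum>j\<in>J'. c i j * x j) = (\<Sum>j\<in>J'. c i p / c i0 p * (c i0 j * x j))"
        by (simp add: algebra_simps sum_subtractf)
      also have "\<dots> = - c i p * x' p"
        unfolding sum_distrib_left[symmetric] x'_def by simp
      finally show ?thesis by (simp add: sum)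
    qed
    moreover have "\<exists>j\<in>J. x' j \<noteq> 0" using x J by (auto simp: x'_def)
    moreover have "\<forall>j. j \<notin> J \<longrightarrow> x' j = 0" using x(2) J by (auto simp: x'_def)
    ultimately show ?thesis by blast
  qed
qed

section \<open>Polynomial functions in a set of variables\<close>

inductive pol :: "'i set \<Rightarrow> (('i \<Rightarrow> complex) \<Rightarrow> complex) \<Rightarrow> bool" for I where
  const: "pol I (\<lambda>_. c)"
| var: "i \<in> I \<Longrightarrow> pol I (\<lambda>z. z i)"
| add: "pol I P \<Longrightarrow> pol I Q \<Longrightarrow> pol I (\<lambda>z. P z + Q z)"
| mult: "pol I P \<Longrightarrow> pol I Q \<Longrightarrow> pol I (\<lambda>z. P z * Q z)"

lemma pol_uminus: "pol I P \<Longrightarrow> pol I (\<lambda>z. - P z)"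
  using pol.mult[OF pol.const[of I "-1"]] by fastforce

lemma pol_diff: "pol I P \<Longrightarrow> pol I Q \<Longrightarrow> pol I (\<lambda>z. P z - Q z)"
  using pol.add[OF _ pol_uminus] by fastforce

lemma pol_sum: "(\<And>t. t \<in> T \<Longrightarrow> pol I (P t)) \<Longrightarrow> pol I (\<lambda>z. \<Sum>t\<in>T. P t z)"
  by (induction T rule: infinite_finite_induct) (auto intro: pol.intros)

lemma pol_prod: "(\<And>t. t \<in> T \<Longrightarrow> pol I (P t)) \<Longrightarrow> pol I (\<lambda>z. \<Prod>t\<in>T. P t z)"
  by (induction T rule: infinite_finite_induct) (auto intro: pol.intros)

lemma pol_power: "pol I P \<Longrightarrow> pol I (\<lambda>z. P z ^ k)"
  by (induction k) (auto intro: pol.intros)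

lemmas pol_intros = pol.intros pol_uminus pol_diff pol_sum pol_prod pol_power

text \<open>Polynomials are represented by the functions they define, so a finite support has to be
  recovered. A monomial is the list of its variables; it may occur under several orderings, which is
  harmless. What matters is that \<open>S\<close> is a finite set of lists over \<open>I\<close>:
  for countable \<open>I\<close> there are only countably many candidates for
  \<open>S\<close>.\<close>

lemma pol_monomial_expansion:
  assumes "pol I P"
  shows "\<exists>S c. finite S \<and> S \<subseteq> lists I \<and> (\<forall>z. P z = (\<Sum>xs\<in>S. c xs * prod_list (map z xs)))"
  using assms
proof induction
  case (const c)
  show ?case by (intro exI[of _ "{[]}"] exI[of _ "\<lambda>_. c"]) simp
next
  case (var i)
  then have "{[i]} \<subseteq> lists I" by simp
  then show ?case by (intro exI[of _ "{[i]}"] exI[of _ "\<lambda>_. 1"]) simp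
next
  case (add P Q)
  from add.IH(1) obtain S c where S: "finite S" "S \<subseteq> lists I"
    and P: "\<And>z. P z = (\<Sum>xs\<in>S. c xs * prod_list (map z xs))" by auto
  from add.IH(2) obtain S' c' where S': "finite S'" "S' \<subseteq> lists I"
    and Q: "\<And>z. Q z = (\<Sum>xs\<in>S'. c' xs * prod_list (map z xs))" by auto
  note S = S S'
  define d where "d xs = (if xs \<in> S then c xs else 0) + (if xs \<in> S' then c' xs else 0)" for xs
  have "P z + Q z = (\<Sum>xs\<in>S \<union> S'. d xs * prod_list (map z xs))" for z
  proof -
    have "P z = (\<Sum>xs\<in>S \<union> S'. (if xs \<in> S then c xs else 0) * prod_list (map z xs))"
      unfolding P using S(1,3) by (intro sum.mono_neutral_cong_left) auto
    moreover have "Q z = (\<Sum>xs\<in>S \<union> S'. (if xs \<in> S' then c' xs else 0) * prod_list (map z xs))"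
      unfolding Q using S(1,3) by (intro sum.mono_neutral_cong_left) auto
    ultimately show ?thesis by (simp only: d_def sum.distrib distrib_right)
  qed
  moreover have "finite (S \<union> S')" "S \<union> S' \<subseteq> lists I" using S by auto
  ultimately show ?case by blast
next
  case (mult P Q)
  from mult.IH(1) obtain S c where S: "finite S" "S \<subseteq> lists I"
    and P: "\<And>z. P z = (\<Sum>xs\<in>S. c xs * prod_list (map z xs))" by auto
  from mult.IH(2) obtain S' c' where S': "finite S'" "S' \<subseteq> lists I"
    and Q: "\<And>z. Q z = (\<Sum>xs\<in>S'. c' xs * prod_list (map z xs))" by auto
  note S = S S'
  define f where "f p = fst p @ snd p" for p :: "'a list \<times> 'a list"
  define T where "T = f ` (S \<times> S')"
  define d where "d us = (\<Sum>p \<in> {p \<in> S \<times> S'. f p = us}. c (fst p) * c' (snd p))" for us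
  have "P z * Q z = (\<Sum>us\<in>T. d us * prod_list (map z us))" for z
  proof -
    have "P z * Q z = (\<Sum>p\<in>S \<times> S'. c (fst p) * c' (snd p) * prod_list (map z (f p)))"
      unfolding P Q sum_product sum.cartesian_product
      by (intro sum.cong) (auto simp: f_def)
    also have "\<dots> = (\<Sum>us\<in>T. \<Sum>p \<in> {p \<in> S \<times> S'. f p = us}. c (fst p) * c' (snd p) * prod_list (map z (f p)))"
      unfolding T_def using S(1,3) by (intro sum.image_gen) simp
    also have "\<dots> = (\<Sum>us\<in>T. d us * prod_list (map z us))"
      unfolding d_def sum_distrib_right by (intro sum.cong refl) simp
    finally show ?thesis .
  qed
  moreover have "finite T" using S by (simp add: T_def)
  moreover have "T \<subseteq> lists I"
  proof
    fix us assume "us \<in> T"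
    then obtain p where p: "p \<in> S \<times> S'" "us = f p" unfolding T_def by blast
    then have "fst p \<in> lists I" "snd p \<in> lists I" using S(2,4) by (auto simp only: mem_Times_iff)
    then show "us \<in> lists I" unfolding p(2) f_def append_in_lists_conv by simp
  qed
  ultimately show ?case by blast
qed

section \<open>Ideals of polynomial functions and residue fields\<close>

definition pol_ideal :: "'i set \<Rightarrow> (('i \<Rightarrow> complex) \<Rightarrow> complex) set \<Rightarrow> bool" where
  "pol_ideal I M \<longleftrightarrow> M \<subseteq> Collect (pol I) \<and> (\<lambda>_. 0) \<in> M \<and>
     (\<forall>P\<in>M. \<forall>Q\<in>M. (\<lambda>z. P z + Q z) \<in> M) \<and> (\<forall>P\<in>M. \<forall>Q. pol I Q \<longrightarrow> (\<lambda>z. Q z * P z) \<in> M)"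

lemma pol_ideal_sum:
  assumes "pol_ideal I M" "\<And>t. t \<in> T \<Longrightarrow> P t \<in> M"
  shows "(\<lambda>z. \<Sum>t\<in>T. P t z) \<in> M"
  using assms(2) by (induction T rule: infinite_finite_induct) (use assms(1) in \<open>auto simp: pol_ideal_def\<close>)

lemma pol_idealD:
  assumes "pol_ideal I M"
  shows "P \<in> M \<Longrightarrow> pol I P" "(\<lambda>_. 0) \<in> M" "P \<in> M \<Longrightarrow> Q \<in> M \<Longrightarrow> (\<lambda>z. P z + Q z) \<in> M"
    "P \<in> M \<Longrightarrow> pol I Q \<Longrightarrow> (\<lambda>z. Q z * P z) \<in> M"
  using assms unfolding pol_ideal_def by blast+

lemma pol_ideal_adjoin:
  assumes M: "pol_ideal I M" and P: "pol I P"
  shows "pol_ideal I {\<lambda>z. Q z + U z * P z | Q U. Q \<in> M \<and> pol I U}" (is "pol_ideal I ?N")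
proof -
  have N: "(\<lambda>z. Q z + U z * P z) \<in> ?N" if "Q \<in> M" "pol I U" for Q U
    using that by blast
  have 1: "?N \<subseteq> Collect (pol I)" using pol_idealD(1)[OF M] pol.add pol.mult[OF _ P] by blast
  have 2: "(\<lambda>_. 0) \<in> ?N" using N[OF pol_idealD(2)[OF M] pol.const[of I 0]] by simp
  have 3: "(\<lambda>z. A z + B z) \<in> ?N" if "A \<in> ?N" "B \<in> ?N" for A B
  proof -
    from that obtain Q U Q' U' where *: "A = (\<lambda>z. Q z + U z * P z)" "Q \<in> M" "pol I U"
       "B = (\<lambda>z. Q' z + U' z * P z)" "Q' \<in> M" "pol I U'" by blast
    then show ?thesis using N[OF pol_idealD(3)[OF M *(2) *(5)] pol.add[OF *(3) *(6)]]
      by (simp add: algebra_simps)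
  qed
  have 4: "(\<lambda>z. B z * A z) \<in> ?N" if "A \<in> ?N" "pol I B" for A B
  proof -
    from that obtain Q U where *: "A = (\<lambda>z. Q z + U z * P z)" "Q \<in> M" "pol I U" by blast
    then show ?thesis using N[OF pol_idealD(4)[OF M *(2) that(2)] pol.mult[OF that(2) *(3)]]
      by (simp add: algebra_simps)
  qed
  show ?thesis unfolding pol_ideal_def by (intro conjI ballI allI impI 1 2 3 4)
qed

text \<open>Zorn's lemma for the proper ideals containing \<open>M0\<close>. Maximality is returned
  as invertibility modulo \<open>M\<close> of everything outside \<open>M\<close>, that is, the
  quotient is a field.\<close>

lemma pol_ideal_maximal:
  assumes "pol_ideal I M0" "(\<lambda>_. 1) \<notin> M0"
  obtains M where "pol_ideal I M" "M0 \<subseteq> M" "(\<lambda>_. 1) \<notin> M"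
    "\<And>P. pol I P \<Longrightarrow> P \<notin> M \<Longrightarrow> \<exists>U Q. pol I U \<and> Q \<in> M \<and> (\<forall>z. U z * P z = 1 + Q z)"
proof -
  define \<J> where "\<J> = {M. pol_ideal I M \<and> M0 \<subseteq> M \<and> (\<lambda>_. 1) \<notin> M}"
  have "\<exists>M\<in>\<J>. \<forall>X\<in>\<J>. M \<subseteq> X \<longrightarrow> X = M"
  proof (rule subset_Zorn_nonempty)
    show "\<J> \<noteq> {}" using assms by (auto simp: \<J>_def)
  next
    fix \<C> assume C: "\<C> \<noteq> {}" "subset.chain \<J> \<C>"
    have sub: "\<C> \<subseteq> \<J>" and lin: "\<And>A B. A \<in> \<C> \<Longrightarrow> B \<in> \<C> \<Longrightarrow> A \<subseteq> B \<or> B \<subseteq> A"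
      using C(2) by (auto simp: subset_chain_def)
    have id: "\<And>A. A \<in> \<C> \<Longrightarrow> pol_ideal I A" using sub by (auto simp: \<J>_def)
    have add: "(\<lambda>z. P z + Q z) \<in> \<Union>\<C>" if PQ: "P \<in> \<Union>\<C>" "Q \<in> \<Union>\<C>" for P Q
    proof -
      obtain A B where AB: "A \<in> \<C>" "B \<in> \<C>" "P \<in> A" "Q \<in> B" using PQ by blast
      then have "P \<in> A \<union> B" "Q \<in> A \<union> B" "A \<union> B \<in> \<C>" using lin[OF AB(1,2)] by (auto simp: sup.absorb1 sup.absorb2)
      then have "(\<lambda>z. P z + Q z) \<in> A \<union> B" using pol_idealD(3)[OF id[of "A \<union> B"]] by blast
      then show ?thesis using AB by blast
    qed
    have zero: "(\<lambda>_. 0) \<in> \<Union>\<C>" using C(1) pol_idealD(2)[OF id] by blast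
    have mult: "(\<lambda>z. Q z * P z) \<in> \<Union>\<C>" if "P \<in> \<Union>\<C>" "pol I Q" for P Q
      using that pol_idealD(4)[OF id] by blast
    have "\<Union>\<C> \<subseteq> Collect (pol I)" using pol_idealD(1)[OF id] by blast
    then have "pol_ideal I (\<Union>\<C>)"
      using add zero mult unfolding pol_ideal_def by blast
    then show "\<Union>\<C> \<in> \<J>" using C(1) sub by (auto simp: \<J>_def)
  qed
  then obtain M where M: "pol_ideal I M" "M0 \<subseteq> M" "(\<lambda>_. 1) \<notin> M"
    and max: "\<And>X. X \<in> \<J> \<Longrightarrow> M \<subseteq> X \<Longrightarrow> X = M" by (auto simp: \<J>_def)
  have "\<exists>U Q. pol I U \<and> Q \<in> M \<and> (\<forall>z. U z * P z = 1 + Q z)" if P: "pol I P" "P \<notin> M" for P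
  proof -
    \<comment> \<open>By maximality, the ideal generated by \<open>M\<close> and \<open>P\<close>
      contains 1; the coefficient of \<open>P\<close> in such a representation of 1 is the
      inverse.\<close>
    define N where "N = {\<lambda>z. Q z + U z * P z | Q U. Q \<in> M \<and> pol I U}"
    have id: "pol_ideal I N" unfolding N_def using M P by (intro pol_ideal_adjoin)
    have sub: "M \<subseteq> N"
    proof
      fix Q assume "Q \<in> M"
      then show "Q \<in> N" unfolding N_def using pol.const[of I 0]
        by (intro CollectI exI[of _ Q] exI[of _ "\<lambda>_. 0"]) auto
    qed
    have "P \<in> N" unfolding N_def using pol.const[of I 1] pol_idealD(2)[OF M(1)]
      by (intro CollectI exI[of _ "\<lambda>_. 0"] exI[of _ "\<lambda>_. 1"]) simp
    then have "N \<noteq> M" using P by blast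
    then have "(\<lambda>_. 1) \<in> N" using max[of N] id sub M(2) by (auto simp: \<J>_def)
    then obtain Q U where QU: "Q \<in> M" "pol I U" "(\<lambda>_. 1) = (\<lambda>z. Q z + U z * P z)"
      unfolding N_def by blast
    have "U z * P z = 1 + - Q z" for z using fun_cong[OF QU(3), of z] by (simp add: algebra_simps)
    moreover have "(\<lambda>z. - Q z) \<in> M"
      using pol_idealD(4)[OF M(1) QU(1) pol.const[of I "-1"]] by simp
    ultimately show ?thesis using QU by (intro exI[of _ U] exI[of _ "\<lambda>z. - Q z"]) auto
  qed
  with M that show ?thesis by blast
qed

text \<open>The residue field of a maximal ideal has countable dimension, while an element \<open>t\<close> outside of
  the constants would give the uncountable linearly independent family \<open>1 / (t - c)\<close>.\<close>

lemma pol_maximal_ideal_coordinate: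
  assumes cI: "countable I" and M: "pol_ideal I M" "(\<lambda>_. 1) \<notin> M"
    and inv: "\<And>P. pol I P \<Longrightarrow> P \<notin> M \<Longrightarrow> \<exists>U Q. pol I U \<and> Q \<in> M \<and> (\<forall>z. U z * P z = 1 + Q z)"
    and i: "i \<in> I"
  shows "\<exists>c. (\<lambda>z. z i - c) \<in> M"
proof (rule ccontr)
  assume no: "\<nexists>c. (\<lambda>z. z i - c) \<in> M"
  \<comment> \<open>In the residue field, \<open>U c\<close> represents 1 / (z i - c). It exists for
    every complex \<open>c\<close>, because no \<open>z i - c\<close> lies in
    \<open>M\<close>.\<close>
  have "\<exists>U Q. pol I U \<and> Q \<in> M \<and> (\<forall>z. U z * (z i - c) = 1 + Q z)" for c
    using no i by (intro inv) (auto intro!: pol_intros)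
  then obtain U Q where UQ: "\<And>c. pol I (U c)" "\<And>c. Q c \<in> M" "\<And>c z. U c z * (z i - c) = 1 + Q c z"
    by metis
  have "\<forall>c. \<exists>S k. finite S \<and> S \<subseteq> lists I \<and> (\<forall>z. U c z = (\<Sum>xs\<in>S. k xs * prod_list (map z xs)))"
    using pol_monomial_expansion[OF UQ(1)] by blast
  then obtain S k where S: "\<And>c. finite (S c)" "\<And>c. S c \<subseteq> lists I"
    "\<And>c z. U c z = (\<Sum>xs\<in>S c. k c xs * prod_list (map z xs))" by metis
  have "countable (Collect (\<lambda>T. finite T \<and> T \<subseteq> lists I))"
    using cI by (intro countable_Collect_finite_subset countable_lists)
  moreover have "range S \<subseteq> Collect (\<lambda>T. finite T \<and> T \<subseteq> lists I)" using S by auto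
  ultimately have "countable (range S)" by (rule countable_subset[rotated])
  \<comment> \<open>Pigeonhole: uncountably many \<open>c\<close> share countably many supports, so
    infinitely many \<open>U c\<close> lie in the span of one finite set \<open>T\<close> of
    monomials.\<close>
  have "\<exists>T. infinite (S -` {T})"
  proof (rule ccontr)
    assume "\<not> ?thesis"
    then have "countable (\<Union>T\<in>range S. S -` {T})"
      using \<open>countable (range S)\<close> by (intro countable_UN) (auto intro: countable_finite)
    moreover have "(\<Union>T\<in>range S. S -` {T}) = UNIV" by auto
    ultimately show False using uncountable_UNIV_complex by simp
  qed
  then obtain T where T: "infinite (S -` {T})" by blast
  then obtain c0 where "c0 \<in> S -` {T}" using infinite_imp_nonempty by blast
  then have fT: "finite T" using S(1)[of c0] by auto
  \<comment> \<open>One function more than there are monomials in \<open>T\<close> forces a linear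
    relation, with coefficients \<open>x\<close>.\<close>
  obtain C where C: "C \<subseteq> S -` {T}" "finite C" "card C = Suc (card T)"
    using infinite_arbitrarily_large[OF T] by metis
  obtain x where x: "\<exists>c\<in>C. x c \<noteq> 0" "\<forall>xs\<in>T. (\<Sum>c\<in>C. k c xs * x c) = 0"
    using homogeneous_system_nontrivial_solution[OF fT C(2), of "\<lambda>xs c. k c xs"] C(3) by auto
  have dep: "(\<Sum>c\<in>C. x c * U c z) = 0" for z
  proof -
    have "(\<Sum>c\<in>C. x c * U c z) = (\<Sum>c\<in>C. \<Sum>xs\<in>T. x c * (k c xs * prod_list (map z xs)))"
      unfolding sum_distrib_left[symmetric] using C S(3) by (intro sum.cong) auto
    also have "\<dots> = (\<Sum>xs\<in>T. (\<Sum>c\<in>C. k c xs * x c) * prod_list (map z xs))"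
      unfolding sum_distrib_right by (subst sum.swap) (simp add: algebra_simps)
    also have "\<dots> = 0" using x(2) by simp
    finally show ?thesis .
  qed
  \<comment> \<open>This is the sum of the \<open>x c / (t - c)\<close>, multiplied by the product
    of all \<open>t - c\<close>. The relation between the \<open>U c\<close> puts
    \<open>R (z i)\<close> into \<open>M\<close>, although \<open>R\<close> is a nonzero
    polynomial.\<close>
  define R where "R t = (\<Sum>c\<in>C. x c * (\<Prod>c'\<in>C - {c}. t - c'))" for t :: complex
  have RM: "(\<lambda>z. R (z i)) \<in> M"
  proof -
    have "R (z i) = (\<Sum>c\<in>C. (- x c * (\<Prod>c'\<in>C - {c}. z i - c')) * Q c z)" for z
    proof -
      have "(\<Sum>c\<in>C. x c * (\<Prod>c'\<in>C - {c}. z i - c') * (1 + Q c z)) = (\<Sum>c\<in>C. (\<Prod>c'\<in>C. z i - c') * (x c * U c z))"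
        using C(2) by (intro sum.cong) (auto simp: UQ(3)[symmetric] prod.remove algebra_simps)
      also have "\<dots> = 0" unfolding sum_distrib_left[symmetric] dep by simp
      finally show ?thesis unfolding R_def by (simp add: algebra_simps sum.distrib sum_negf eq_neg_iff_add_eq_0)
    qed
    moreover have "(\<lambda>z. \<Sum>c\<in>C. (- x c * (\<Prod>c'\<in>C - {c}. z i - c')) * Q c z) \<in> M"
    proof (rule pol_ideal_sum[OF M(1)])
      fix c
      have "pol I (\<lambda>z. - x c * (\<Prod>c'\<in>C - {c}. z i - c'))" using i by (intro pol_intros)
      then show "(\<lambda>z. (- x c * (\<Prod>c'\<in>C - {c}. z i - c')) * Q c z) \<in> M"
        using pol_idealD(4)[OF M(1) UQ(2)[of c]] by blast
    qed
    ultimately show ?thesis by presburger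
  qed
  obtain p where p: "R = poly p"
  proof
    show "R = poly (\<Sum>c\<in>C. smult (x c) (\<Prod>c'\<in>C - {c}. [:- c', 1:]))"
      by (auto simp: R_def poly_sum poly_prod algebra_simps)
  qed
  obtain c1 where c1: "c1 \<in> C" "x c1 \<noteq> 0" using x(1) by blast
  \<comment> \<open>At \<open>c1\<close>, all other summands contain the factor
    \<open>c1 - c1\<close>.\<close>
  have "R c1 = x c1 * (\<Prod>c'\<in>C - {c1}. c1 - c') + (\<Sum>c\<in>C - {c1}. x c * (\<Prod>c'\<in>C - {c}. c1 - c'))"
    unfolding R_def using C(2) c1(1) by (subst sum.remove[of C c1]) auto
  also have "(\<Sum>c\<in>C - {c1}. x c * (\<Prod>c'\<in>C - {c}. c1 - c')) = 0"
    using C(2) c1(1) by (intro sum.neutral ballI) auto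
  finally have "R c1 \<noteq> 0" using c1 C(2) by simp
  then have "p \<noteq> 0" using p by auto
  \<comment> \<open>A nonzero polynomial in \<open>z i\<close> cannot lie in \<open>M\<close>: split
    off a root \<open>r\<close>, cancel the factor \<open>z i - r\<close> by its inverse
    \<open>U r\<close>, and continue down to a nonzero constant, which would put 1 into
    \<open>M\<close>.\<close>
  have "q = 0" if "(\<lambda>z. poly q (z i)) \<in> M" "degree q \<le> N" for q N
    using that
  proof (induction N arbitrary: q)
    case 0
    then obtain e where q: "q = [:e:]" by (auto elim: degree_eq_zeroE)
    show ?case
    proof (rule ccontr)
      assume "q \<noteq> 0"
      then have "e \<noteq> 0" using q by auto
      have "(\<lambda>z. inverse e * poly q (z i)) \<in> M"
        using pol_idealD(4)[OF M(1) 0(1) pol.const[of I "inverse e"]] .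
      then show False using M(2) q \<open>e \<noteq> 0\<close> by simp
    qed
  next
    case (Suc N)
    show ?case
    proof (cases "degree q = 0")
      case True
      then show ?thesis using Suc by auto
    next
      case False
      then have "\<not> constant (poly q)" by (simp add: constant_degree)
      then obtain r where "poly q r = 0" using fundamental_theorem_of_algebra by blast
      then obtain q' where q': "q = [:- r, 1:] * q'" by (auto simp: poly_eq_0_iff_dvd)
      have "(\<lambda>z. U r z * poly q (z i)) \<in> M" using pol_idealD(4)[OF M(1) Suc.prems(1) UQ(1)] .
      moreover have "(\<lambda>z. (- poly q' (z i)) * Q r z) \<in> M"
      proof -
        have "pol I (\<lambda>z. poly q' (z i))" using i
          by (induction q') (auto intro!: pol_intros)
        then show ?thesis using pol_idealD(4)[OF M(1) UQ(2)[of r] pol_uminus] by blast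
      qed
      ultimately have "(\<lambda>z. U r z * poly q (z i) + (- poly q' (z i)) * Q r z) \<in> M"
        by (rule pol_idealD(3)[OF M(1)])
      moreover have "U r z * poly q (z i) + (- poly q' (z i)) * Q r z = poly q' (z i)" for z
      proof -
        have "U r z * poly q (z i) = (U r z * (z i - r)) * poly q' (z i)" by (simp add: q' algebra_simps)
        then show ?thesis unfolding UQ(3) by (simp add: algebra_simps)
      qed
      ultimately have "(\<lambda>z. poly q' (z i)) \<in> M" by simp
      moreover have "q' \<noteq> 0" using False q' by auto
      then have "degree q' \<le> N" using Suc.prems(2) unfolding q' by (subst (asm) degree_mult_eq) auto
      ultimately have "q' = 0" using Suc.IH by blast
      then show ?thesis using q' by simp
    qed
  qed
  from this[of p "degree p"] RM p \<open>p \<noteq> 0\<close> show False by auto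
qed

text \<open>If 1 were not in the ideal generated by \<open>G\<close>, that ideal would lie in a
  maximal one. Modulo the latter each variable is a constant \<open>a i\<close>, so every polynomial
  is congruent to its value at \<open>a\<close>, and a \<open>g\<close> with
  \<open>g a \<noteq> 0\<close> would be a unit inside a proper ideal.\<close>

theorem nullstellensatz:
  assumes cI: "countable I" and G: "\<And>g. g \<in> G \<Longrightarrow> pol I g"
    and nz: "\<And>a. \<exists>g\<in>G. g a \<noteq> 0"
  obtains T c where "finite T" "T \<subseteq> G" "\<And>t. t \<in> T \<Longrightarrow> pol I (c t)" "\<And>a. (\<Sum>t\<in>T. c t a * t a) = 1"
proof -
  define M0 where "M0 = {\<lambda>z. \<Sum>t\<in>T. c t z * t z | T c. finite T \<and> T \<subseteq> G \<and> (\<forall>t\<in>T. pol I (c t))}"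
  have id: "pol_ideal I M0"
  proof -
    have 1: "M0 \<subseteq> Collect (pol I)" using G by (auto simp: M0_def intro!: pol_intros)
    have 2: "(\<lambda>_. 0) \<in> M0" unfolding M0_def by (intro CollectI exI[of _ "{}"]) auto
    have 3: "(\<lambda>z. A z + B z) \<in> M0" if "A \<in> M0" "B \<in> M0" for A B
    proof -
      from that obtain T c T' c' where *: "A = (\<lambda>z. \<Sum>t\<in>T. c t z * t z)" "finite T" "T \<subseteq> G" "\<forall>t\<in>T. pol I (c t)"
        "B = (\<lambda>z. \<Sum>t\<in>T'. c' t z * t z)" "finite T'" "T' \<subseteq> G" "\<forall>t\<in>T'. pol I (c' t)" 
        unfolding M0_def by blast
      define d where "d t = (\<lambda>z. (if t \<in> T then c t z else 0) + (if t \<in> T' then c' t z else 0))" for t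
      have "A z + B z = (\<Sum>t\<in>T \<union> T'. d t z * t z)" for z
      proof -
        have "A z = (\<Sum>t\<in>T \<union> T'. (if t \<in> T then c t z else 0) * t z)"
          unfolding * using * by (intro sum.mono_neutral_cong_left) auto
        moreover have "B z = (\<Sum>t\<in>T \<union> T'. (if t \<in> T' then c' t z else 0) * t z)"
          unfolding * using * by (intro sum.mono_neutral_cong_left) auto
        ultimately show ?thesis by (simp add: d_def sum.distrib algebra_simps)
      qed
      moreover have "pol I (d t)" for t
      proof -
        have "pol I (\<lambda>z. if t \<in> T then c t z else 0)" "pol I (\<lambda>z. if t \<in> T' then c' t z else 0)"
          using * pol.const[of I 0] by (cases "t \<in> T", simp_all) (use * pol.const[of I 0] in \<open>cases "t \<in> T'", simp_all\<close>)
        then show ?thesis unfolding d_def by (rule pol.add)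
      qed
      ultimately show ?thesis unfolding M0_def using * by (intro CollectI exI[of _ "T \<union> T'"] exI[of _ d]) auto
    qed
    have 4: "(\<lambda>z. B z * A z) \<in> M0" if "A \<in> M0" "pol I B" for A B
    proof -
      from that obtain T c where *: "A = (\<lambda>z. \<Sum>t\<in>T. c t z * t z)" "finite T" "T \<subseteq> G" "\<forall>t\<in>T. pol I (c t)"
        unfolding M0_def by blast
      then show ?thesis unfolding M0_def using that(2)
        by (intro CollectI exI[of _ T] exI[of _ "\<lambda>t z. B z * c t z"]) (auto simp: sum_distrib_left mult.assoc intro: pol.mult)
    qed
    show ?thesis unfolding pol_ideal_def by (intro conjI ballI allI impI 1 2 3 4)
  qed
  have "(\<lambda>_. 1) \<in> M0"
  proof (rule ccontr)
    assume "(\<lambda>_. 1) \<notin> M0"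
    then obtain M where M: "pol_ideal I M" "M0 \<subseteq> M" "(\<lambda>_. 1) \<notin> M"
      and inv: "\<And>P. pol I P \<Longrightarrow> P \<notin> M \<Longrightarrow> \<exists>U Q. pol I U \<and> Q \<in> M \<and> (\<forall>z. U z * P z = 1 + Q z)"
      using pol_ideal_maximal[OF id] by metis
    have "\<forall>i\<in>I. \<exists>c. (\<lambda>z. z i - c) \<in> M"
      using pol_maximal_ideal_coordinate[OF cI M(1,3) inv] by blast
    then obtain a where a: "\<And>i. i \<in> I \<Longrightarrow> (\<lambda>z. z i - a i) \<in> M" by metis
    have eval: "(\<lambda>z. P z - P a) \<in> M" if "pol I P" for P
      using that
    proof induction
      case (const c)
      then show ?case using M by (auto simp: pol_ideal_def)
    next
      case (var i)
      then show ?case using a by auto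
    next
      case (add P Q)
      then have "(\<lambda>z. (P z - P a) + (Q z - Q a)) \<in> M" using pol_idealD(3)[OF M(1)] by blast
      then show ?case by (simp add: algebra_simps)
    next
      case (mult P Q)
      then have "(\<lambda>z. Q z * (P z - P a)) \<in> M" "(\<lambda>z. P a * (Q z - Q a)) \<in> M"
        using pol_idealD(4)[OF M(1)] pol.const[of I "P a"] by blast+
      then have "(\<lambda>z. Q z * (P z - P a) + P a * (Q z - Q a)) \<in> M" by (rule pol_idealD(3)[OF M(1)])
      then show ?case by (simp add: algebra_simps)
    qed
    obtain g where g: "g \<in> G" "g a \<noteq> 0" using nz by blast
    have "g \<in> M0" unfolding M0_def using g pol.const[of I 1]
      by (intro CollectI exI[of _ "{g}"] exI[of _ "\<lambda>_ _. 1"]) auto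
    then have "(\<lambda>z. inverse (g a) * g z) \<in> M"
      using pol_idealD(4)[OF M(1) _ pol.const[of I "inverse (g a)"]] M(2) by blast
    with pol_idealD(4)[OF M(1) eval[OF G[OF g(1)]] pol.const[of I "- inverse (g a)"]]
    have "(\<lambda>z. (- inverse (g a)) * (g z - g a) + inverse (g a) * g z) \<in> M"
      by (rule pol_idealD(3)[OF M(1)])
    then show False using M(3) g(2) by (simp add: algebra_simps)
  qed
  then obtain T c where "(\<lambda>_. 1) = (\<lambda>z. \<Sum>t\<in>T. c t z * t z)" "finite T" "T \<subseteq> G" "\<forall>t\<in>T. pol I (c t)"
    unfolding M0_def by blast
  then show ?thesis using that[of T c] by metis
qed

section \<open>Quasi-compactness and regular functions on affine varieties\<close>

lemma pol_cong:
  assumes "pol I P" "\<And>i. i \<in> I \<Longrightarrow> a i = b i"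
  shows "P a = P b"
  using assms by induction auto

lemma pol_reindex:
  assumes "pol I P" "f ` I \<subseteq> J"
  shows "pol J (\<lambda>y. P (\<lambda>i. y (f i)))"
  using assms by induction (auto intro: pol.intros)

text \<open>The coordinates \<open>z\<close> identify \<open>W\<close> with the zero set of
  \<open>E\<close>. The polynomials in \<open>E\<close> and \<open>H\<close> have no common zero,
  hence generate 1. On \<open>W\<close> the terms from \<open>E\<close> drop out, so the finitely
  many members of \<open>H\<close> in the combination never vanish simultaneously there.\<close>

lemma affine_quasi_compact:
  assumes cI: "countable I" and E: "\<And>e. e \<in> E \<Longrightarrow> pol I e"
    and zeros: "\<And>a. (\<forall>e\<in>E. e a = 0) \<Longrightarrow> \<exists>p\<in>W. \<forall>i\<in>I. z p i = a i"
    and vanish: "\<And>p e. p \<in> W \<Longrightarrow> e \<in> E \<Longrightarrow> e (z p) = 0"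
    and H: "\<And>h. h \<in> H \<Longrightarrow> pol I h" and cover: "\<And>p. p \<in> W \<Longrightarrow> \<exists>h\<in>H. h (z p) \<noteq> 0"
  obtains H0 where "finite H0" "H0 \<subseteq> H" "\<And>p. p \<in> W \<Longrightarrow> \<exists>h\<in>H0. h (z p) \<noteq> 0"
proof -
  have EH: "pol I g" if "g \<in> E \<union> H" for g using that E H by auto
  have nz: "\<exists>g\<in>E \<union> H. g a \<noteq> 0" for a
  proof (cases "\<forall>e\<in>E. e a = 0")
    case True
    then obtain p where p: "p \<in> W" "\<forall>i\<in>I. z p i = a i" using zeros by blast
    then obtain h where h: "h \<in> H" "h (z p) \<noteq> 0" using cover by blast
    then have "h a \<noteq> 0" using pol_cong[OF H[OF h(1)], of "z p" a] p by simp
    then show ?thesis using h by blast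
  qed auto
  obtain T c where T: "finite T" "T \<subseteq> E \<union> H" "\<And>a. (\<Sum>t\<in>T. c t a * t a) = 1"
    by (rule nullstellensatz[OF cI EH nz]) blast+
  have "\<exists>h\<in>T \<inter> H. h (z p) \<noteq> 0" if "p \<in> W" for p
  proof (rule ccontr)
    assume no: "\<not> ?thesis"
    have "t (z p) = 0" if "t \<in> T" for t
      using that no T(2) vanish[OF \<open>p \<in> W\<close>] by blast
    then have "(\<Sum>t\<in>T. c t (z p) * t (z p)) = 0" by (intro sum.neutral) simp
    then show False using T(3)[of "z p"] by simp
  qed
  then show ?thesis using that[of "T \<inter> H"] T(1) by blast
qed

text \<open>The Rabinowitsch trick turns the locus where \<open>g\<close> is nonzero into an affine
  variety. There the local denominators generate 1, so the local fractions glue to one polynomial,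
  whose additional variable costs only powers of \<open>g\<close>.\<close>

lemma affine_regular_function:
  fixes z :: "'p \<Rightarrow> 'i \<Rightarrow> complex"
  assumes cI: "countable I" and E: "\<And>e. e \<in> E \<Longrightarrow> pol I e"
    and zeros: "\<And>a. (\<forall>e\<in>E. e a = 0) \<Longrightarrow> \<exists>p\<in>W. \<forall>i\<in>I. z p i = a i"
    and vanish: "\<And>p e. p \<in> W \<Longrightarrow> e \<in> E \<Longrightarrow> e (z p) = 0"
    and g: "pol I g"
    and loc: "\<And>p. p \<in> W \<Longrightarrow> g (z p) \<noteq> 0 \<Longrightarrow> \<exists>P Q. pol I P \<and> pol I Q \<and> Q (z p) \<noteq> 0 \<and>
      (\<forall>p'\<in>W. g (z p') \<noteq> 0 \<longrightarrow> Q (z p') \<noteq> 0 \<longrightarrow> \<phi> p' * Q (z p') = P (z p'))"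
  shows "\<exists>k a. pol I a \<and> (\<forall>p\<in>W. g (z p) \<noteq> 0 \<longrightarrow> g (z p) ^ k * \<phi> p = a (z p))"
proof -
  \<comment> \<open>\<open>None\<close> is the additional variable, to be read as 1 / g; the old
    variables are lifted along \<open>Some\<close>.\<close>
  define J where "J = insert None (Some ` I)"
  define lift where "lift P = (\<lambda>y. P (\<lambda>i. y (Some i)) :: complex)" for P :: "('i \<Rightarrow> complex) \<Rightarrow> complex"
  have lift: "pol J (lift P)" if "pol I P" for P
    unfolding lift_def using that by (rule pol_reindex) (auto simp: J_def)
  have None: "pol J (\<lambda>y. y None)" by (rule pol.var) (simp add: J_def)
  define y where "y p = (\<lambda>j. case j of None \<Rightarrow> inverse (g (z p)) | Some i \<Rightarrow> z p i)" for p
  have lift_y: "lift P (y p) = P (z p)" for P p by (simp add: lift_def y_def)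
  define D where "D = {(P, Q). pol I P \<and> pol I Q \<and>
    (\<forall>p'\<in>W. g (z p') \<noteq> 0 \<longrightarrow> Q (z p') \<noteq> 0 \<longrightarrow> \<phi> p' * Q (z p') = P (z p'))}"
  \<comment> \<open>Denominators enter squared: \<phi> Q = P is known only where \<open>Q\<close> is
    nonzero, whereas Q^2 \<phi> = P Q also holds where \<open>Q\<close> vanishes.\<close>
  define G where "G = lift ` E \<union> {\<lambda>y. lift g y * y None - 1} \<union> (\<lambda>(P, Q) y. (lift Q y)\<^sup>2) ` D"
  have G: "pol J t" if "t \<in> G" for t
    using that unfolding G_def D_def by (auto intro!: pol_diff pol_power pol.mult pol.const None intro: lift E g)
  have nz: "\<exists>t\<in>G. t a \<noteq> 0" for a
  proof (rule ccontr)
    assume "\<not> ?thesis"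
    then have no: "t a = 0" if "t \<in> G" for t using that by auto
    have "lift e \<in> G" if "e \<in> E" for e using that unfolding G_def by simp
    from no[OF this] have E0: "\<forall>e\<in>E. e (\<lambda>i. a (Some i)) = 0" by (simp add: lift_def)
    obtain p where p: "p \<in> W" "\<forall>i\<in>I. z p i = a (Some i)" using zeros[OF E0] by blast
    have "(\<lambda>y. lift g y * y None - 1) \<in> G" unfolding G_def by simp
    from no[OF this] have "lift g a * a None = 1" by simp
    then have "lift g a \<noteq> 0" by auto
    then have "g (z p) \<noteq> 0" using pol_cong[OF g, of "z p" "\<lambda>i. a (Some i)"] p by (simp add: lift_def)
    then obtain P Q where PQ: "(P, Q) \<in> D" "Q (z p) \<noteq> 0" using loc[OF p(1)] unfolding D_def by blast
    then have "pol I Q" by (simp add: D_def)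
    then have "lift Q a \<noteq> 0" using pol_cong[of I Q "z p" "\<lambda>i. a (Some i)"] p PQ(2) by (simp add: lift_def)
    moreover have "(\<lambda>y. (lift Q y)\<^sup>2) \<in> G"
      unfolding G_def using imageI[OF PQ(1), of "\<lambda>(P, Q) y. (lift Q y)\<^sup>2"] by simp
    then have "(lift Q a)\<^sup>2 = 0" by (rule no)
    ultimately show False by simp
  qed
  have cJ: "countable J" using cI by (simp add: J_def)
  obtain T c where T: "finite T" "T \<subseteq> G" "\<And>t. t \<in> T \<Longrightarrow> pol J (c t)" "\<And>a. (\<Sum>t\<in>T. c t a * t a) = 1"
    by (rule nullstellensatz[OF cJ G nz]) blast+
  \<comment> \<open>Each generator times \<phi> is a polynomial function; for the equations of the
    variety it is 0. Summing with the coefficients \<open>c\<close> then yields \<phi>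
    itself.\<close>
  have "\<exists>r. pol J r \<and> (\<forall>p\<in>W. g (z p) \<noteq> 0 \<longrightarrow> t (y p) * \<phi> p = r (y p))" if t: "t \<in> T" for t
  proof -
    consider e where "e \<in> E" "t = lift e" | "t = (\<lambda>y. lift g y * y None - 1)"
      | P Q where "(P, Q) \<in> D" "t = (\<lambda>y. (lift Q y)\<^sup>2)"
      using t T(2) unfolding G_def by auto
    then show ?thesis
    proof cases
      case 1
      then show ?thesis using vanish by (intro exI[of _ "\<lambda>_. 0"]) (auto simp: lift_y intro: pol.const)
    next
      case 2
      then show ?thesis by (intro exI[of _ "\<lambda>_. 0"]) (auto simp: lift_y intro: pol.const, auto simp: y_def)
    next
      case 3
      then have PQ: "pol I P" "pol I Q"
        "\<And>p. p \<in> W \<Longrightarrow> g (z p) \<noteq> 0 \<Longrightarrow> Q (z p) \<noteq> 0 \<Longrightarrow> \<phi> p * Q (z p) = P (z p)"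
        by (auto simp: D_def)
      have "(Q (z p))\<^sup>2 * \<phi> p = P (z p) * Q (z p)" if "p \<in> W" "g (z p) \<noteq> 0" for p
      proof (cases "Q (z p) = 0")
        case False
        then show ?thesis using PQ(3)[OF that False, symmetric] by (simp add: power2_eq_square algebra_simps)
      qed simp
      then show ?thesis using 3(2) PQ
        by (intro exI[of _ "\<lambda>y. lift P y * lift Q y"]) (auto simp: lift_y intro!: pol.mult lift)
    qed
  qed
  then obtain r where r: "\<And>t. t \<in> T \<Longrightarrow> pol J (r t)"
    "\<And>t p. t \<in> T \<Longrightarrow> p \<in> W \<Longrightarrow> g (z p) \<noteq> 0 \<Longrightarrow> t (y p) * \<phi> p = r t (y p)" by metis
  define R where "R = (\<lambda>y. \<Sum>t\<in>T. c t y * r t y)"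
  have R: "pol J R" unfolding R_def using T(3) r(1) by (intro pol_intros)
  have Rphi: "\<phi> p = R (y p)" if "p \<in> W" "g (z p) \<noteq> 0" for p
  proof -
    have "\<phi> p = (\<Sum>t\<in>T. c t (y p) * t (y p)) * \<phi> p" using T(4) by simp
    also have "\<dots> = R (y p)" unfolding R_def sum_distrib_right
      using r(2)[OF _ that] by (intro sum.cong) (auto simp: mult.assoc)
    finally show ?thesis .
  qed
  \<comment> \<open>The value of \<open>None\<close> is 1 / g, so induction over the polynomial
    clears it with a power of \<open>g\<close>.\<close>
  have "\<exists>k a. pol I a \<and> (\<forall>p\<in>W. g (z p) \<noteq> 0 \<longrightarrow> g (z p) ^ k * R (y p) = a (z p))" if "pol J R" for R
    using that
  proof induction
    case (const c)
    show ?case by (intro exI[of _ 0] exI[of _ "\<lambda>_. c"]) (auto intro: pol.const)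
  next
    case (var j)
    show ?case
    proof (cases j)
      case None
      then show ?thesis by (intro exI[of _ 1] exI[of _ "\<lambda>_. 1"]) (auto intro: pol.const simp: y_def)
    next
      case (Some i)
      then have "i \<in> I" using var by (auto simp: J_def)
      then show ?thesis using Some by (intro exI[of _ 0] exI[of _ "\<lambda>z. z i"]) (auto intro: pol.var simp: y_def)
    qed
  next
    case (add P Q)
    from add.IH(1) obtain k a where a: "pol I a" "\<And>p. p \<in> W \<Longrightarrow> g (z p) \<noteq> 0 \<Longrightarrow> g (z p) ^ k * P (y p) = a (z p)" by auto
    from add.IH(2) obtain l b where b: "pol I b" "\<And>p. p \<in> W \<Longrightarrow> g (z p) \<noteq> 0 \<Longrightarrow> g (z p) ^ l * Q (y p) = b (z p)" by auto
    have "g (z p) ^ (k + l) * (P (y p) + Q (y p)) = g (z p) ^ l * a (z p) + g (z p) ^ k * b (z p)"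
      if "p \<in> W" "g (z p) \<noteq> 0" for p
      unfolding a(2)[OF that, symmetric] b(2)[OF that, symmetric] by (simp add: power_add algebra_simps)
    then show ?case using a(1) b(1) g
      by (intro exI[of _ "k + l"] exI[of _ "\<lambda>z. g z ^ l * a z + g z ^ k * b z"]) (auto intro!: pol_intros)
  next
    case (mult P Q)
    from mult.IH(1) obtain k a where a: "pol I a" "\<And>p. p \<in> W \<Longrightarrow> g (z p) \<noteq> 0 \<Longrightarrow> g (z p) ^ k * P (y p) = a (z p)" by auto
    from mult.IH(2) obtain l b where b: "pol I b" "\<And>p. p \<in> W \<Longrightarrow> g (z p) \<noteq> 0 \<Longrightarrow> g (z p) ^ l * Q (y p) = b (z p)" by auto
    have "g (z p) ^ (k + l) * (P (y p) * Q (y p)) = a (z p) * b (z p)"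
      if "p \<in> W" "g (z p) \<noteq> 0" for p
      unfolding a(2)[OF that, symmetric] b(2)[OF that, symmetric] by (simp add: power_add algebra_simps)
    then show ?case using a(1) b(1)
      by (intro exI[of _ "k + l"] exI[of _ "\<lambda>z. a z * b z"]) (auto intro!: pol_intros)
  qed
  from this[OF R] obtain k a where "pol I a" "\<And>p. p \<in> W \<Longrightarrow> g (z p) \<noteq> 0 \<Longrightarrow> g (z p) ^ k * R (y p) = a (z p)" by auto
  then show ?thesis using Rphi by (intro exI[of _ k] exI[of _ a]) auto
qed

section \<open>Homogeneous functions and elimination\<close>

lemma homogeneous_mono:
  assumes "homogeneous C G m F" "C \<subseteq> C'" "G \<subseteq> G'"
  shows "homogeneous C' G' m F"
  using assms by induction (blast intro: homogeneous.intros)+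

lemma homogeneous_scale:
  assumes "homogeneous C G m F" "(\<lambda>_. c) \<in> C"
  shows "homogeneous C G m (\<lambda>r. c * F r)"
  using homogeneous.mult[OF homogeneous.degree_zero[OF assms(2), of G] assms(1)] by simp

lemma homogeneous_uminus:
  assumes "homogeneous C G m F" "\<And>c. (\<lambda>_. c) \<in> C"
  shows "homogeneous C G m (\<lambda>r. - F r)"
  using homogeneous_scale[OF assms(1) assms(2)[of "-1"]] by simp

lemma homogeneous_diff:
  assumes "homogeneous C G m F" "homogeneous C G m F'" "\<And>c. (\<lambda>_. c) \<in> C"
  shows "homogeneous C G m (\<lambda>r. F r - F' r)"
  using homogeneous.add[OF assms(1) homogeneous_uminus[OF assms(2,3)]] by simp

lemma homogeneous_power:
  assumes "homogeneous C G m F" "(\<lambda>_. 1) \<in> C"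
  shows "homogeneous C G (k * m) (\<lambda>r. F r ^ k)"
proof (induction k)
  case 0
  show ?case using homogeneous.degree_zero[OF assms(2), of G] by simp
next
  case (Suc k)
  show ?case using homogeneous.mult[OF assms(1) Suc] by simp
qed

lemma homogeneous_prod:
  assumes "finite A" "\<And>i. i \<in> A \<Longrightarrow> homogeneous C G (m i) (F i)" "(\<lambda>_. 1) \<in> C"
  shows "homogeneous C G (sum m A) (\<lambda>r. \<Prod>i\<in>A. F i r)"
  using assms(1,2)
proof induction
  case empty
  show ?case using homogeneous.degree_zero[OF assms(3), of G] by simp
next
  case (insert x A)
  then show ?case using homogeneous.mult[of C G "m x" "F x" "sum m A" "\<lambda>r. \<Prod>i\<in>A. F i r"] by simp
qed

lemma homogeneous_sum_const:
  assumes "finite A" "\<And>i. i \<in> A \<Longrightarrow> homogeneous C G m (F i)" "A \<noteq> {}"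
  shows "homogeneous C G m (\<lambda>r. \<Sum>i\<in>A. F i r)"
  using assms(1,3,2)
proof (induction A rule: finite_ne_induct)
  case (insert x A)
  then show ?case using homogeneous.add[of C G m "F x" "\<lambda>r. \<Sum>i\<in>A. F i r"] by simp
qed simp

text \<open>Fraction-free Gaussian elimination: the unknowns in \<open>J\<close> are eliminated one after the other,
  with a pivot that does not vanish at \<open>p0\<close>.\<close>

lemma homogeneous_elimination:
  fixes M :: "'r \<Rightarrow> 'j \<Rightarrow> 'p \<Rightarrow> complex"
  assumes const: "\<And>c. (\<lambda>_. c) \<in> C"
  assumes "finite J" "a \<notin> J" "j0 \<notin> J" "a \<noteq> j0"
    and "\<And>i j. i \<in> I \<Longrightarrow> j \<in> insert a (insert j0 J) \<Longrightarrow> homogeneous C G (r i + e j) (M i j)"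
    and "\<And>x. (\<And>i. i \<in> I \<Longrightarrow> (\<Sum>j\<in>insert a (insert j0 J). M i j p0 * x j) = 0) \<Longrightarrow> x j0 = 0 \<Longrightarrow>
               \<forall>j\<in>insert a J. x j = 0"
  shows "\<exists>m \<alpha> \<beta>. homogeneous C G (m + e a) \<alpha> \<and> homogeneous C G (m + e j0) \<beta> \<and> \<alpha> p0 \<noteq> 0 \<and>
           (\<forall>p x. (\<forall>i\<in>I. (\<Sum>j\<in>insert a (insert j0 J). M i j p * x j) = 0) \<longrightarrow> \<alpha> p * x a = \<beta> p * x j0)"
  using assms(2-)
proof (induction J arbitrary: M r rule: finite_induct)
  case empty
  have "\<exists>i\<in>I. M i a p0 \<noteq> 0"
  proof (rule ccontr)
    assume "\<not> ?thesis"
    then show False using empty(5)[of "\<lambda>j. if j = a then 1 else 0"] empty(3) by auto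
  qed
  then obtain i where i: "i \<in> I" "M i a p0 \<noteq> 0" by blast
  have "homogeneous C G (r i + e a) (M i a)" using i(1) by (intro empty) auto
  moreover have "homogeneous C G (r i + e j0) (\<lambda>p. - M i j0 p)"
    using i(1) by (intro homogeneous_uminus empty const) auto
  moreover have "M i a p * x a = - M i j0 p * x j0"
    if "\<forall>i\<in>I. (\<Sum>j\<in>insert a (insert j0 {}). M i j p * x j) = 0" for p x
    using bspec[OF that i(1)] empty(3) by (simp add: eq_neg_iff_add_eq_0)
  ultimately show ?case using i(2) by (intro exI[of _ "r i"] exI[of _ "M i a"] exI[of _ "\<lambda>p. - M i j0 p"]) auto
next
  case (insert k J)
  define K where "K = insert a (insert j0 J)"
  have K: "insert a (insert j0 (insert k J)) = insert k K" "finite K" "k \<notin> K" "j0 \<in> K"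
    using insert by (auto simp: K_def)
  \<comment> \<open>If column \<open>k\<close> vanished at \<open>p0\<close>, the unit vector at
    \<open>k\<close> would be a kernel vector with \<open>x j0 = 0\<close>, against the assumption
    on the kernel.\<close>
  have "\<exists>i\<in>I. M i k p0 \<noteq> 0"
  proof (rule ccontr)
    assume "\<not> ?thesis"
    then have "\<forall>j\<in>insert a (insert k J). (if j = k then 1 else 0::complex) = 0"
      using insert.prems K by (intro insert.prems(5)) (auto intro!: sum.neutral)
    then show False by auto
  qed
  then obtain q where q: "q \<in> I" "M q k p0 \<noteq> 0" by blast
  define M' where "M' i j = (\<lambda>p. M q k p * M i j p - M i k p * M q j p)" for i j
  have row: "(\<Sum>j\<in>K. M' i j p * x j) =
     M q k p * (\<Sum>j\<in>insert k K. M i j p * x j) - M i k p * (\<Sum>j\<in>insert k K. M q j p * x j)" for i p x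
    using K by (simp add: M'_def sum_subtractf sum_distrib_left algebra_simps)
  \<comment> \<open>Degrees of entries are a row weight plus a column weight. This shape survives
    cross-multiplication with the pivot row, which raises every row weight by
    \<open>r q + e k\<close>.\<close>
  have hom: "homogeneous C G ((r i + (r q + e k)) + e j) (M' i j)" if "i \<in> I" "j \<in> K" for i j
  proof -
    have h: "homogeneous C G (r i' + e j') (M i' j')" if "i' \<in> I" "j' \<in> insert k K" for i' j'
      using that by (intro insert.prems) (auto simp: K_def)
    have "homogeneous C G ((r q + e k) + (r i + e j)) (\<lambda>p. M q k p * M i j p)"
      "homogeneous C G ((r i + e k) + (r q + e j)) (\<lambda>p. M i k p * M q j p)"
      using that q(1) by (auto intro!: homogeneous.mult h)
    moreover have "(r q + e k) + (r i + e j) = (r i + (r q + e k)) + e j"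
      "(r i + e k) + (r q + e j) = (r i + (r q + e k)) + e j" by auto
    ultimately show ?thesis unfolding M'_def using const by (intro homogeneous_diff) auto
  qed
  have "\<forall>j\<in>insert a J. x j = 0"
    if x: "\<And>i. i \<in> I \<Longrightarrow> (\<Sum>j\<in>insert a (insert j0 J). M' i j p0 * x j) = 0" "x j0 = 0" for x
  proof -
    \<comment> \<open>A kernel vector of the reduced system is extended to the full one by solving
      the pivot row at \<open>p0\<close> for the coordinate \<open>k\<close>.\<close>
    define x' where "x' = x(k := - (\<Sum>j\<in>K. M q j p0 * x j) / M q k p0)"
    have x'K: "(\<Sum>j\<in>K. N j * x' j) = (\<Sum>j\<in>K. N j * x j)" for N
      using K by (intro sum.cong) (auto simp: x'_def)
    have q0: "(\<Sum>j\<in>insert k K. M q j p0 * x' j) = 0"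
      using K q(2) by (simp add: x'K) (simp add: x'_def)
    have "(\<Sum>j\<in>insert k K. M i j p0 * x' j) = 0" if "i \<in> I" for i
    proof -
      have "(\<Sum>j\<in>K. M' i j p0 * x' j) = 0" using x(1)[OF that] by (simp add: x'K K_def[symmetric])
      then show ?thesis using q(2) unfolding row q0 by simp
    qed
    moreover have "x' j0 = 0" using x(2) K by (auto simp: x'_def)
    ultimately have "\<forall>j\<in>insert a (insert k J). x' j = 0" unfolding K(1)[symmetric] by (intro insert.prems(5))
    then show ?thesis using insert by (auto simp: x'_def split: if_splits)
  qed
  then have "\<exists>m \<alpha> \<beta>. homogeneous C G (m + e a) \<alpha> \<and> homogeneous C G (m + e j0) \<beta> \<and> \<alpha> p0 \<noteq> 0 \<and>
           (\<forall>p x. (\<forall>i\<in>I. (\<Sum>j\<in>insert a (insert j0 J). M' i j p * x j) = 0) \<longrightarrow> \<alpha> p * x a = \<beta> p * x j0)"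
    using insert.prems hom by (intro insert.IH[of "\<lambda>i. r i + (r q + e k)"]) (auto simp: K_def)
  then obtain m \<alpha> \<beta> where IH: "homogeneous C G (m + e a) \<alpha>" "homogeneous C G (m + e j0) \<beta>" "\<alpha> p0 \<noteq> 0"
    "\<And>p x. (\<forall>i\<in>I. (\<Sum>j\<in>K. M' i j p * x j) = 0) \<Longrightarrow> \<alpha> p * x a = \<beta> p * x j0"
    unfolding K_def by blast
  have "\<alpha> p * x a = \<beta> p * x j0" if "\<forall>i\<in>I. (\<Sum>j\<in>insert k K. M i j p * x j) = 0" for p x
  proof (rule IH(4))
    show "\<forall>i\<in>I. (\<Sum>j\<in>K. M' i j p * x j) = 0" unfolding row using that q(1) by simp
  qed
  then show ?case unfolding K(1) using IH(1-3) by blast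
qed

section \<open>Regular functions on projectivisations\<close>

text \<open>There will be two instances, projective space and the projectivised bundle. Products are
  taken across different domains because an intersection of nonvanishing loci has to be a
  nonvanishing locus again; the constant 1 exhibits each domain as such a locus.\<close>

locale proj_system =
  fixes S :: "nat \<Rightarrow> ('r set set \<times> ('r \<Rightarrow> complex)) set"
  assumes mult: "(D, F) \<in> S m \<Longrightarrow> (D', F') \<in> S m' \<Longrightarrow> (D \<inter> D', \<lambda>r. F r * F' r) \<in> S (m + m')"
    and add: "(D, F) \<in> S m \<Longrightarrow> (D, F') \<in> S m \<Longrightarrow> (D, \<lambda>r. F r + F' r) \<in> S m"
    and const: "(D, F) \<in> S m \<Longrightarrow> (D, \<lambda>_. c) \<in> S 0"
begin

lemma mult': "(D, F) \<in> S m \<Longrightarrow> (D, F') \<in> S m' \<Longrightarrow> (D, \<lambda>r. F r * F' r) \<in> S (m + m')"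
  using mult[of D F m D F' m'] by simp

lemma nonvanishing_mult: "nonvanishing (D \<inter> D') (\<lambda>r. F r * F' r) = nonvanishing D F \<inter> nonvanishing D' F'"
  by (auto simp: nonvanishing_def)

lemma zopen_nonvanishing: "(D, F) \<in> S m \<Longrightarrow> zopen (Proj S) (nonvanishing D F)"
  by (auto simp: Proj_def intro!: topology_generated_by_Basis)

lemma points_Proj: "points (Proj S) = (\<Union>{D | D F m. (D, F) \<in> S m})"
proof -
  have "nonvanishing D (\<lambda>_. 1) = D" for D :: "'r set set" by (simp add: nonvanishing_def)
  then show ?thesis unfolding Proj_def topology_generated_by_topspace fun_space.simps
    using const by (fastforce simp: nonvanishing_def)
qed

lemma zopen_basis:
  assumes "zopen (Proj S) U" "\<xi> \<in> U"
  obtains D F m where "(D, F) \<in> S m" "\<xi> \<in> nonvanishing D F" "nonvanishing D F \<subseteq> U"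
proof -
  have "generate_topology_on {nonvanishing D F | D F m. (D, F) \<in> S m} U"
    using assms(1) by (simp add: Proj_def openin_topology_generated_by_iff)
  then have "\<forall>\<xi>\<in>U. \<exists>D F m. (D, F) \<in> S m \<and> \<xi> \<in> nonvanishing D F \<and> nonvanishing D F \<subseteq> U"
  proof induction
    case (Int a b)
    show ?case
    proof
      fix \<xi> assume "\<xi> \<in> a \<inter> b"
      then obtain D F m D' F' m' where *: "(D, F) \<in> S m" "\<xi> \<in> nonvanishing D F" "nonvanishing D F \<subseteq> a"
        "(D', F') \<in> S m'" "\<xi> \<in> nonvanishing D' F'" "nonvanishing D' F' \<subseteq> b" using Int.IH by blast
      show "\<exists>D F m. (D, F) \<in> S m \<and> \<xi> \<in> nonvanishing D F \<and> nonvanishing D F \<subseteq> a \<inter> b"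
        using mult[OF *(1,4)] * nonvanishing_mult[of D D' F F']
        by (intro exI[of _ "D \<inter> D'"] exI[of _ "\<lambda>r. F r * F' r"] exI[of _ "m + m'"]) auto
    qed
  next
    case (UN K)
    then show ?case by blast
  next
    case (Basis s)
    then show ?case by blast
  qed simp
  then show ?thesis using assms(2) that by blast
qed

lemma regularI:
  assumes "\<And>\<xi>. \<xi> \<in> W \<Longrightarrow> \<exists>m D F G. (D, F) \<in> S m \<and> (D, G) \<in> S m \<and> \<xi> \<in> nonvanishing D G \<and>
      (\<forall>\<eta> \<in> W \<inter> nonvanishing D G. \<forall>r\<in>\<eta>. \<phi> \<eta> = F r / G r)"
  shows "\<phi> \<in> regular (Proj S) W"
  using assms by (simp add: Proj_def)

lemma regularE:
  assumes "\<phi> \<in> regular (Proj S) W" "\<xi> \<in> W"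
  obtains m D F G where "(D, F) \<in> S m" "(D, G) \<in> S m" "\<xi> \<in> nonvanishing D G"
    "\<And>\<eta> r. \<eta> \<in> W \<Longrightarrow> \<eta> \<in> nonvanishing D G \<Longrightarrow> r \<in> \<eta> \<Longrightarrow> \<phi> \<eta> = F r / G r"
proof -
  have "\<exists>m D F G. (D, F) \<in> S m \<and> (D, G) \<in> S m \<and> \<xi> \<in> nonvanishing D G \<and>
      (\<forall>\<eta> \<in> W \<inter> nonvanishing D G. \<forall>r\<in>\<eta>. \<phi> \<eta> = F r / G r)"
    using assms by (simp add: Proj_def)
  then show ?thesis by (elim exE conjE) (rule that, auto)
qed

lemma regular_mono: "\<phi> \<in> regular (Proj S) W \<Longrightarrow> W' \<subseteq> W \<Longrightarrow> \<phi> \<in> regular (Proj S) W'"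
proof (rule regularI)
  fix \<xi> assume "\<phi> \<in> regular (Proj S) W" "W' \<subseteq> W" "\<xi> \<in> W'"
  then have "\<phi> \<in> regular (Proj S) W" "\<xi> \<in> W" by auto
  then obtain m D F G where "(D, F) \<in> S m" "(D, G) \<in> S m" "\<xi> \<in> nonvanishing D G"
    "\<And>\<eta> r. \<eta> \<in> W \<Longrightarrow> \<eta> \<in> nonvanishing D G \<Longrightarrow> r \<in> \<eta> \<Longrightarrow> \<phi> \<eta> = F r / G r"
    by (rule regularE) (rule that)
  with \<open>W' \<subseteq> W\<close> show "\<exists>m D F G. (D, F) \<in> S m \<and> (D, G) \<in> S m \<and> \<xi> \<in> nonvanishing D G \<and>
      (\<forall>\<eta> \<in> W' \<inter> nonvanishing D G. \<forall>r\<in>\<eta>. \<phi> \<eta> = F r / G r)"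
    by (intro exI[of _ m] exI[of _ D] exI[of _ F] exI[of _ G]) auto
qed

lemma regular_cong:
  assumes "\<phi> \<in> regular (Proj S) W" "\<And>\<xi>. \<xi> \<in> W \<Longrightarrow> \<phi> \<xi> = \<psi> \<xi>"
  shows "\<psi> \<in> regular (Proj S) W"
proof (rule regularI)
  fix \<xi> assume \<xi>: "\<xi> \<in> W"
  obtain m D F G where "(D, F) \<in> S m" "(D, G) \<in> S m" "\<xi> \<in> nonvanishing D G"
    "\<And>\<eta> r. \<eta> \<in> W \<Longrightarrow> \<eta> \<in> nonvanishing D G \<Longrightarrow> r \<in> \<eta> \<Longrightarrow> \<phi> \<eta> = F r / G r" by (rule regularE[OF assms(1) \<xi>]) (rule that)
  then show "\<exists>m D F G. (D, F) \<in> S m \<and> (D, G) \<in> S m \<and> \<xi> \<in> nonvanishing D G \<and>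
      (\<forall>\<eta> \<in> W \<inter> nonvanishing D G. \<forall>r\<in>\<eta>. \<psi> \<eta> = F r / G r)"
    using assms(2) by (intro exI[of _ m] exI[of _ D] exI[of _ F] exI[of _ G]) auto
qed

lemma regular_const: "W \<subseteq> points (Proj S) \<Longrightarrow> (\<lambda>_. c) \<in> regular (Proj S) W"
proof (rule regularI)
  fix \<xi> assume "W \<subseteq> points (Proj S)" "\<xi> \<in> W"
  then obtain D F m where "(D, F) \<in> S m" "\<xi> \<in> D" unfolding points_Proj by blast
  then show "\<exists>m D F G. (D, F) \<in> S m \<and> (D, G) \<in> S m \<and> \<xi> \<in> nonvanishing D G \<and>
      (\<forall>\<eta> \<in> W \<inter> nonvanishing D G. \<forall>r\<in>\<eta>. c = F r / G r)"
    using const[of D F m c] const[of D F m 1]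
    by (intro exI[of _ 0] exI[of _ D] exI[of _ "\<lambda>_. c"] exI[of _ "\<lambda>_. 1"]) (auto simp: nonvanishing_def)
qed

lemma regular_mult:
  assumes "\<phi> \<in> regular (Proj S) W" "\<psi> \<in> regular (Proj S) W"
  shows "(\<lambda>\<xi>. \<phi> \<xi> * \<psi> \<xi>) \<in> regular (Proj S) W"
proof (rule regularI)
  fix \<xi> assume \<xi>: "\<xi> \<in> W"
  obtain m D F G where 1: "(D, F) \<in> S m" "(D, G) \<in> S m" "\<xi> \<in> nonvanishing D G"
    "\<And>\<eta> r. \<eta> \<in> W \<Longrightarrow> \<eta> \<in> nonvanishing D G \<Longrightarrow> r \<in> \<eta> \<Longrightarrow> \<phi> \<eta> = F r / G r" by (rule regularE[OF assms(1) \<xi>]) (rule that)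
  obtain m' D' F' G' where 2: "(D', F') \<in> S m'" "(D', G') \<in> S m'" "\<xi> \<in> nonvanishing D' G'"
    "\<And>\<eta> r. \<eta> \<in> W \<Longrightarrow> \<eta> \<in> nonvanishing D' G' \<Longrightarrow> r \<in> \<eta> \<Longrightarrow> \<psi> \<eta> = F' r / G' r" by (rule regularE[OF assms(2) \<xi>]) (rule that)
  show "\<exists>m D F G. (D, F) \<in> S m \<and> (D, G) \<in> S m \<and> \<xi> \<in> nonvanishing D G \<and>
      (\<forall>\<eta> \<in> W \<inter> nonvanishing D G. \<forall>r\<in>\<eta>. \<phi> \<eta> * \<psi> \<eta> = F r / G r)"
    using mult[OF 1(1) 2(1)] mult[OF 1(2) 2(2)] 1(3,4) 2(3,4)
    by (intro exI[of _ "m + m'"] exI[of _ "D \<inter> D'"] exI[of _ "\<lambda>r. F r * F' r"] exI[of _ "\<lambda>r. G r * G' r"])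
       (auto simp: nonvanishing_mult)
qed

lemma regular_add:
  assumes "\<phi> \<in> regular (Proj S) W" "\<psi> \<in> regular (Proj S) W"
  shows "(\<lambda>\<xi>. \<phi> \<xi> + \<psi> \<xi>) \<in> regular (Proj S) W"
proof (rule regularI)
  fix \<xi> assume \<xi>: "\<xi> \<in> W"
  obtain m D F G where 1: "(D, F) \<in> S m" "(D, G) \<in> S m" "\<xi> \<in> nonvanishing D G"
    "\<And>\<eta> r. \<eta> \<in> W \<Longrightarrow> \<eta> \<in> nonvanishing D G \<Longrightarrow> r \<in> \<eta> \<Longrightarrow> \<phi> \<eta> = F r / G r" by (rule regularE[OF assms(1) \<xi>]) (rule that)
  obtain m' D' F' G' where 2: "(D', F') \<in> S m'" "(D', G') \<in> S m'" "\<xi> \<in> nonvanishing D' G'"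
    "\<And>\<eta> r. \<eta> \<in> W \<Longrightarrow> \<eta> \<in> nonvanishing D' G' \<Longrightarrow> r \<in> \<eta> \<Longrightarrow> \<psi> \<eta> = F' r / G' r" by (rule regularE[OF assms(2) \<xi>]) (rule that)
  have sum: "(D \<inter> D', \<lambda>r. F r * G' r + G r * F' r) \<in> S (m + m')"
    using add[OF mult[OF 1(1) 2(2)] mult[OF 1(2) 2(1)]] .
  have "\<phi> \<eta> + \<psi> \<eta> = (F r * G' r + G r * F' r) / (G r * G' r)"
    if "\<eta> \<in> W" "\<eta> \<in> nonvanishing D G" "\<eta> \<in> nonvanishing D' G'" "r \<in> \<eta>" for \<eta> r
  proof -
    have "G r \<noteq> 0" "G' r \<noteq> 0" using that by (auto simp: nonvanishing_def)
    then show ?thesis using 1(4)[OF that(1,2,4)] 2(4)[OF that(1,3,4)] by (simp add: field_simps)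
  qed
  then show "\<exists>m D F G. (D, F) \<in> S m \<and> (D, G) \<in> S m \<and> \<xi> \<in> nonvanishing D G \<and>
      (\<forall>\<eta> \<in> W \<inter> nonvanishing D G. \<forall>r\<in>\<eta>. \<phi> \<eta> + \<psi> \<eta> = F r / G r)"
    using sum mult[OF 1(2) 2(2)] 1(3) 2(3)
    by (intro exI[of _ "m + m'"] exI[of _ "D \<inter> D'"] exI[of _ "\<lambda>r. F r * G' r + G r * F' r"] exI[of _ "\<lambda>r. G r * G' r"])
       (auto simp: nonvanishing_mult)
qed

lemma regular_inverse:
  assumes "\<phi> \<in> regular (Proj S) W" "\<And>\<xi>. \<xi> \<in> W \<Longrightarrow> \<phi> \<xi> \<noteq> 0"
  shows "(\<lambda>\<xi>. inverse (\<phi> \<xi>)) \<in> regular (Proj S) W"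
proof (rule regularI)
  fix \<xi> assume \<xi>: "\<xi> \<in> W"
  obtain m D F G where 1: "(D, F) \<in> S m" "(D, G) \<in> S m" "\<xi> \<in> nonvanishing D G"
    "\<And>\<eta> r. \<eta> \<in> W \<Longrightarrow> \<eta> \<in> nonvanishing D G \<Longrightarrow> r \<in> \<eta> \<Longrightarrow> \<phi> \<eta> = F r / G r" by (rule regularE[OF assms(1) \<xi>]) (rule that)
  \<comment> \<open>The fraction G / F is expanded by \<open>G\<close>: the formula for \<phi> is
    available only where \<open>G\<close> is nonzero, and the denominator \<open>F * G\<close>
    guarantees this.\<close>
  have "\<xi> \<in> nonvanishing D (\<lambda>r. F r * G r)"
    using assms(2)[OF \<xi>] 1(4)[OF \<xi> 1(3)] 1(3) by (fastforce simp: nonvanishing_def)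
  moreover have "inverse (\<phi> \<eta>) = (G r * G r) / (F r * G r)"
    if "\<eta> \<in> W" "\<eta> \<in> nonvanishing D (\<lambda>r. F r * G r)" "r \<in> \<eta>" for \<eta> r
  proof -
    have "G r \<noteq> 0" "F r \<noteq> 0" "\<eta> \<in> nonvanishing D G" using that by (auto simp: nonvanishing_def)
    then show ?thesis using 1(4)[OF that(1) _ that(3)] by simp
  qed
  ultimately show "\<exists>m D F G. (D, F) \<in> S m \<and> (D, G) \<in> S m \<and> \<xi> \<in> nonvanishing D G \<and>
      (\<forall>\<eta> \<in> W \<inter> nonvanishing D G. \<forall>r\<in>\<eta>. inverse (\<phi> \<eta>) = F r / G r)"
    using mult'[OF 1(2) 1(2)] mult'[OF 1(1) 1(2)]
    by (intro exI[of _ "m + m"] exI[of _ D] exI[of _ "\<lambda>r. G r * G r"] exI[of _ "\<lambda>r. F r * G r"]) auto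
qed

lemma regular_local:
  assumes "\<And>\<xi>. \<xi> \<in> W \<Longrightarrow> \<exists>V. zopen (Proj S) V \<and> \<xi> \<in> V \<and> \<phi> \<in> regular (Proj S) (W \<inter> V)"
  shows "\<phi> \<in> regular (Proj S) W"
proof (rule regularI)
  fix \<xi> assume \<xi>: "\<xi> \<in> W"
  then obtain V where V: "zopen (Proj S) V" "\<xi> \<in> V" "\<phi> \<in> regular (Proj S) (W \<inter> V)" using assms by blast
  obtain m D F G where 1: "(D, F) \<in> S m" "(D, G) \<in> S m" "\<xi> \<in> nonvanishing D G"
    "\<And>\<eta> r. \<eta> \<in> W \<inter> V \<Longrightarrow> \<eta> \<in> nonvanishing D G \<Longrightarrow> r \<in> \<eta> \<Longrightarrow> \<phi> \<eta> = F r / G r"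
    by (rule regularE[OF V(3) IntI[OF \<xi> V(2)]]) (rule that)
  obtain D' F' m' where 2: "(D', F') \<in> S m'" "\<xi> \<in> nonvanishing D' F'" "nonvanishing D' F' \<subseteq> V"
    by (rule zopen_basis[OF V(1,2)]) (rule that)
  \<comment> \<open>Expanding by \<open>F'\<close> shrinks the nonvanishing locus of the denominator
    into \<open>V\<close>, where the local formula is valid.\<close>
  have "\<phi> \<eta> = F r * F' r / (G r * F' r)"
    if "\<eta> \<in> W" "\<eta> \<in> nonvanishing D G" "\<eta> \<in> nonvanishing D' F'" "r \<in> \<eta>" for \<eta> r
  proof -
    have "F' r \<noteq> 0" "\<eta> \<in> V" using that 2 by (auto simp: nonvanishing_def)
    then show ?thesis using 1(4)[of \<eta> r] that by simp
  qed
  then show "\<exists>m D F G. (D, F) \<in> S m \<and> (D, G) \<in> S m \<and> \<xi> \<in> nonvanishing D G \<and>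
      (\<forall>\<eta> \<in> W \<inter> nonvanishing D G. \<forall>r\<in>\<eta>. \<phi> \<eta> = F r / G r)"
    using mult[OF 1(1) 2(1)] mult[OF 1(2) 2(1)] 1(3) 2(2)
    by (intro exI[of _ "m + m'"] exI[of _ "D \<inter> D'"] exI[of _ "\<lambda>r. F r * F' r"] exI[of _ "\<lambda>r. G r * F' r"])
       (auto simp: nonvanishing_mult)
qed

lemma regular_fraction:
  assumes "(D, F) \<in> S m" "(D, G) \<in> S m" "W \<subseteq> nonvanishing D G"
    "\<And>\<xi> r. \<xi> \<in> W \<Longrightarrow> r \<in> \<xi> \<Longrightarrow> \<phi> \<xi> = F r / G r"
  shows "\<phi> \<in> regular (Proj S) W"
  using assms by (intro regularI exI[of _ m] exI[of _ D] exI[of _ F] exI[of _ G]) auto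

lemma regular_sum:
  assumes "W \<subseteq> points (Proj S)" "\<And>i. i \<in> A \<Longrightarrow> \<phi> i \<in> regular (Proj S) W"
  shows "(\<lambda>\<xi>. \<Sum>i\<in>A. \<phi> i \<xi>) \<in> regular (Proj S) W"
  using assms(2) by (induction A rule: infinite_finite_induct) (auto intro: regular_const[OF assms(1)] regular_add)

lemma regular_power:
  assumes "W \<subseteq> points (Proj S)" "\<phi> \<in> regular (Proj S) W"
  shows "(\<lambda>\<xi>. \<phi> \<xi> ^ k) \<in> regular (Proj S) W"
  using assms(2) by (induction k) (auto intro: regular_const[OF assms(1)] regular_mult)

lemma regular_minus:
  assumes "W \<subseteq> points (Proj S)" "\<phi> \<in> regular (Proj S) W"
  shows "(\<lambda>\<xi>. - \<phi> \<xi>) \<in> regular (Proj S) W"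
  using regular_mult[OF regular_const[OF assms(1), of "-1"] assms(2)] by simp

end

section \<open>Projective space\<close>

lemma pclass_self: "v \<in> pclass v"
  by (auto simp: pclass_def intro!: exI[of _ 1])

lemma pclass_scale: "c \<noteq> 0 \<Longrightarrow> pclass (\<lambda>i. c * v i) = pclass v"
proof -
  assume c: "c \<noteq> 0"
  have "\<exists>d'. (\<lambda>i. d * (c * v i)) = (\<lambda>i. d' * v i) \<and> d' \<noteq> 0" if "d \<noteq> 0" for d
    using c that by (intro exI[of _ "d * c"]) auto
  moreover have "\<exists>d'. (\<lambda>i. d * v i) = (\<lambda>i. d' * (c * v i)) \<and> d' \<noteq> 0" if "d \<noteq> 0" for d
    using c that by (intro exI[of _ "d / c"]) auto
  ultimately show ?thesis unfolding pclass_def by blast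
qed

lemma mem_pclassE:
  assumes "v' \<in> pclass v"
  obtains c where "c \<noteq> 0" "v' = (\<lambda>i. c * v i)"
  using assms by (auto simp: pclass_def)

lemma vecs_scale: "v \<in> vecs n \<Longrightarrow> (\<lambda>i. c * v i) \<in> vecs n"
  by (simp add: vecs_def)

lemma vecs_line: "v \<in> vecs n \<Longrightarrow> w \<in> vecs n \<Longrightarrow> (\<lambda>i. v i + t * w i) \<in> vecs n"
  by (simp add: vecs_def)

lemma proj_points_mem:
  assumes "x \<in> proj_points n" "v \<in> x"
  shows "x = pclass v" "v \<in> vecs n" "v \<noteq> (\<lambda>_. 0)"
proof -
  obtain u where u: "u \<in> vecs n" "u \<noteq> (\<lambda>_. 0)" "x = pclass u" using assms(1) by (auto simp: proj_points_def)
  then obtain c where c: "c \<noteq> 0" "v = (\<lambda>i. c * u i)" using assms(2) by (auto elim: mem_pclassE)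
  show "x = pclass v" unfolding c(2) pclass_scale[OF c(1)] u(3) ..
  show "v \<in> vecs n" unfolding c(2) using u(1) by (rule vecs_scale)
  show "v \<noteq> (\<lambda>_. 0)" using u(2) c by (auto simp: fun_eq_iff)
qed

lemma pclass_in_proj_points: "pclass v \<in> proj_points n \<longleftrightarrow> v \<in> vecs n \<and> v \<noteq> (\<lambda>_. 0)"
proof
  assume *: "pclass v \<in> proj_points n"
  show "v \<in> vecs n \<and> v \<noteq> (\<lambda>_. 0)" using proj_points_mem(2,3)[OF * pclass_self] ..
qed (simp add: proj_points_def)

lemma proj_points_nonempty: "x \<in> proj_points n \<Longrightarrow> \<exists>v. v \<in> x"
  unfolding proj_points_def by (elim imageE) (metis pclass_self)

lemma hom_poly_scale: "hom_poly n m F \<Longrightarrow> F (\<lambda>i. c * v i) = c ^ m * F v"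
  unfolding hom_poly_def
proof (induction rule: homogeneous.induct)
qed (auto simp: algebra_simps power_add)

lemma hom_poly_const: "hom_poly n 0 (\<lambda>_. c)"
  unfolding hom_poly_def by (rule homogeneous.degree_zero) blast

lemma hom_poly_coord: "i \<le> n \<Longrightarrow> hom_poly n 1 (\<lambda>v. v i)"
  unfolding hom_poly_def by (rule homogeneous.degree_one) blast

lemma hom_poly_add: "hom_poly n m F \<Longrightarrow> hom_poly n m G \<Longrightarrow> hom_poly n m (\<lambda>v. F v + G v)"
  unfolding hom_poly_def by (rule homogeneous.add)

lemma hom_poly_mult: "hom_poly n m F \<Longrightarrow> hom_poly n k G \<Longrightarrow> hom_poly n (m + k) (\<lambda>v. F v * G v)"
  unfolding hom_poly_def by (rule homogeneous.mult)

lemma hom_poly_lin: "hom_poly n 1 (\<lambda>v. lin n a v)"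
proof -
  have "homogeneous {\<lambda>_. c |c. True} {\<lambda>v. v i |i. i \<le> n} 1 (\<lambda>v. \<Sum>i\<in>{..n}. a i * v i)"
    by (intro homogeneous_sum_const homogeneous_scale homogeneous.degree_one) auto
  then show ?thesis by (simp add: hom_poly_def lin_def)
qed

lemma hom_poly_power: "hom_poly n m F \<Longrightarrow> hom_poly n (k * m) (\<lambda>v. F v ^ k)"
  unfolding hom_poly_def by (rule homogeneous_power) auto

abbreviation proj_space_system :: "nat \<Rightarrow> nat \<Rightarrow> (vec set set \<times> (vec \<Rightarrow> complex)) set" where
  "proj_space_system n \<equiv> \<lambda>m. {(proj_points n, F) | F. hom_poly n m F}"

interpretation P: proj_system "proj_space_system n" for n
  by unfold_locales (auto intro: hom_poly_const hom_poly_add hom_poly_mult)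

lemma points_proj_space: "points (proj_space n) = proj_points n"
  unfolding proj_space_def P.points_Proj using hom_poly_const[of n 0] by auto

lemma zopen_proj_space_subset: "zopen (proj_space n) U \<Longrightarrow> U \<subseteq> proj_points n"
  using openin_subset points_proj_space by metis

lemma zopen_proj_space_basis:
  assumes "zopen (proj_space n) U" "pclass v \<in> U"
  obtains m F where "hom_poly n m F" "F v \<noteq> 0" "nonvanishing (proj_points n) F \<subseteq> U"
proof -
  obtain D F m where "(D, F) \<in> proj_space_system n m" "pclass v \<in> nonvanishing D F" "nonvanishing D F \<subseteq> U"
    by (rule P.zopen_basis[OF assms[unfolded proj_space_def]]) (rule that)
  then show ?thesis using that[of m F] pclass_self[of v] by (auto simp: nonvanishing_def)
qed

lemma nonvanishing_proj_points:
  assumes "hom_poly n m F"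
  shows "pclass v \<in> nonvanishing (proj_points n) F \<longleftrightarrow> v \<in> vecs n \<and> v \<noteq> (\<lambda>_. 0) \<and> F v \<noteq> 0"
proof -
  have "(\<forall>r\<in>pclass v. F r \<noteq> 0) \<longleftrightarrow> F v \<noteq> 0"
  proof
    assume "F v \<noteq> 0"
    then show "\<forall>r\<in>pclass v. F r \<noteq> 0" by (auto elim!: mem_pclassE simp: hom_poly_scale[OF assms])
  qed (simp add: pclass_self)
  then show ?thesis by (simp add: nonvanishing_def pclass_in_proj_points)
qed

lemma zopen_nonvanishing_proj_points:
  "hom_poly n m F \<Longrightarrow> zopen (proj_space n) (nonvanishing (proj_points n) F)"
  unfolding proj_space_def by (rule P.zopen_nonvanishing) auto

lemma regular_proj_spaceE:
  assumes "f \<in> regular (proj_space n) U" "pclass v \<in> U"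
  obtains m F G where "hom_poly n m F" "hom_poly n m G" "G v \<noteq> 0"
    "\<And>u. pclass u \<in> U \<Longrightarrow> pclass u \<in> proj_points n \<Longrightarrow> G u \<noteq> 0 \<Longrightarrow> f (pclass u) = F u / G u"
proof -
  obtain m D F G where 1: "(D, F) \<in> proj_space_system n m" "(D, G) \<in> proj_space_system n m" "pclass v \<in> nonvanishing D G"
    "\<And>\<eta> r. \<eta> \<in> U \<Longrightarrow> \<eta> \<in> nonvanishing D G \<Longrightarrow> r \<in> \<eta> \<Longrightarrow> f \<eta> = F r / G r"
    by (rule P.regularE[OF assms[unfolded proj_space_def]]) (rule that)
  then have h: "hom_poly n m F" "hom_poly n m G" "D = proj_points n" by auto
  moreover have "G v \<noteq> 0" using 1(3) pclass_self by (auto simp: nonvanishing_def)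
  moreover have "f (pclass u) = F u / G u" if "pclass u \<in> U" "pclass u \<in> proj_points n" "G u \<noteq> 0" for u
    using that 1(4)[OF that(1) _ pclass_self] h nonvanishing_proj_points[OF h(2), of u]
    by (auto simp: pclass_in_proj_points)
  ultimately show ?thesis using that by blast
qed

lemma regular_proj_space_fraction:
  assumes "hom_poly n m F" "hom_poly n m G" "\<And>v. pclass v \<in> U \<Longrightarrow> G v \<noteq> 0" "U \<subseteq> proj_points n"
    "\<And>v. pclass v \<in> U \<Longrightarrow> f (pclass v) = F v / G v"
  shows "f \<in> regular (proj_space n) U"
  unfolding proj_space_def
proof (rule P.regular_fraction[where F = F and G = G and D = "proj_points n" and m = m])
  have U: "pclass v = x" if "x \<in> U" "v \<in> x" for x v using proj_points_mem[of x n v] assms(4) that by auto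
  show "U \<subseteq> nonvanishing (proj_points n) G"
    using assms(3,4) U unfolding nonvanishing_def by blast
  show "f \<xi> = F r / G r" if "\<xi> \<in> U" "r \<in> \<xi>" for \<xi> r using assms(5) U that by blast
qed (use assms in auto)

section \<open>Differentials of regular functions\<close>

lemma lin_line: "lin n a (\<lambda>i. v i + t * w i) = lin n a v + t * lin n a w"
  by (simp add: lin_def algebra_simps sum.distrib sum_distrib_left)

lemma lin_scale: "lin n a (\<lambda>i. c * v i) = c * lin n a v"
  by (simp add: lin_def algebra_simps sum_distrib_left)

lemma lin_scale_left: "lin n (\<lambda>i. c * a i) v = c * lin n a v"
  by (simp add: lin_def algebra_simps sum_distrib_left)

lemma lin_commute: "lin n a v = lin n v a"
  by (simp add: lin_def mult.commute)

text \<open>Continuity is recorded for base point and direction moving along lines simultaneously,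
  since functionals over the arrangement will be limits of this kind. Quantifying over
  \<open>D\<close> lets the induction carry along explicit sum and product formulas.\<close>

lemma hom_poly_line_derivative:
  assumes "hom_poly n m F"
  shows "\<exists>D. (\<forall>v w. ((\<lambda>t. F (\<lambda>i. v i + t * w i)) has_field_derivative D v w) (at 0)) \<and>
             (\<forall>v u w w'. isCont (\<lambda>t. D (\<lambda>i. v i + t * u i) (\<lambda>i. w i + t * w' i)) 0)"
  using assms unfolding hom_poly_def
proof (induction rule: homogeneous.induct)
  case (degree_zero c)
  then obtain k where "c = (\<lambda>_. k)" by blast
  then show ?case by (intro exI[of _ "\<lambda>_ _. 0"]) auto
next
  case (degree_one g)
  then obtain k where "g = (\<lambda>v. v k)" by blast
  then show ?case by (intro exI[of _ "\<lambda>_ w. w k"]) (auto intro!: derivative_eq_intros continuous_intros)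
next
  case (add m F F')
  from add.IH(1) obtain D where D: "\<And>v w. ((\<lambda>t. F (\<lambda>i. v i + t * w i)) has_field_derivative D v w) (at 0)"
    "\<And>v u w w'. isCont (\<lambda>t. D (\<lambda>i. v i + t * u i) (\<lambda>i. w i + t * w' i)) 0" by auto
  from add.IH(2) obtain D' where D': "\<And>v w. ((\<lambda>t. F' (\<lambda>i. v i + t * w i)) has_field_derivative D' v w) (at 0)"
    "\<And>v u w w'. isCont (\<lambda>t. D' (\<lambda>i. v i + t * u i) (\<lambda>i. w i + t * w' i)) 0" by auto
  show ?case
    by (rule exI[of _ "\<lambda>v w. D v w + D' v w"]) (auto intro!: DERIV_add D D' isCont_add)
next
  case (mult m F k F')
  from mult.IH(1) obtain D where D: "\<And>v w. ((\<lambda>t. F (\<lambda>i. v i + t * w i)) has_field_derivative D v w) (at 0)"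
    "\<And>v u w w'. isCont (\<lambda>t. D (\<lambda>i. v i + t * u i) (\<lambda>i. w i + t * w' i)) 0" by auto
  from mult.IH(2) obtain D' where D': "\<And>v w. ((\<lambda>t. F' (\<lambda>i. v i + t * w i)) has_field_derivative D' v w) (at 0)"
    "\<And>v u w w'. isCont (\<lambda>t. D' (\<lambda>i. v i + t * u i) (\<lambda>i. w i + t * w' i)) 0" by auto
  have "((\<lambda>t. F (\<lambda>i. v i + t * w i) * F' (\<lambda>i. v i + t * w i)) has_field_derivative D v w * F' v + D' v w * F v) (at 0)" for v w
    using DERIV_mult[OF D(1) D'(1), of v w v w] by simp
  moreover have "isCont (\<lambda>t. D (\<lambda>i. v i + t * u i) (\<lambda>i. w i + t * w' i) * F' (\<lambda>i. v i + t * u i) +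
      D' (\<lambda>i. v i + t * u i) (\<lambda>i. w i + t * w' i) * F (\<lambda>i. v i + t * u i)) 0" for v u w w'
    by (intro isCont_add isCont_mult D D' DERIV_isCont[OF D(1)] DERIV_isCont[OF D'(1)])
  ultimately show ?case
    by - (rule exI[of _ "\<lambda>v w. D v w * F' v + D' v w * F v"], auto)
qed

definition line_derivative :: "(vec \<Rightarrow> complex) \<Rightarrow> vec \<Rightarrow> vec \<Rightarrow> complex" where
  "line_derivative F v w = deriv (\<lambda>t. F (\<lambda>i. v i + t * w i)) 0"

lemma
  assumes "hom_poly n m F"
  shows has_line_derivative: "((\<lambda>t. F (\<lambda>i. v i + t * w i)) has_field_derivative line_derivative F v w) (at 0)"
    and isCont_line_derivative: "isCont (\<lambda>t. line_derivative F (\<lambda>i. v i + t * u i) (\<lambda>i. w i + t * w' i)) 0"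
proof -
  from hom_poly_line_derivative[OF assms] obtain D where
    D: "\<And>v w. ((\<lambda>t. F (\<lambda>i. v i + t * w i)) has_field_derivative D v w) (at 0)"
    "\<And>v u w w'. isCont (\<lambda>t. D (\<lambda>i. v i + t * u i) (\<lambda>i. w i + t * w' i)) 0" by auto
  have "line_derivative F = D" unfolding line_derivative_def
    using DERIV_imp_deriv[OF D(1)] by (intro ext) simp
  with D show "((\<lambda>t. F (\<lambda>i. v i + t * w i)) has_field_derivative line_derivative F v w) (at 0)"
    "isCont (\<lambda>t. line_derivative F (\<lambda>i. v i + t * u i) (\<lambda>i. w i + t * w' i)) 0" by auto
qed

lemma isCont_hom_poly_line:
  "hom_poly n m F \<Longrightarrow> isCont (\<lambda>t. F (\<lambda>i. v i + t * w i)) 0"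
  using has_line_derivative DERIV_isCont by blast

lemma isCont_nonzero_nhds:
  fixes f :: "complex \<Rightarrow> complex"
  assumes "isCont f 0" "f 0 \<noteq> 0"
  shows "\<forall>\<^sub>F t in nhds 0. f t \<noteq> 0"
proof -
  have "\<forall>\<^sub>F t in at 0. f t \<noteq> 0" using assms by (intro tendsto_imp_eventually_ne[of f "f 0"]) (simp_all add: isCont_def)
  then show ?thesis using assms(2) by (auto simp: eventually_at_filter elim: eventually_mono)
qed

text \<open>A polynomial \<open>F\<close> whose nonvanishing locus lies in \<open>V\<close> is
  continuous along the line and nonzero at its start; a coordinate with
  \<open>v j \<noteq> 0\<close> keeps the vector itself from becoming 0.\<close>

lemma line_in_zopen:
  assumes "zopen (proj_space n) V" "pclass v \<in> V" "u \<in> vecs n"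
  shows "\<forall>\<^sub>F t in nhds 0. pclass (\<lambda>i. v i + t * u i) \<in> V"
proof -
  obtain m F where F: "hom_poly n m F" "F v \<noteq> 0" "nonvanishing (proj_points n) F \<subseteq> V"
    by (rule zopen_proj_space_basis[OF assms(1,2)]) (rule that)
  have v: "v \<in> vecs n" "v \<noteq> (\<lambda>_. 0)"
    using zopen_proj_space_subset[OF assms(1)] assms(2) pclass_in_proj_points[of v n] by auto
  then obtain j where j: "v j \<noteq> 0" by (auto simp: fun_eq_iff)
  have "isCont (\<lambda>t. v j + t * u j) 0" by (intro continuous_intros)
  then have "\<forall>\<^sub>F t in nhds 0. v j + t * u j \<noteq> 0" using j by (intro isCont_nonzero_nhds) auto
  moreover have "\<forall>\<^sub>F t in nhds 0. F (\<lambda>i. v i + t * u i) \<noteq> 0"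
    using F(2) by (intro isCont_nonzero_nhds isCont_hom_poly_line[OF F(1)]) auto
  ultimately show ?thesis
  proof eventually_elim
    case (elim t)
    then have "(\<lambda>i. v i + t * u i) \<noteq> (\<lambda>_. 0)" by (auto dest: fun_cong[of _ _ j])
    then have "pclass (\<lambda>i. v i + t * u i) \<in> nonvanishing (proj_points n) F"
      using nonvanishing_proj_points[OF F(1)] elim(2) vecs_line[OF v(1) assms(3)] by simp
    then show ?case using F(3) by blast
  qed
qed

lemma differential_fraction:
  assumes V: "zopen (proj_space n) V" "pclass v \<in> V" "w \<in> vecs n"
    and F: "hom_poly n m F" "hom_poly n m G" "G v \<noteq> 0"
    and f: "\<And>u. pclass u \<in> V \<Longrightarrow> G u \<noteq> 0 \<Longrightarrow> f (pclass u) = F u / G u"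
  shows "((\<lambda>t. f (pclass (\<lambda>i. v i + t * w i))) has_field_derivative
     (line_derivative F v w * G v - F v * line_derivative G v w) / (G v * G v)) (at 0)"
proof -
  have G: "G (\<lambda>i. v i + 0 * w i) \<noteq> 0" using F(3) by simp
  have "((\<lambda>t. F (\<lambda>i. v i + t * w i) / G (\<lambda>i. v i + t * w i)) has_field_derivative
     (line_derivative F v w * G v - F v * line_derivative G v w) / (G v * G v)) (at 0)"
    using DERIV_divide[OF has_line_derivative[OF F(1)] has_line_derivative[OF F(2)] G] by simp
  moreover have "\<forall>\<^sub>F t in nhds 0. f (pclass (\<lambda>i. v i + t * w i)) = F (\<lambda>i. v i + t * w i) / G (\<lambda>i. v i + t * w i)"
    using line_in_zopen[OF V] isCont_nonzero_nhds[OF isCont_hom_poly_line[OF F(2)] G]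
    by eventually_elim (simp add: f)
  ultimately show ?thesis by (subst DERIV_cong_ev[OF refl _ refl])
qed

lemma
  assumes V: "zopen (proj_space n) V" "pclass v \<in> V" and f: "f \<in> regular (proj_space n) V"
  shows regular_has_differential: "w \<in> vecs n \<Longrightarrow>
      ((\<lambda>t. f (pclass (\<lambda>i. v i + t * w i))) has_field_derivative differential f v w) (at 0)"
    and differential_converges: "u \<in> vecs n \<Longrightarrow> w \<in> vecs n \<Longrightarrow> w' \<in> vecs n \<Longrightarrow>
      \<exists>L. ((\<lambda>t. differential f (\<lambda>i. v i + t * u i) (\<lambda>i. w i + t * w' i)) \<longlongrightarrow> L) (at 0)"
proof -
  obtain m F G where F: "hom_poly n m F" "hom_poly n m G" "G v \<noteq> 0"
    "\<And>u. pclass u \<in> V \<Longrightarrow> pclass u \<in> proj_points n \<Longrightarrow> G u \<noteq> 0 \<Longrightarrow> f (pclass u) = F u / G u"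
    by (rule regular_proj_spaceE[OF f V(2)]) (rule that)
  have f: "f (pclass u) = F u / G u" if "pclass u \<in> V" "G u \<noteq> 0" for u
    using F(4)[of u] that zopen_proj_space_subset[OF V(1)] by blast
  have d: "((\<lambda>t. f (pclass (\<lambda>i. v i + t * w i))) has_field_derivative
     (line_derivative F v w * G v - F v * line_derivative G v w) / (G v * G v)) (at 0)"
    if "pclass v \<in> V" "G v \<noteq> 0" "w \<in> vecs n" for v w
    using that by (intro differential_fraction[OF V(1) _ _ F(1,2) _ f])
  have d_eq: "differential f v w = (line_derivative F v w * G v - F v * line_derivative G v w) / (G v * G v)"
    if "pclass v \<in> V" "G v \<noteq> 0" "w \<in> vecs n" for v w
    unfolding differential_def using DERIV_imp_deriv[OF d[OF that]] .
  show "((\<lambda>t. f (pclass (\<lambda>i. v i + t * w i))) has_field_derivative differential f v w) (at 0)" if "w \<in> vecs n"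
    using d[OF V(2) F(3) that] d_eq[OF V(2) F(3) that] by simp
  assume u: "u \<in> vecs n" and w: "w \<in> vecs n" and w': "w' \<in> vecs n"
  \<comment> \<open>The quotient rule at the moving point and direction: continuous at 0, and equal
    to the differential for small parameters.\<close>
  define L where "L t = (line_derivative F (\<lambda>i. v i + t * u i) (\<lambda>i. w i + t * w' i) * G (\<lambda>i. v i + t * u i) -
    F (\<lambda>i. v i + t * u i) * line_derivative G (\<lambda>i. v i + t * u i) (\<lambda>i. w i + t * w' i)) /
    (G (\<lambda>i. v i + t * u i) * G (\<lambda>i. v i + t * u i))" for t
  have G0: "G (\<lambda>i. v i + 0 * u i) \<noteq> 0" using F(3) by simp
  have "isCont L 0" unfolding L_def
    using G0 by (intro isCont_divide isCont_diff isCont_mult isCont_line_derivative[OF F(1)]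
      isCont_line_derivative[OF F(2)] isCont_hom_poly_line[OF F(1)] isCont_hom_poly_line[OF F(2)]) auto
  moreover have "\<forall>\<^sub>F t in at 0. L t = differential f (\<lambda>i. v i + t * u i) (\<lambda>i. w i + t * w' i)"
  proof -
    have "\<forall>\<^sub>F t in nhds 0. L t = differential f (\<lambda>i. v i + t * u i) (\<lambda>i. w i + t * w' i)"
      using line_in_zopen[OF V u] isCont_nonzero_nhds[OF isCont_hom_poly_line[OF F(2)] G0]
      by eventually_elim (simp add: L_def d_eq vecs_line[OF w w'])
    then show ?thesis by (simp add: eventually_at_filter eventually_mono)
  qed
  ultimately have "((\<lambda>t. differential f (\<lambda>i. v i + t * u i) (\<lambda>i. w i + t * w' i)) \<longlongrightarrow> L 0) (at 0)"
    unfolding isCont_def by (rule Lim_transform_eventually)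
  then show "\<exists>L. ((\<lambda>t. differential f (\<lambda>i. v i + t * u i) (\<lambda>i. w i + t * w' i)) \<longlongrightarrow> L) (at 0)" ..
qed

lemma regular_line_tendsto:
  assumes "zopen (proj_space n) V" "pclass v \<in> V" "f \<in> regular (proj_space n) V" "u \<in> vecs n"
  shows "((\<lambda>t. f (pclass (\<lambda>i. v i + t * u i))) \<longlongrightarrow> f (pclass v)) (at 0)"
  using DERIV_isCont[OF regular_has_differential[OF assms]] by (simp add: isCont_def)

lemma differential_eqI:
  "((\<lambda>t. f (pclass (\<lambda>i. v i + t * w i))) has_field_derivative D) (at 0) \<Longrightarrow> differential f v w = D"
  unfolding differential_def by (rule DERIV_imp_deriv)

lemma differential_mult:
  assumes V: "zopen (proj_space n) V" "pclass v \<in> V" "w \<in> vecs n"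
    and f: "f \<in> regular (proj_space n) V" "g \<in> regular (proj_space n) V"
  shows "differential (\<lambda>x. f x * g x) v w = g (pclass v) * differential f v w + f (pclass v) * differential g v w"
  using DERIV_mult[OF regular_has_differential[OF V(1,2) f(1) V(3)] regular_has_differential[OF V(1,2) f(2) V(3)]]
  by (intro differential_eqI) (simp add: mult.commute)

lemma differential_add:
  assumes V: "zopen (proj_space n) V" "pclass v \<in> V" "w \<in> vecs n"
    and f: "f \<in> regular (proj_space n) V" "g \<in> regular (proj_space n) V"
  shows "differential (\<lambda>x. f x + g x) v w = differential f v w + differential g v w"
  using DERIV_add[OF regular_has_differential[OF V(1,2) f(1) V(3)] regular_has_differential[OF V(1,2) f(2) V(3)]]
  by (intro differential_eqI) simp

lemma differential_const: "differential (\<lambda>_. c) v w = 0"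
  by (simp add: differential_def)

lemma differential_cong:
  assumes V: "zopen (proj_space n) V" "pclass v \<in> V" "w \<in> vecs n"
    and eq: "\<And>x. x \<in> V \<Longrightarrow> f x = g x"
  shows "differential f v w = differential g v w"
  unfolding differential_def
  by (rule deriv_cong_ev[OF _ refl]) (use line_in_zopen[OF V] in \<open>auto elim!: eventually_mono simp: eq\<close>)

definition lin_ratio :: "nat \<Rightarrow> vec \<Rightarrow> vec \<Rightarrow> vec set \<Rightarrow> complex" where
  "lin_ratio n a b x = lin n a (SOME v. v \<in> x) / lin n b (SOME v. v \<in> x)"

lemma representative_pclass: obtains c where "c \<noteq> 0" "(SOME u. u \<in> pclass v) = (\<lambda>i. c * v i)"
proof -
  have "(SOME u. u \<in> pclass v) \<in> pclass v" by (rule someI[of "\<lambda>u. u \<in> pclass v", OF pclass_self])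
  then show ?thesis using that by (auto elim: mem_pclassE)
qed

lemma lin_ratio_pclass: "lin_ratio n a b (pclass v) = lin n a v / lin n b v"
proof -
  obtain c where "c \<noteq> 0" "(SOME u. u \<in> pclass v) = (\<lambda>i. c * v i)" by (rule representative_pclass)
  then show ?thesis by (simp add: lin_ratio_def lin_scale)
qed

lemma local_equation_lin_ratio: "local_equation n H b = lin_ratio n (SOME a. a \<in> H) b"
  by (intro ext) (simp add: local_equation_def lin_ratio_def)

lemma lin_ratio_regular:
  assumes "U \<subseteq> proj_points n" "\<And>v. pclass v \<in> U \<Longrightarrow> lin n b v \<noteq> 0"
  shows "lin_ratio n a b \<in> regular (proj_space n) U"
  by (rule regular_proj_space_fraction[OF hom_poly_lin hom_poly_lin])
     (use assms lin_ratio_pclass in auto)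

lemma differential_lin_ratio:
  assumes "lin n b v \<noteq> 0"
  shows "differential (lin_ratio n a b) v w = (lin n a w * lin n b v - lin n a v * lin n b w) / (lin n b v * lin n b v)"
proof -
  have "((\<lambda>t. (lin n a v + t * lin n a w) / (lin n b v + t * lin n b w)) has_field_derivative
      (lin n a w * lin n b v - lin n a v * lin n b w) / (lin n b v * lin n b v)) (at 0)"
    using assms by (auto intro!: derivative_eq_intros)
  then show ?thesis by (intro differential_eqI) (simp add: lin_ratio_pclass lin_line)
qed

section \<open>Hyperplanes\<close>

text \<open>The linear form is chosen by the same \<open>SOME\<close> as in
  \<open>local_equation\<close>, so that logarithmic derivatives can be written with
  \<open>eqn\<close>; for a point of the dual space, other representatives differ by a nonzero
  factor.\<close>

definition eqn :: "nat \<Rightarrow> vec set \<Rightarrow> vec \<Rightarrow> complex" where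
  "eqn n H v = lin n (SOME a. a \<in> H) v"

lemma eqn_line: "eqn n H (\<lambda>i. v i + t * w i) = eqn n H v + t * eqn n H w"
  by (simp add: eqn_def lin_line)

lemma eqn_scale: "eqn n H (\<lambda>i. c * v i) = c * eqn n H v"
  by (simp add: eqn_def lin_scale)

lemma lin_mem_proj_points:
  assumes "H \<in> proj_points n" "a \<in> H"
  shows "\<exists>c\<noteq>0. \<forall>v. lin n a v = c * eqn n H v"
proof -
  have "pclass (SOME a. a \<in> H) = H" using proj_points_mem(1)[OF assms(1) someI[of "\<lambda>a. a \<in> H", OF assms(2)]] ..
  then have "a \<in> pclass (SOME a. a \<in> H)" using assms(2) by simp
  then show ?thesis by (auto elim!: mem_pclassE simp: eqn_def lin_scale_left)
qed

lemma mem_hyperplane: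
  assumes "H \<in> proj_points n" "pclass v \<in> proj_points n"
  shows "pclass v \<in> hyperplane n H \<longleftrightarrow> eqn n H v = 0"
proof
  assume "pclass v \<in> hyperplane n H"
  moreover obtain a where a: "a \<in> H" using proj_points_nonempty[OF assms(1)] by blast
  moreover obtain c where "c \<noteq> 0" "\<forall>v. lin n a v = c * eqn n H v" using lin_mem_proj_points[OF assms(1) a] by blast
  ultimately show "eqn n H v = 0" using pclass_self[of v] by (auto simp: hyperplane_def)
next
  assume 0: "eqn n H v = 0"
  have "lin n a u = 0" if "a \<in> H" "u \<in> pclass v" for a u
    using lin_mem_proj_points[OF assms(1) that(1)] that(2) 0 by (auto elim!: mem_pclassE simp: eqn_scale)
  then show "pclass v \<in> hyperplane n H" using assms(2) by (simp add: hyperplane_def)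
qed

lemma dlog_local_equation:
  assumes "lin n b v \<noteq> 0" "eqn n H v \<noteq> 0"
  shows "dlog (local_equation n H b) v w = eqn n H w / eqn n H v - lin n b w / lin n b v"
  using assms unfolding dlog_def local_equation_lin_ratio
  by (simp add: differential_lin_ratio lin_ratio_pclass eqn_def field_simps)

section \<open>Logarithmic forms\<close>

text \<open>\<open>general\<close> is general position seen from the primal side: a nonzero vector
  killed by n+1 of the forms would define a hyperplane of the dual space through the corresponding
  points. \<open>H0\<close> is the hyperplane at which functionals are normalised.\<close>

locale arrangement =
  fixes n :: nat and \<A> :: "vec set set" and H0 :: "vec set"
  assumes arr: "\<A> \<subseteq> proj_points n" "finite \<A>" "H0 \<in> \<A>"
    and card_arr: "n + 1 \<le> card \<A>"
    and general: "\<And>T v. T \<subseteq> \<A> \<Longrightarrow> card T = n + 1 \<Longrightarrow> v \<in> vecs n \<Longrightarrow> (\<And>H. H \<in> T \<Longrightarrow> eqn n H v = 0) \<Longrightarrow> v = (\<lambda>_. 0)"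
begin

abbreviation reg :: "vec set set \<Rightarrow> (vec set \<Rightarrow> complex) set" where
  "reg U \<equiv> regular (proj_space n) U"

abbreviation pop :: "vec set set \<Rightarrow> bool" where
  "pop U \<equiv> zopen (proj_space n) U"

lemmas reg_mono = P.regular_mono[of _ n, folded proj_space_def]
lemmas reg_cong = P.regular_cong[of _ n, folded proj_space_def]
lemmas reg_mult = P.regular_mult[of _ n, folded proj_space_def]
lemmas reg_add = P.regular_add[of _ n, folded proj_space_def]
lemmas reg_inverse = P.regular_inverse[of _ n, folded proj_space_def]
lemmas reg_const = P.regular_const[of _ n, folded proj_space_def, unfolded points_proj_space]
lemmas reg_sum = P.regular_sum[of _ n, folded proj_space_def, unfolded points_proj_space]
lemmas reg_minus = P.regular_minus[of _ n, folded proj_space_def, unfolded points_proj_space]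
lemmas pop_sub = zopen_proj_space_subset[of n]

lemma eqn_nonzero:
  assumes "H \<in> \<A>" "pclass v \<in> V - arr_union n \<A>" "pop V"
  shows "eqn n H v \<noteq> 0"
  using assms arr(1) mem_hyperplane[of H n v] pop_sub[OF assms(3)] by (auto simp: arr_union_def)

text \<open>The witnesses hidden in \<open>log_forms\<close> become explicit parameters, so that
  representations can be restricted, added, rescaled and moved to another \<open>b\<close>.\<close>

definition log_rep where
  "log_rep V b N f g h \<omega> \<longleftrightarrow>
     (\<forall>k<N. f k \<in> reg V \<and> g k \<in> reg V) \<and> (\<forall>H\<in>\<A>. h H \<in> reg V) \<and> (\<forall>v. pclass v \<in> V \<longrightarrow> lin n b v \<noteq> 0) \<and>
     forms_agree_on n (V - arr_union n \<A>) \<omega>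
       (\<lambda>v w. (\<Sum>k<N. f k (pclass v) * differential (g k) v w) +
              (\<Sum>H\<in>\<A>. h H (pclass v) * dlog (local_equation n H b) v w))" for N :: nat

lemma log_rep_agree:
  assumes "log_rep V b N f g h \<omega>" "pclass v \<in> V" "pclass v \<notin> arr_union n \<A>" "w \<in> vecs n"
  shows "\<omega> v w = (\<Sum>k<N. f k (pclass v) * differential (g k) v w) +
              (\<Sum>H\<in>\<A>. h H (pclass v) * dlog (local_equation n H b) v w)"
  using assms by (auto simp: log_rep_def forms_agree_on_def)

lemma log_rep_reg:
  assumes "log_rep V b N f g h \<omega>"
  shows "k < N \<Longrightarrow> f k \<in> reg V" "k < N \<Longrightarrow> g k \<in> reg V" "H \<in> \<A> \<Longrightarrow> h H \<in> reg V"
    "pclass v \<in> V \<Longrightarrow> lin n b v \<noteq> 0"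
  using assms by (auto simp: log_rep_def)

lemma log_repI:
  assumes "\<And>k. k < N \<Longrightarrow> f k \<in> reg V" "\<And>k. k < N \<Longrightarrow> g k \<in> reg V" "\<And>H. H \<in> \<A> \<Longrightarrow> h H \<in> reg V"
    "\<And>v. pclass v \<in> V \<Longrightarrow> lin n b v \<noteq> 0"
    "\<And>v w. pclass v \<in> V \<Longrightarrow> pclass v \<notin> arr_union n \<A> \<Longrightarrow> w \<in> vecs n \<Longrightarrow>
       \<omega> v w = (\<Sum>k<N. f k (pclass v) * differential (g k) v w) +
              (\<Sum>H\<in>\<A>. h H (pclass v) * dlog (local_equation n H b) v w)"
  shows "log_rep V b N f g h \<omega>"
  using assms by (auto simp: log_rep_def forms_agree_on_def)

lemma log_rep_mono: "log_rep V b N f g h \<omega> \<Longrightarrow> V' \<subseteq> V \<Longrightarrow> log_rep V' b N f g h \<omega>"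
  by (rule log_repI) (auto dest: log_rep_reg log_rep_agree intro: reg_mono)

lemma log_forms_iff:
  "\<omega> \<in> log_forms n \<A> U \<longleftrightarrow> (\<forall>x\<in>U. \<exists>V N f g h b. pop V \<and> x \<in> V \<and> V \<subseteq> U \<and> log_rep V b N f g h \<omega>)"
proof -
  have "(\<forall>y\<in>V. \<forall>v\<in>y. lin n b v \<noteq> 0) \<longleftrightarrow> (\<forall>v. pclass v \<in> V \<longrightarrow> lin n b v \<noteq> 0)" if "pop V" for V b
  proof
    assume "\<forall>y\<in>V. \<forall>v\<in>y. lin n b v \<noteq> 0"
    then show "\<forall>v. pclass v \<in> V \<longrightarrow> lin n b v \<noteq> 0" using pclass_self by blast
  next
    assume *: "\<forall>v. pclass v \<in> V \<longrightarrow> lin n b v \<noteq> 0"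
    show "\<forall>y\<in>V. \<forall>v\<in>y. lin n b v \<noteq> 0"
    proof (intro ballI)
      fix y v assume "y \<in> V" "v \<in> y"
      then have "y = pclass v" using proj_points_mem(1) pop_sub[OF that] by blast
      with \<open>y \<in> V\<close> * show "lin n b v \<noteq> 0" by blast
    qed
  qed
  then show ?thesis unfolding log_forms_def log_rep_def by (simp cong: conj_cong)
qed

lemma log_formsE:
  assumes "\<omega> \<in> log_forms n \<A> U" "x \<in> U"
  obtains V N f g h b where "pop V" "x \<in> V" "V \<subseteq> U" "log_rep V b N f g h \<omega>"
proof -
  have "\<exists>V N f g h b. pop V \<and> x \<in> V \<and> V \<subseteq> U \<and> log_rep V b N f g h \<omega>"
    using assms(1)[unfolded log_forms_iff] assms(2) by (rule bspec)
  then show ?thesis by (elim exE conjE) (rule that)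
qed

lemma log_forms_mono:
  assumes "\<omega> \<in> log_forms n \<A> U" "pop U'" "U' \<subseteq> U"
  shows "\<omega> \<in> log_forms n \<A> U'"
  unfolding log_forms_iff
proof
  fix x assume x: "x \<in> U'"
  then have "x \<in> U" using assms(3) by blast
  obtain V N f g h b where V: "pop V" "x \<in> V" "V \<subseteq> U" "log_rep V b N f g h \<omega>"
    by (rule log_formsE[OF assms(1) \<open>x \<in> U\<close>]) (rule that)
  have "pop (V \<inter> U')" "x \<in> V \<inter> U'" "V \<inter> U' \<subseteq> U'" using V assms x by auto
  moreover have "log_rep (V \<inter> U') b N f g h \<omega>" using log_rep_mono[OF V(4)] by blast
  ultimately show "\<exists>V N f g h b. pop V \<and> x \<in> V \<and> V \<subseteq> U' \<and> log_rep V b N f g h \<omega>"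
    by (intro exI conjI)
qed

lemma log_rep_log_forms: "pop V \<Longrightarrow> log_rep V b N f g h \<omega> \<Longrightarrow> \<omega> \<in> log_forms n \<A> V"
  unfolding log_forms_iff by (intro ballI exI conjI) (assumption | rule subset_refl)+

lemma log_stalkI: "\<omega> \<in> log_forms n \<A> U \<Longrightarrow> pop U \<Longrightarrow> x \<in> U \<Longrightarrow> \<omega> \<in> log_stalk n \<A> x"
  by (auto simp: log_stalk_def)

lemma log_rep_log_stalk: "pop V \<Longrightarrow> log_rep V b N f g h \<omega> \<Longrightarrow> x \<in> V \<Longrightarrow> \<omega> \<in> log_stalk n \<A> x"
  using log_rep_log_forms log_stalkI by blast

definition affine_part :: "vec \<Rightarrow> vec set set" where
  "affine_part b = nonvanishing (proj_points n) (lin n b)"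

lemma pop_affine_part: "pop (affine_part b)"
  unfolding affine_part_def by (rule zopen_nonvanishing_proj_points[OF hom_poly_lin])

lemma mem_affine_part: "pclass v \<in> affine_part b \<longleftrightarrow> v \<in> vecs n \<and> v \<noteq> (\<lambda>_. 0) \<and> lin n b v \<noteq> 0"
  unfolding affine_part_def by (rule nonvanishing_proj_points[OF hom_poly_lin])

lemma affine_part_sub: "affine_part b \<subseteq> proj_points n"
  using pop_sub[OF pop_affine_part] .

lemma lin_ratio_reg: "V \<subseteq> affine_part b \<Longrightarrow> lin_ratio n a b \<in> reg V"
  using affine_part_sub by (intro lin_ratio_regular) (auto simp: mem_affine_part)

text \<open>Changing the auxiliary form \<open>b\<close> costs the regular form \<open>dlog (b / b')\<close>.\<close>

lemma log_rep_rebase: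
  assumes V: "pop V" and rep: "log_rep V b N f g h \<omega>" and b': "\<And>v. pclass v \<in> V \<Longrightarrow> lin n b' v \<noteq> 0"
  shows "log_rep V b' (Suc N) (f(N := \<lambda>x. - ((\<Sum>H\<in>\<A>. h H x) * lin_ratio n b' b x))) (g(N := lin_ratio n b b')) h \<omega>"
proof (rule log_repI)
  have sub: "V \<subseteq> proj_points n" by (rule pop_sub[OF V])
  have r: "lin_ratio n b' b \<in> reg V" "lin_ratio n b b' \<in> reg V"
    using log_rep_reg(4)[OF rep] b' sub by (auto intro!: lin_ratio_regular)
  have s: "(\<lambda>x. - ((\<Sum>H\<in>\<A>. h H x) * lin_ratio n b' b x)) \<in> reg V"
    by (intro reg_minus sub reg_mult reg_sum r log_rep_reg(3)[OF rep])
  show "(f(N := \<lambda>x. - ((\<Sum>H\<in>\<A>. h H x) * lin_ratio n b' b x))) k \<in> reg V"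
    "(g(N := lin_ratio n b b')) k \<in> reg V" if "k < Suc N" for k
    using that log_rep_reg(1,2)[OF rep] r s by (cases "k = N"; simp)+
  fix v w assume v: "pclass v \<in> V" "pclass v \<notin> arr_union n \<A>" and w: "w \<in> vecs n"
  have b: "lin n b v \<noteq> 0" "lin n b' v \<noteq> 0" using log_rep_reg(4)[OF rep] b' v by auto
  \<comment> \<open>Passing from \<open>b\<close> to \<open>b'\<close> changes every
    \<open>dlog\<close> term by the same form dlog (b' / b), which is -(b' / b) d(b / b') and hence
    regular on \<open>V\<close>.\<close>
  define e where "e = lin n b' w / lin n b' v - lin n b w / lin n b v"
  have "(\<Sum>H\<in>\<A>. h H (pclass v) * dlog (local_equation n H b) v w) =
      (\<Sum>H\<in>\<A>. h H (pclass v) * dlog (local_equation n H b') v w) + (\<Sum>H\<in>\<A>. h H (pclass v)) * e"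
    unfolding sum_distrib_right sum.distrib[symmetric]
    using eqn_nonzero[OF _ DiffI[OF v] V] b by (intro sum.cong) (simp_all add: dlog_local_equation e_def algebra_simps)
  moreover have "e = - lin_ratio n b' b (pclass v) * differential (lin_ratio n b b') v w"
    using b by (simp add: e_def differential_lin_ratio lin_ratio_pclass field_simps)
  ultimately show "\<omega> v w = (\<Sum>k<Suc N. (f(N := \<lambda>x. - ((\<Sum>H\<in>\<A>. h H x) * lin_ratio n b' b x))) k (pclass v) *
        differential ((g(N := lin_ratio n b b')) k) v w) +
      (\<Sum>H\<in>\<A>. h H (pclass v) * dlog (local_equation n H b') v w)"
    using log_rep_agree[OF rep v w] by (simp add: algebra_simps)
qed (use b' log_rep_reg(3)[OF rep] in auto)

section \<open>Germs of logarithmic forms\<close>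

lemma log_stalk_rep:
  assumes "\<omega> \<in> log_stalk n \<A> x" "x \<in> affine_part b"
  obtains V N f g h where "pop V" "x \<in> V" "V \<subseteq> affine_part b" "log_rep V b N f g h \<omega>"
proof -
  obtain U where U: "pop U" "x \<in> U" "\<omega> \<in> log_forms n \<A> U" using assms(1) by (auto simp: log_stalk_def)
  obtain V N f g h b' where V: "pop V" "x \<in> V" "V \<subseteq> U" "log_rep V b' N f g h \<omega>"
    by (rule log_formsE[OF U(3,2)]) (rule that)
  have V': "pop (V \<inter> affine_part b)" "x \<in> V \<inter> affine_part b" "V \<inter> affine_part b \<subseteq> affine_part b"
    using V pop_affine_part assms(2) by auto
  have "lin n b v \<noteq> 0" if "pclass v \<in> V \<inter> affine_part b" for v using that by (simp add: mem_affine_part)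
  from that[OF V' log_rep_rebase[OF V'(1) log_rep_mono[OF V(4)] this]] show ?thesis by simp
qed

lemma log_rep_add:
  assumes V: "pop V" and 1: "log_rep V b N f g h \<omega>" and 2: "log_rep V b N' f' g' h' \<omega>'"
  shows "log_rep V b (N + N') (\<lambda>k. if k < N then f k else f' (k - N)) (\<lambda>k. if k < N then g k else g' (k - N))
     (\<lambda>H x. h H x + h' H x) (\<lambda>v w. \<omega> v w + \<omega>' v w)"
proof (rule log_repI)
  fix v w assume v: "pclass v \<in> V" "pclass v \<notin> arr_union n \<A>" and w: "w \<in> vecs n"
  have split: "(\<Sum>k<N + N'. (if k < N then F k else F' (k - N))) = (\<Sum>k<N. F k) + (\<Sum>k<N'. F' k)"
    for F F' :: "nat \<Rightarrow> complex"
  by (induction N') (auto intro: sum.cong)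
  have "(\<Sum>k<N + N'. (if k < N then f k else f' (k - N)) (pclass v) * differential (if k < N then g k else g' (k - N)) v w) =
     (\<Sum>k<N. f k (pclass v) * differential (g k) v w) + (\<Sum>k<N'. f' k (pclass v) * differential (g' k) v w)"
    unfolding split[symmetric] by (intro sum.cong) auto
  then show "\<omega> v w + \<omega>' v w =
      (\<Sum>k<N + N'. (if k < N then f k else f' (k - N)) (pclass v) * differential (if k < N then g k else g' (k - N)) v w) +
      (\<Sum>H\<in>\<A>. (h H (pclass v) + h' H (pclass v)) * dlog (local_equation n H b) v w)"
    using log_rep_agree[OF 1 v w] log_rep_agree[OF 2 v w] by (simp add: algebra_simps sum.distrib)
qed (use log_rep_reg[OF 1] log_rep_reg[OF 2] in \<open>auto intro: reg_add\<close>)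

lemma log_rep_scale:
  assumes V: "pop V" and 1: "log_rep V b N f g h \<omega>" and c: "c \<in> reg V"
  shows "log_rep V b N (\<lambda>k x. c x * f k x) g (\<lambda>H x. c x * h H x) (\<lambda>v w. c (pclass v) * \<omega> v w)"
proof (rule log_repI)
  fix v w assume v: "pclass v \<in> V" "pclass v \<notin> arr_union n \<A>" and w: "w \<in> vecs n"
  show "c (pclass v) * \<omega> v w = (\<Sum>k<N. c (pclass v) * f k (pclass v) * differential (g k) v w) +
      (\<Sum>H\<in>\<A>. c (pclass v) * h H (pclass v) * dlog (local_equation n H b) v w)"
    using log_rep_agree[OF 1 v w] by (simp add: algebra_simps sum_distrib_left)
qed (use log_rep_reg[OF 1] c in \<open>auto intro: reg_mult\<close>)

lemma in_affine_part:
  assumes "x \<in> proj_points n" obtains j where "j \<le> n" "x \<in> affine_part (\<lambda>i. if i = j then 1 else 0)"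
proof -
  obtain v where v: "v \<in> vecs n" "v \<noteq> (\<lambda>_. 0)" "x = pclass v" using assms by (auto simp: proj_points_def)
  then obtain j where j: "v j \<noteq> 0" by (auto simp: fun_eq_iff)
  then have "j \<le> n" using v(1) by (metis (mono_tags, lifting) mem_Collect_eq not_le vecs_def)
  then have "lin n (\<lambda>i. if i = j then 1 else 0) v = v j" by (simp add: lin_def if_distrib[of "\<lambda>c. c * _"] cong: if_cong)
  then show ?thesis using that[of j] v j \<open>j \<le> n\<close> by (simp add: mem_affine_part)
qed

lemma log_stalk_add:
  assumes "x \<in> proj_points n" "\<omega> \<in> log_stalk n \<A> x" "\<omega>' \<in> log_stalk n \<A> x"
  shows "(\<lambda>v w. \<omega> v w + \<omega>' v w) \<in> log_stalk n \<A> x"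
proof -
  obtain j where j: "x \<in> affine_part (\<lambda>i. if i = j then 1 else 0)" (is "x \<in> affine_part ?b") by (rule in_affine_part[OF assms(1)])
  obtain V N f g h where V: "pop V" "x \<in> V" "log_rep V ?b N f g h \<omega>" by (rule log_stalk_rep[OF assms(2) j]) (rule that)
  obtain V' N' f' g' h' where V': "pop V'" "x \<in> V'" "log_rep V' ?b N' f' g' h' \<omega>'" by (rule log_stalk_rep[OF assms(3) j]) (rule that)
  have I: "pop (V \<inter> V')" "x \<in> V \<inter> V'" using V V' by auto
  show ?thesis
    by (rule log_rep_log_stalk[OF I(1) log_rep_add[OF I(1) log_rep_mono[OF V(3)] log_rep_mono[OF V'(3)]] I(2)]) auto
qed

lemma log_stalk_scale:
  assumes "x \<in> proj_points n" "\<omega> \<in> log_stalk n \<A> x" "pop U" "x \<in> U" "c \<in> reg U"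
  shows "(\<lambda>v w. c (pclass v) * \<omega> v w) \<in> log_stalk n \<A> x"
proof -
  obtain j where j: "x \<in> affine_part (\<lambda>i. if i = j then 1 else 0)" (is "x \<in> affine_part ?b") by (rule in_affine_part[OF assms(1)])
  obtain V N f g h where V: "pop V" "x \<in> V" "log_rep V ?b N f g h \<omega>" by (rule log_stalk_rep[OF assms(2) j]) (rule that)
  have I: "pop (V \<inter> U)" "x \<in> V \<inter> U" using V assms by auto
  show ?thesis
    by (rule log_rep_log_stalk[OF I(1) log_rep_scale[OF I(1) log_rep_mono[OF V(3)] reg_mono[OF assms(5)]] I(2)]) auto
qed

lemma differential_log_rep:
  assumes "V \<subseteq> affine_part b" "f \<in> reg V"
  shows "log_rep V b 1 (\<lambda>_ _. 1) (\<lambda>_. f) (\<lambda>_ _. 0) (differential f)"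
proof -
  have "V \<subseteq> proj_points n" using assms(1) affine_part_sub by blast
  then show ?thesis using assms by (intro log_repI reg_const) (auto simp: mem_affine_part)
qed

lemma differential_log_stalk:
  assumes "pop V" "x \<in> V" "f \<in> reg V"
  shows "differential f \<in> log_stalk n \<A> x"
proof -
  obtain j where j: "x \<in> affine_part (\<lambda>i. if i = j then 1 else 0)" (is "x \<in> affine_part ?b")
    using in_affine_part pop_sub[OF assms(1)] assms(2) by blast
  show ?thesis
    by (rule log_rep_log_stalk[OF _ differential_log_rep[of "V \<inter> affine_part ?b" ?b]])
       (use assms pop_affine_part j in \<open>auto intro: reg_mono\<close>)
qed

lemma dlog_log_rep:
  assumes "V \<subseteq> affine_part b" "H \<in> \<A>"
  shows "log_rep V b 0 f g (\<lambda>H' _. if H' = H then 1 else 0) (dlog (local_equation n H b))"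
proof -
  have V: "V \<subseteq> proj_points n" using assms(1) affine_part_sub by blast
  then have "(\<lambda>x. if H' = H then 1 else 0) \<in> reg V" for H' by (cases "H' = H") (auto intro: reg_const)
  then show ?thesis using assms V arr(2)
    by (intro log_repI) (auto simp: mem_affine_part if_distrib[of "\<lambda>c. c * _"] cong: if_cong)
qed

lemma dlog_log_stalk: "x \<in> affine_part b \<Longrightarrow> H \<in> \<A> \<Longrightarrow> dlog (local_equation n H b) \<in> log_stalk n \<A> x"
  using log_rep_log_stalk[OF pop_affine_part dlog_log_rep] by blast

section \<open>Global logarithmic forms\<close>

definition om :: "vec set \<Rightarrow> form" where
  "om H = (\<lambda>v w. eqn n H w / eqn n H v - eqn n H0 w / eqn n H0 v)"

text \<open>The contribution of \<open>b\<close> is the same in both \<open>dlog\<close> terms and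
  cancels in their difference. This is why \<open>om H\<close> is a logarithmic form on all of
  projective space.\<close>

lemma om_log_rep:
  assumes "V \<subseteq> affine_part b" "H \<in> \<A>" "pop V"
  shows "log_rep V b 0 f g (\<lambda>H' _. (if H' = H then 1 else 0) - (if H' = H0 then 1 else 0)) (om H)"
proof (rule log_repI)
  have V: "V \<subseteq> proj_points n" using assms(1) affine_part_sub by blast
  then show "(\<lambda>_. (if H' = H then 1 else 0) - (if H' = H0 then 1 else 0)) \<in> reg V" for H' by (rule reg_const)
  show b: "lin n b v \<noteq> 0" if "pclass v \<in> V" for v using that assms(1) by (auto simp: mem_affine_part)
  fix v w assume v: "pclass v \<in> V" "pclass v \<notin> arr_union n \<A>"
  have "(\<Sum>H'\<in>\<A>. ((if H' = H then 1 else 0) - (if H' = H0 then 1 else 0)) * dlog (local_equation n H' b) v w) =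
    dlog (local_equation n H b) v w - dlog (local_equation n H0 b) v w"
    unfolding left_diff_distrib sum_subtractf
    using arr(2,3) assms(2) by (simp add: if_distrib[of "\<lambda>c. c * _"] cong: if_cong)
  then show "om H v w = (\<Sum>k<0. f k (pclass v) * differential (g k) v w) +
       (\<Sum>H'\<in>\<A>. ((if H' = H then 1 else 0) - (if H' = H0 then 1 else 0)) * dlog (local_equation n H' b) v w)"
    using eqn_nonzero[OF assms(2) DiffI[OF v] assms(3)] eqn_nonzero[OF arr(3) DiffI[OF v] assms(3)] b[OF v(1)]
    by (simp add: dlog_local_equation om_def)
qed auto

lemma om_log_forms: "H \<in> \<A> \<Longrightarrow> om H \<in> log_forms n \<A> (proj_points n)"
  unfolding log_forms_iff
proof
  fix x assume H: "H \<in> \<A>" and x: "x \<in> proj_points n"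
  obtain j where j: "x \<in> affine_part (\<lambda>i. if i = j then 1 else 0)" (is "x \<in> affine_part ?b") by (rule in_affine_part[OF x])
  show "\<exists>V N f g h b. pop V \<and> x \<in> V \<and> V \<subseteq> proj_points n \<and> log_rep V b N f g h (om H)"
    by (intro exI conjI) (rule pop_affine_part, rule j, rule affine_part_sub, rule om_log_rep[OF subset_refl H pop_affine_part])
qed

lemma pop_proj_points: "pop (proj_points n)"
  using openin_topspace[of "zariski (proj_space n)"] points_proj_space[of n] by simp

lemma om_log_stalk: "H \<in> \<A> \<Longrightarrow> x \<in> proj_points n \<Longrightarrow> om H \<in> log_stalk n \<A> x"
  using log_stalkI[OF om_log_forms pop_proj_points] .

section \<open>Fibres of the logarithmic tangent bundle\<close>

lemma dualD:
  assumes "l \<in> log_fibre_dual n \<A> x"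
  shows dual_add: "\<omega> \<in> log_stalk n \<A> x \<Longrightarrow> \<omega>' \<in> log_stalk n \<A> x \<Longrightarrow> l (\<lambda>v w. \<omega> v w + \<omega>' v w) = l \<omega> + l \<omega>'"
    and dual_mult: "\<omega> \<in> log_stalk n \<A> x \<Longrightarrow> pop U \<Longrightarrow> x \<in> U \<Longrightarrow> f \<in> reg U \<Longrightarrow> l (\<lambda>v w. f (pclass v) * \<omega> v w) = f x * l \<omega>"
    and dual_agree: "\<omega> \<in> log_stalk n \<A> x \<Longrightarrow> \<omega>' \<in> log_stalk n \<A> x \<Longrightarrow> pop U \<Longrightarrow> x \<in> U \<Longrightarrow>
        (\<And>v w. pclass v \<in> U \<Longrightarrow> pclass v \<notin> arr_union n \<A> \<Longrightarrow> w \<in> vecs n \<Longrightarrow> \<omega> v w = \<omega>' v w) \<Longrightarrow> l \<omega> = l \<omega>'"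
    and dual_outside: "\<omega> \<notin> log_stalk n \<A> x \<Longrightarrow> l \<omega> = 0"
proof -
  have 1: "\<forall>\<omega> \<in> log_stalk n \<A> x. \<forall>\<omega>' \<in> log_stalk n \<A> x. l (\<lambda>v w. \<omega> v w + \<omega>' v w) = l \<omega> + l \<omega>'"
    and 2: "\<forall>\<omega> \<in> log_stalk n \<A> x. \<forall>U f. zopen (proj_space n) U \<and> x \<in> U \<and> f \<in> regular (proj_space n) U \<longrightarrow>
            l (\<lambda>v w. f (pclass v) * \<omega> v w) = f x * l \<omega>"
    and 3: "\<forall>\<omega> \<in> log_stalk n \<A> x. \<forall>\<omega>' \<in> log_stalk n \<A> x. \<forall>U. zopen (proj_space n) U \<and> x \<in> U \<and>
            forms_agree_on n (U - arr_union n \<A>) \<omega> \<omega>' \<longrightarrow> l \<omega> = l \<omega>'"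
    and 4: "\<forall>\<omega>. \<omega> \<notin> log_stalk n \<A> x \<longrightarrow> l \<omega> = 0"
    using assms unfolding log_fibre_dual_def by simp_all
  show "l (\<lambda>v w. \<omega> v w + \<omega>' v w) = l \<omega> + l \<omega>'" if "\<omega> \<in> log_stalk n \<A> x" "\<omega>' \<in> log_stalk n \<A> x"
    using bspec[OF bspec[OF 1 that(1)] that(2)] .
  show "l (\<lambda>v w. f (pclass v) * \<omega> v w) = f x * l \<omega>" if "\<omega> \<in> log_stalk n \<A> x" "pop U" "x \<in> U" "f \<in> reg U"
    using bspec[OF 2 that(1), rule_format, of U f] that(2-) by simp
  show "l \<omega> = l \<omega>'" if "\<omega> \<in> log_stalk n \<A> x" "\<omega>' \<in> log_stalk n \<A> x" "pop U" "x \<in> U"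
     "\<And>v w. pclass v \<in> U \<Longrightarrow> pclass v \<notin> arr_union n \<A> \<Longrightarrow> w \<in> vecs n \<Longrightarrow> \<omega> v w = \<omega>' v w"
    using bspec[OF bspec[OF 3 that(1)] that(2), rule_format, of U] that(3-) by (simp add: forms_agree_on_def)
  show "l \<omega> = 0" if "\<omega> \<notin> log_stalk n \<A> x" using 4 that by simp
qed

lemma om_H0: "om H0 = (\<lambda>_ _. 0)"
  by (simp add: om_def)

lemma zero_log_stalk: "x \<in> proj_points n \<Longrightarrow> (\<lambda>_ _. 0) \<in> log_stalk n \<A> x"
  using om_log_stalk[OF arr(3)] om_H0 by simp

lemma dual_zero:
  assumes "l \<in> log_fibre_dual n \<A> x" "x \<in> proj_points n"
  shows "l (\<lambda>_ _. 0) = 0"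
  using dual_mult[OF assms(1) zero_log_stalk[OF assms(2)] pop_proj_points assms(2) reg_const[OF subset_refl], of 0] by simp

lemma dual_sum:
  assumes l: "l \<in> log_fibre_dual n \<A> x" "x \<in> proj_points n" and K: "finite K" "\<And>k. k \<in> K \<Longrightarrow> \<omega> k \<in> log_stalk n \<A> x"
  shows "(\<lambda>v w. \<Sum>k\<in>K. \<omega> k v w) \<in> log_stalk n \<A> x" "l (\<lambda>v w. \<Sum>k\<in>K. \<omega> k v w) = (\<Sum>k\<in>K. l (\<omega> k))"
proof -
  have "(\<lambda>v w. \<Sum>k\<in>K. \<omega> k v w) \<in> log_stalk n \<A> x \<and> l (\<lambda>v w. \<Sum>k\<in>K. \<omega> k v w) = (\<Sum>k\<in>K. l (\<omega> k))"
    using K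
  proof (induction K rule: finite_induct)
    case empty
    then show ?case using zero_log_stalk[OF l(2)] dual_zero[OF l] by simp
  next
    case (insert k K)
    have k: "\<omega> k \<in> log_stalk n \<A> x" by (rule insert.prems) simp
    have IH: "(\<lambda>v w. \<Sum>k\<in>K. \<omega> k v w) \<in> log_stalk n \<A> x" "l (\<lambda>v w. \<Sum>k\<in>K. \<omega> k v w) = (\<Sum>k\<in>K. l (\<omega> k))"
      using insert.IH insert.prems by simp_all
    show ?case using log_stalk_add[OF l(2) k IH(1)] dual_add[OF l(1) k IH(1)] IH(2) insert.hyps by simp
  qed
  then show "(\<lambda>v w. \<Sum>k\<in>K. \<omega> k v w) \<in> log_stalk n \<A> x" "l (\<lambda>v w. \<Sum>k\<in>K. \<omega> k v w) = (\<Sum>k\<in>K. l (\<omega> k))" by auto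
qed

text \<open>A functional sees only the values of the coefficients at \<open>x\<close>, and it cannot
  distinguish the form from its representation, since the two agree off the arrangement near
  \<open>x\<close>. So it may be applied term by term.\<close>

lemma dual_log_rep:
  assumes V: "pop V" "x \<in> V" "V \<subseteq> affine_part b" and rep: "log_rep V b N f g h \<omega>" and l: "l \<in> log_fibre_dual n \<A> x"
  shows "l \<omega> = (\<Sum>k<N. f k x * l (differential (g k))) + (\<Sum>H\<in>\<A>. h H x * l (dlog (local_equation n H b)))"
proof -
  have x: "x \<in> proj_points n" using pop_sub V by blast
  define \<alpha> where "\<alpha> k = (\<lambda>v w. f k (pclass v) * differential (g k) v w)" for k
  define \<beta> where "\<beta> H = (\<lambda>v w. h H (pclass v) * dlog (local_equation n H b) v w)" for H
  have g: "differential (g k) \<in> log_stalk n \<A> x" if "k < N" for k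
    using differential_log_stalk[OF V(1,2)] log_rep_reg(2)[OF rep that] by simp
  have d: "dlog (local_equation n H b) \<in> log_stalk n \<A> x" if "H \<in> \<A>" for H
    using dlog_log_stalk[OF _ that] V by blast
  have \<alpha>: "\<alpha> k \<in> log_stalk n \<A> x" "l (\<alpha> k) = f k x * l (differential (g k))" if "k < N" for k
    unfolding \<alpha>_def using log_rep_reg(1)[OF rep that] g[OF that]
    by (auto intro!: log_stalk_scale[OF x _ V(1,2)] dual_mult[OF l _ V(1,2)])
  have \<beta>: "\<beta> H \<in> log_stalk n \<A> x" "l (\<beta> H) = h H x * l (dlog (local_equation n H b))" if "H \<in> \<A>" for H
    unfolding \<beta>_def using log_rep_reg(3)[OF rep that] d[OF that]
    by (auto intro!: log_stalk_scale[OF x _ V(1,2)] dual_mult[OF l _ V(1,2)])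
  have A: "(\<lambda>v w. \<Sum>k<N. \<alpha> k v w) \<in> log_stalk n \<A> x" "l (\<lambda>v w. \<Sum>k<N. \<alpha> k v w) = (\<Sum>k<N. l (\<alpha> k))"
    using dual_sum[OF l x, of "{..<N}" \<alpha>] \<alpha>(1) by simp_all
  have B: "(\<lambda>v w. \<Sum>H\<in>\<A>. \<beta> H v w) \<in> log_stalk n \<A> x" "l (\<lambda>v w. \<Sum>H\<in>\<A>. \<beta> H v w) = (\<Sum>H\<in>\<A>. l (\<beta> H))"
    using dual_sum[OF l x arr(2), of \<beta>] \<beta>(1) by simp_all
  have "l \<omega> = l (\<lambda>v w. (\<Sum>k<N. \<alpha> k v w) + (\<Sum>H\<in>\<A>. \<beta> H v w))"
    by (rule dual_agree[OF l log_rep_log_stalk[OF V(1) rep V(2)] log_stalk_add[OF x A(1) B(1)] V(1,2)])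
       (simp add: \<alpha>_def \<beta>_def log_rep_agree[OF rep])
  also have "\<dots> = (\<Sum>k<N. l (\<alpha> k)) + (\<Sum>H\<in>\<A>. l (\<beta> H))"
    using dual_add[OF l A(1) B(1)] A(2) B(2) by simp
  finally show ?thesis using \<alpha>(2) \<beta>(2) by simp
qed

section \<open>Functionals applied to differentials\<close>

lemma dual_differential_mult:
  assumes V: "pop V" "x \<in> V" and f: "f \<in> reg V" "g \<in> reg V" and l: "l \<in> log_fibre_dual n \<A> x"
  shows "l (differential (\<lambda>y. f y * g y)) = g x * l (differential f) + f x * l (differential g)"
proof -
  have x: "x \<in> proj_points n" using pop_sub V by blast
  have d: "differential f \<in> log_stalk n \<A> x" "differential g \<in> log_stalk n \<A> x" "differential (\<lambda>y. f y * g y) \<in> log_stalk n \<A> x"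
    by (intro differential_log_stalk[OF V] reg_mult f)+
  have "l (differential (\<lambda>y. f y * g y)) =
      l (\<lambda>v w. g (pclass v) * differential f v w + f (pclass v) * differential g v w)"
    by (rule dual_agree[OF l d(3) log_stalk_add[OF x log_stalk_scale[OF x d(1) V f(2)] log_stalk_scale[OF x d(2) V f(1)]] V])
       (simp add: differential_mult[OF V(1) _ _ f])
  also have "\<dots> = g x * l (differential f) + f x * l (differential g)"
    using dual_add[OF l log_stalk_scale[OF x d(1) V f(2)] log_stalk_scale[OF x d(2) V f(1)]]
      dual_mult[OF l d(1) V f(2)] dual_mult[OF l d(2) V f(1)] by simp
  finally show ?thesis .
qed

lemma dual_differential_add:
  assumes V: "pop V" "x \<in> V" and f: "f \<in> reg V" "g \<in> reg V" and l: "l \<in> log_fibre_dual n \<A> x"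
  shows "l (differential (\<lambda>y. f y + g y)) = l (differential f) + l (differential g)"
proof -
  have x: "x \<in> proj_points n" using pop_sub V by blast
  have d: "differential f \<in> log_stalk n \<A> x" "differential g \<in> log_stalk n \<A> x" "differential (\<lambda>y. f y + g y) \<in> log_stalk n \<A> x"
    by (intro differential_log_stalk[OF V] reg_add f)+
  have "l (differential (\<lambda>y. f y + g y)) = l (\<lambda>v w. differential f v w + differential g v w)"
    by (rule dual_agree[OF l d(3) log_stalk_add[OF x d(1,2)] V]) (simp add: differential_add[OF V(1) _ _ f])
  then show ?thesis using dual_add[OF l d(1,2)] by simp
qed

lemma dual_differential_const:
  assumes "l \<in> log_fibre_dual n \<A> x" "x \<in> proj_points n"
  shows "l (differential (\<lambda>_. c)) = 0"
proof -
  have "differential (\<lambda>_. c) = (\<lambda>_ _. 0)" by (intro ext) (simp add: differential_const)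
  then show ?thesis using dual_zero[OF assms] by simp
qed

lemma dual_differential_cong:
  assumes V: "pop V" "x \<in> V" and f: "f \<in> reg V" and l: "l \<in> log_fibre_dual n \<A> x" and eq: "\<And>y. y \<in> V \<Longrightarrow> f y = g y"
  shows "l (differential f) = l (differential g)"
proof -
  have g: "g \<in> reg V" using reg_cong[OF f eq] .
  show ?thesis
    by (rule dual_agree[OF l differential_log_stalk[OF V f] differential_log_stalk[OF V g] V])
       (rule differential_cong[OF V(1) _ _ eq])
qed

text \<open>\<theta> is meant as a function on the dual bundle over \<open>V\<close>, typically
  evaluation at a form. It is to be a combination of the coordinates \<open>l (om H)\<close> with
  coefficients regular on the base; these are not unique, as \<open>om H0\<close> is zero.\<close>

definition lin_om :: "vec set set \<Rightarrow> (vec set \<Rightarrow> (form \<Rightarrow> complex) \<Rightarrow> complex) \<Rightarrow> bool" where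
  "lin_om V \<theta> \<longleftrightarrow> (\<exists>c. (\<forall>H\<in>\<A>. c H \<in> reg V) \<and>
     (\<forall>x\<in>V. \<forall>l\<in>log_fibre_dual n \<A> x. \<theta> x l = (\<Sum>H\<in>\<A>. c H x * l (om H))))"

lemma lin_omI:
  assumes "\<And>H. H \<in> \<A> \<Longrightarrow> c H \<in> reg V"
    "\<And>x l. x \<in> V \<Longrightarrow> l \<in> log_fibre_dual n \<A> x \<Longrightarrow> \<theta> x l = (\<Sum>H\<in>\<A>. c H x * l (om H))"
  shows "lin_om V \<theta>"
  unfolding lin_om_def by (rule exI[of _ c]) (use assms in auto)

lemma lin_omE:
  assumes "lin_om V \<theta>"
  obtains c where "\<And>H. H \<in> \<A> \<Longrightarrow> c H \<in> reg V"
    "\<And>x l. x \<in> V \<Longrightarrow> l \<in> log_fibre_dual n \<A> x \<Longrightarrow> \<theta> x l = (\<Sum>H\<in>\<A>. c H x * l (om H))"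
  using assms unfolding lin_om_def by auto

lemma lin_om_cong:
  assumes "lin_om V \<theta>" "\<And>x l. x \<in> V \<Longrightarrow> l \<in> log_fibre_dual n \<A> x \<Longrightarrow> \<theta>' x l = \<theta> x l"
  shows "lin_om V \<theta>'"
proof -
  obtain c where c: "\<And>H. H \<in> \<A> \<Longrightarrow> c H \<in> reg V"
    "\<And>x l. x \<in> V \<Longrightarrow> l \<in> log_fibre_dual n \<A> x \<Longrightarrow> \<theta> x l = (\<Sum>H\<in>\<A>. c H x * l (om H))"
    by (rule lin_omE[OF assms(1)]) (rule that)
  show ?thesis by (rule lin_omI[of c]) (auto simp: c assms(2))
qed

lemma lin_om_mono: "lin_om V \<theta> \<Longrightarrow> V' \<subseteq> V \<Longrightarrow> lin_om V' \<theta>"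
  by (erule lin_omE) (rule lin_omI, auto intro: reg_mono)

lemma lin_om_add:
  assumes "lin_om V \<theta>" "lin_om V \<theta>'"
  shows "lin_om V (\<lambda>x l. \<theta> x l + \<theta>' x l)"
proof -
  obtain c where c: "\<And>H. H \<in> \<A> \<Longrightarrow> c H \<in> reg V"
    "\<And>x l. x \<in> V \<Longrightarrow> l \<in> log_fibre_dual n \<A> x \<Longrightarrow> \<theta> x l = (\<Sum>H\<in>\<A>. c H x * l (om H))"
    by (rule lin_omE[OF assms(1)]) (rule that)
  obtain c' where c': "\<And>H. H \<in> \<A> \<Longrightarrow> c' H \<in> reg V"
    "\<And>x l. x \<in> V \<Longrightarrow> l \<in> log_fibre_dual n \<A> x \<Longrightarrow> \<theta>' x l = (\<Sum>H\<in>\<A>. c' H x * l (om H))"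
    by (rule lin_omE[OF assms(2)]) (rule that)
  show ?thesis by (rule lin_omI[of "\<lambda>H x. c H x + c' H x"]) (auto simp: c c' algebra_simps sum.distrib intro: reg_add)
qed

lemma lin_om_scale:
  assumes "lin_om V \<theta>" "f \<in> reg V"
  shows "lin_om V (\<lambda>x l. f x * \<theta> x l)"
proof -
  obtain c where c: "\<And>H. H \<in> \<A> \<Longrightarrow> c H \<in> reg V"
    "\<And>x l. x \<in> V \<Longrightarrow> l \<in> log_fibre_dual n \<A> x \<Longrightarrow> \<theta> x l = (\<Sum>H\<in>\<A>. c H x * l (om H))"
    by (rule lin_omE[OF assms(1)]) (rule that)
  show ?thesis
    by (rule lin_omI[of "\<lambda>H x. f x * c H x"]) (auto simp: c algebra_simps sum_distrib_left intro: reg_mult assms)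
qed

lemma lin_om_om:
  assumes "V \<subseteq> proj_points n" "H \<in> \<A>"
  shows "lin_om V (\<lambda>x l. l (om H))"
proof (rule lin_omI[of "\<lambda>H' _. if H' = H then 1 else 0"])
  show "(\<lambda>_. if H' = H then 1 else 0) \<in> reg V" for H' by (rule reg_const[OF assms(1)])
qed (use assms arr in \<open>simp add: if_distrib[of "\<lambda>c. c * _"] cong: if_cong\<close>)

lemma lin_om_zero: "V \<subseteq> proj_points n \<Longrightarrow> lin_om V (\<lambda>_ _. 0)"
  using lin_om_scale[OF lin_om_om[OF _ arr(3)] reg_const[of V 0]] by simp

lemma lin_om_sum:
  assumes "V \<subseteq> proj_points n" "\<And>i. i \<in> K \<Longrightarrow> lin_om V (\<theta> i)"
  shows "lin_om V (\<lambda>x l. \<Sum>i\<in>K. \<theta> i x l)"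
  using assms(2) by (induction K rule: infinite_finite_induct) (auto intro: lin_om_zero[OF assms(1)] lin_om_add)

section \<open>Bases of linear forms taken from the arrangement\<close>

lemma interpolation_basis:
  assumes "S \<subseteq> \<A>" "card S = n + 1"
  shows "\<exists>u. \<forall>H\<in>S. u H \<in> vecs n \<and> (\<forall>H'\<in>S. eqn n H' (u H) = (if H' = H then 1 else 0))"
proof -
  have "\<exists>u. u \<in> vecs n \<and> (\<forall>H'\<in>S. eqn n H' u = (if H' = H then 1 else 0))" if H: "H \<in> S" for H
  proof -
    have fS: "finite S" using assms(1) arr(2) finite_subset by blast
    \<comment> \<open>The \<open>n\<close> equations of the other hyperplanes in
      \<open>n + 1\<close> unknowns have a nonzero solution. By general position the form of
      \<open>H\<close> does not vanish on it, so it can be scaled to the value 1.\<close>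
    have "card (S - {H}) < card {..n}" using assms(2) fS H by simp
    from homogeneous_system_nontrivial_solution[OF _ _ this, of "\<lambda>H j. (SOME a. a \<in> H) j"] fS
    obtain x where x: "\<exists>j\<in>{..n}. x j \<noteq> 0" "\<forall>j. j \<notin> {..n} \<longrightarrow> x j = 0"
      "\<forall>H'\<in>S - {H}. (\<Sum>j\<in>{..n}. (SOME a. a \<in> H') j * x j) = 0" by auto
    have xv: "x \<in> vecs n" using x(2) by (simp add: vecs_def)
    have e: "eqn n H' x = 0" if "H' \<in> S" "H' \<noteq> H" for H' using x(3) that by (simp add: eqn_def lin_def)
    have nz: "eqn n H x \<noteq> 0"
    proof
      assume "eqn n H x = 0"
      then have "x = (\<lambda>_. 0)" using e by (intro general[OF assms xv]) blast
      then show False using x(1) by simp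
    qed
    show ?thesis using e nz vecs_scale[OF xv]
      by (intro exI[of _ "\<lambda>i. inverse (eqn n H x) * x i"]) (simp add: eqn_scale)
  qed
  then show ?thesis by metis
qed

lemma eqn_sum: "eqn n H (\<lambda>i. \<Sum>k\<in>K. c k * u k i) = (\<Sum>k\<in>K. c k * eqn n H (u k))"
  unfolding eqn_def lin_def sum_distrib_left by (subst sum.swap) (simp add: algebra_simps)

lemma vecs_sum: "(\<And>k. k \<in> K \<Longrightarrow> u k \<in> vecs n) \<Longrightarrow> (\<lambda>i. \<Sum>k\<in>K. c k * u k i) \<in> vecs n"
  by (auto simp: vecs_def)

lemma eqn_diff: "eqn n H (\<lambda>i. v i - w i) = eqn n H v - eqn n H w"
  using eqn_line[of n H v "-1" w] by simp

text \<open>At most n+1 hyperplanes can be completed to n+1 of them, whose dual basis solves the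
  equations.\<close>

lemma interpolation:
  assumes "S \<subseteq> \<A>" "card S \<le> n + 1"
  shows "\<exists>w\<in>vecs n. \<forall>H\<in>S. eqn n H w = y H"
proof -
  obtain T where T: "S \<subseteq> T" "T \<subseteq> \<A>" "card T = n + 1"
    using exists_subset_between[OF assms(2) card_arr assms(1) arr(2)] by blast
  obtain u where u: "\<And>H. H \<in> T \<Longrightarrow> u H \<in> vecs n"
    "\<And>H H'. H \<in> T \<Longrightarrow> H' \<in> T \<Longrightarrow> eqn n H' (u H) = (if H' = H then 1 else 0)"
    using interpolation_basis[OF T(2,3)] by metis
  have fT: "finite T" using T(2) arr(2) finite_subset by blast
  define w where "w = (\<lambda>i. \<Sum>H\<in>T. y H * u H i)"
  have "w \<in> vecs n" unfolding w_def using u(1) by (rule vecs_sum)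
  moreover have "eqn n H w = y H" if "H \<in> S" for H
    using that T(1) fT unfolding w_def eqn_sum by (simp add: u(2) subset_iff if_distrib[of "\<lambda>c. _ * c"] cong: if_cong)
  ultimately show ?thesis by blast
qed

end

text \<open>With a fixed basis of linear forms and its dual basis of vectors, a vector is an
  explicit linear expression in its values on \<open>S\<close>. This is what makes
  \<open>tangent\<close> polynomial in the point and in the values \<open>Y H\<close>.\<close>

locale arrangement_basis = arrangement +
  fixes S :: "vec set set" and u :: "vec set \<Rightarrow> vec"
  assumes S: "S \<subseteq> \<A>" "card S = n + 1"
    and u: "\<And>H. H \<in> S \<Longrightarrow> u H \<in> vecs n" "\<And>H H'. H \<in> S \<Longrightarrow> H' \<in> S \<Longrightarrow> eqn n H' (u H) = (if H' = H then 1 else 0)"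
begin

lemma finite_S: "finite S"
  using S(1) arr(2) finite_subset by blast

lemma expansion:
  assumes "v \<in> vecs n"
  shows "v = (\<lambda>i. \<Sum>H\<in>S. eqn n H v * u H i)"
proof -
  define v' where "v' = (\<lambda>i. \<Sum>H\<in>S. eqn n H v * u H i)"
  have "v' \<in> vecs n" unfolding v'_def using u(1) by (rule vecs_sum)
  then have "(\<lambda>i. v i - v' i) \<in> vecs n" using assms by (simp add: vecs_def)
  moreover have "eqn n H (\<lambda>i. v i - v' i) = 0" if "H \<in> S" for H
    using that finite_S unfolding eqn_diff v'_def eqn_sum
    by (simp add: u(2) if_distrib[of "\<lambda>c. _ * c"] cong: if_cong)
  ultimately have "(\<lambda>i. v i - v' i) = (\<lambda>_. 0)" by (intro general[OF S])
  then show ?thesis unfolding v'_def[symmetric] by (simp add: fun_eq_iff)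
qed

abbreviation cvec :: "nat \<Rightarrow> vec" where
  "cvec j \<equiv> \<lambda>i. if i = j then 1 else 0"

lemma lin_cvec: "j \<le> n \<Longrightarrow> lin n (cvec j) v = v j"
  by (simp add: lin_def if_distrib[of "\<lambda>c. c * _"] cong: if_cong)

abbreviation coord :: "nat \<Rightarrow> nat \<Rightarrow> vec set \<Rightarrow> complex" where
  "coord j i \<equiv> lin_ratio n (cvec i) (cvec j)"

abbreviation coord_eqn :: "nat \<Rightarrow> vec set \<Rightarrow> vec set \<Rightarrow> complex" where
  "coord_eqn j H \<equiv> lin_ratio n (SOME a. a \<in> H) (cvec j)"

text \<open>The vector \<open>w\<close> with \<open>eqn n H w = eqn n H v * Y H\<close>, normalised by \<open>Y H0 = 0\<close>.\<close>

definition tangent :: "vec \<Rightarrow> (vec set \<Rightarrow> complex) \<Rightarrow> vec" where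
  "tangent v Y = (\<lambda>i. \<Sum>H\<in>S. eqn n H v * Y H * u H i)"

lemma tangent_vecs: "tangent v Y \<in> vecs n"
  unfolding tangent_def using u(1) by (rule vecs_sum)

text \<open>Let t be the local equation of \<open>H\<close> on the patch. Applying \<open>l\<close>
  to the identity t dlog t = dt, where dt is a constant combination of coordinate differentials,
  relates the values y H of \<open>l\<close> on the \<open>dlog\<close> forms to the vector \<eta>
  of its values on coordinate differentials. Subtracting \<open>y H0\<close> times \<open>v\<close>
  from \<eta> gives a vector \<open>w\<close> with \<open>eqn n H w = eqn n H v * Y H\<close>, hence
  \<open>w = tangent v Y\<close>. Finally \<eta> j = 0 recovers \<open>y H0\<close>, so
  \<open>Y\<close> determines all these values.\<close>

lemma dual_coordinates:
  assumes j: "j \<le> n" and v: "pclass v \<in> affine_part (cvec j)" "v j = 1"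
    and l: "l \<in> log_fibre_dual n \<A> (pclass v)"
  defines "Y \<equiv> \<lambda>H. l (om H)"
  shows "H \<in> \<A> \<Longrightarrow> eqn n H (tangent v Y) = eqn n H v * Y H"
    and "i \<le> n \<Longrightarrow> l (differential (coord j i)) = tangent v Y i - tangent v Y j * v i"
    and "H \<in> \<A> \<Longrightarrow> l (dlog (local_equation n H (cvec j))) = Y H - tangent v Y j"
proof -
  let ?A = "affine_part (cvec j)"
  have V: "pop ?A" "pclass v \<in> ?A" "?A \<subseteq> ?A" using pop_affine_part v by auto
  have x: "pclass v \<in> proj_points n" using v(1) affine_part_sub by blast
  have vv: "v \<in> vecs n" using x by (simp add: pclass_in_proj_points)
  define y where "y H = l (dlog (local_equation n H (cvec j)))" for H
  define \<eta> where "\<eta> i = (if i \<le> n then l (differential (coord j i)) else 0)" for i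
  have \<eta>: "\<eta> \<in> vecs n" by (simp add: vecs_def \<eta>_def)
  have coord: "coord j i \<in> reg ?A" for i by (rule lin_ratio_reg) simp
  have Y: "Y H = y H - y H0" if H: "H \<in> \<A>" for H
  proof -
    have "l (om H) = (\<Sum>H'\<in>\<A>. ((if H' = H then 1 else 0) - (if H' = H0 then 1 else 0)) * l (dlog (local_equation n H' (cvec j))))"
      using dual_log_rep[OF V om_log_rep[OF V(3) H V(1)] l] by simp
    then show ?thesis unfolding y_def Y_def left_diff_distrib sum_subtractf
      using arr(2,3) H by (simp add: if_distrib[of "\<lambda>c. c * _"] cong: if_cong)
  qed
  have rel: "eqn n H v * y H = eqn n H \<eta>" if H: "H \<in> \<A>" for H
  proof -
    have dl: "dlog (local_equation n H (cvec j)) \<in> log_stalk n \<A> (pclass v)" using dlog_log_stalk[OF V(2) H] .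
    have ceq: "coord_eqn j H \<in> reg ?A" by (rule lin_ratio_reg) simp
    have dc: "differential (coord j i) \<in> log_stalk n \<A> (pclass v)" for i
      using differential_log_stalk[OF V(1,2) coord] .
    have ic: "(\<lambda>_. (SOME a. a \<in> H) i) \<in> reg ?A" for i by (rule reg_const[OF affine_part_sub])
    define a where "a = (SOME a. a \<in> H)"
    define \<gamma> where "\<gamma> i = (\<lambda>v w. (\<lambda>_. a i) (pclass v) * differential (coord j i) v w)" for i
    have \<gamma>: "\<gamma> i \<in> log_stalk n \<A> (pclass v)" "l (\<gamma> i) = a i * l (differential (coord j i))" for i
      unfolding \<gamma>_def a_def
      using log_stalk_scale[OF x dc V(1,2) ic] dual_mult[OF l dc V(1,2) ic] by auto
    have G: "(\<lambda>v w. \<Sum>i\<le>n. \<gamma> i v w) \<in> log_stalk n \<A> (pclass v)" "l (\<lambda>v w. \<Sum>i\<le>n. \<gamma> i v w) = (\<Sum>i\<le>n. l (\<gamma> i))"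
      using dual_sum[OF l x, of "{..n}" \<gamma>] \<gamma>(1) by simp_all
    have "eqn n H v * y H = coord_eqn j H (pclass v) * l (dlog (local_equation n H (cvec j)))"
      using v(2) j by (simp add: y_def lin_ratio_pclass lin_cvec eqn_def)
    also have "\<dots> = l (\<lambda>v w. coord_eqn j H (pclass v) * dlog (local_equation n H (cvec j)) v w)"
      using dual_mult[OF l dl V(1,2) ceq] by simp
    also have "\<dots> = l (\<lambda>v w. \<Sum>i\<le>n. \<gamma> i v w)"
    proof (rule dual_agree[OF l log_stalk_scale[OF x dl V(1,2) ceq] G(1) V(1,2)])
      fix v w assume v: "pclass v \<in> ?A" "pclass v \<notin> arr_union n \<A>" and w: "w \<in> vecs n"
      have vj: "v j \<noteq> 0" using v(1) j by (simp add: mem_affine_part lin_cvec)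
      have e: "eqn n H v \<noteq> 0" using eqn_nonzero[OF H DiffI[OF v] V(1)] .
      have "coord_eqn j H (pclass v) * dlog (local_equation n H (cvec j)) v w = (eqn n H w * v j - eqn n H v * w j) / (v j * v j)"
        using vj e j by (simp add: dlog_local_equation lin_ratio_pclass lin_cvec eqn_def[symmetric] field_simps)
      also have "\<dots> = (\<Sum>i\<le>n. a i * ((w i * v j - v i * w j) / (v j * v j)))"
        unfolding eqn_def lin_def a_def sum_distrib_right sum_subtractf[symmetric] sum_divide_distrib
        by (intro sum.cong) (simp_all add: algebra_simps)
      also have "\<dots> = (\<Sum>i\<le>n. \<gamma> i v w)"
        unfolding \<gamma>_def using vj j by (intro sum.cong) (auto simp: differential_lin_ratio lin_cvec)
      finally show "coord_eqn j H (pclass v) * dlog (local_equation n H (cvec j)) v w = (\<Sum>i\<le>n. \<gamma> i v w)" .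
    qed
    also have "\<dots> = eqn n H \<eta>" unfolding G(2) \<gamma>(2) by (simp add: eqn_def lin_def \<eta>_def a_def)
    finally show ?thesis .
  qed
  \<comment> \<open>On the patch \<open>coord j j\<close> is the constant 1.\<close>
  have \<eta>j: "\<eta> j = 0"
  proof -
    have "l (differential (coord j j)) = l (differential (\<lambda>_. 1))"
    proof (rule dual_differential_cong[OF V(1,2) coord l])
      fix z assume z: "z \<in> ?A"
      then obtain w where "z = pclass w" using affine_part_sub by (auto simp: proj_points_def)
      with z show "coord j j z = 1" using j by (simp add: lin_ratio_pclass mem_affine_part)
    qed
    then show ?thesis using dual_differential_const[OF l x] by (simp add: \<eta>_def)
  qed
  \<comment> \<open>Tangent vectors are given modulo \<open>v\<close>; this is the representative on
    which the form of \<open>H0\<close> vanishes.\<close>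
  define w where "w = (\<lambda>i. \<eta> i - y H0 * v i)"
  have w: "w \<in> vecs n" using \<eta> vv by (simp add: w_def vecs_def)
  have we: "eqn n H w = eqn n H v * Y H" if "H \<in> \<A>" for H
    unfolding w_def eqn_diff eqn_scale rel[OF that, symmetric] Y[OF that] by (simp add: algebra_simps)
  have wt: "w = tangent v Y"
    by (subst expansion[OF w]) (use S(1) in \<open>auto simp: tangent_def we subset_iff intro!: sum.cong ext\<close>)
  have y0: "y H0 = - tangent v Y j" using \<eta>j v(2) by (simp add: wt[symmetric] w_def)
  show "eqn n H (tangent v Y) = eqn n H v * Y H" if "H \<in> \<A>" using we[OF that] wt by simp
  show "l (differential (coord j i)) = tangent v Y i - tangent v Y j * v i" if "i \<le> n"
  proof -
    have "\<eta> i = tangent v Y i + y H0 * v i" using fun_cong[OF wt, of i] by (simp add: w_def algebra_simps)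
    then show ?thesis using that by (simp add: y0 \<eta>_def)
  qed
  show "l (dlog (local_equation n H (cvec j))) = Y H - tangent v Y j" if "H \<in> \<A>"
    using Y[OF that] y0 by (simp add: y_def)
qed

section \<open>Local generation by the global forms\<close>

lemma affine_part_representative:
  assumes "x \<in> affine_part b" obtains v where "x = pclass v"
proof -
  have "x \<in> proj_points n" using assms affine_part_sub by blast
  then show ?thesis using that unfolding proj_points_def by (elim imageE)
qed

lemma normalised_representative:
  assumes "x \<in> affine_part (cvec j)" "j \<le> n"
  obtains v where "x = pclass v" "v \<in> vecs n" "v j = 1"
proof -
  obtain w where w: "x = pclass w" by (rule affine_part_representative[OF assms(1)])
  with assms have "w j \<noteq> 0" "w \<in> vecs n" by (simp_all add: mem_affine_part lin_cvec)
  then show ?thesis using that[of "\<lambda>i. inverse (w j) * w i"] w pclass_scale[of "inverse (w j)" w] vecs_scale[of w n "inverse (w j)"] by simp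
qed

lemma coord_reg: "coord j i \<in> reg (affine_part (cvec j))"
  by (rule lin_ratio_reg) simp

lemma coord_eqn_reg: "coord_eqn j H \<in> reg (affine_part (cvec j))"
  by (rule lin_ratio_reg) simp

lemma coord_pclass: "j \<le> n \<Longrightarrow> i \<le> n \<Longrightarrow> coord j i (pclass v) = v i / v j"
  by (simp add: lin_ratio_pclass lin_cvec)

lemma coord_eqn_pclass: "j \<le> n \<Longrightarrow> coord_eqn j H (pclass v) = eqn n H v / v j"
  by (simp add: lin_ratio_pclass lin_cvec eqn_def)

lemma lin_om_tangent:
  assumes "j \<le> n"
  shows "lin_om (affine_part (cvec j)) (\<lambda>x l. \<Sum>H\<in>S. coord_eqn j H x * u H i * l (om H))"
proof (rule lin_om_sum[OF affine_part_sub])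
  fix H assume "H \<in> S"
  then have "H \<in> \<A>" using S(1) by blast
  have "(\<lambda>x. coord_eqn j H x * u H i) \<in> reg (affine_part (cvec j))"
    using reg_mult[OF coord_eqn_reg reg_const[OF affine_part_sub]] .
  from lin_om_scale[OF lin_om_om[OF affine_part_sub \<open>H \<in> \<A>\<close>] this]
  show "lin_om (affine_part (cvec j)) (\<lambda>x l. coord_eqn j H x * u H i * l (om H))" .
qed

lemma tangent_coord:
  assumes "j \<le> n" "v j = 1"
  shows "(\<Sum>H\<in>S. coord_eqn j H (pclass v) * u H i * l (om H)) = tangent v (\<lambda>H. l (om H)) i"
  unfolding tangent_def using assms by (intro sum.cong) (auto simp: coord_eqn_pclass)

text \<open>The formula for coordinate differentials in \<open>dual_coordinates\<close>, with the
  point now varying: it enters through \<open>coord j i\<close> and \<open>coord_eqn j H\<close>,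
  which are regular on the patch.\<close>

lemma lin_om_coord:
  assumes j: "j \<le> n" and i: "i \<le> n"
  shows "lin_om (affine_part (cvec j)) (\<lambda>x l. l (differential (coord j i)))"
proof -
  let ?T = "\<lambda>i x l. \<Sum>H\<in>S. coord_eqn j H x * u H i * l (om H)"
  have c: "(\<lambda>x. - coord j i x) \<in> reg (affine_part (cvec j))" by (rule reg_minus[OF affine_part_sub coord_reg])
  have "lin_om (affine_part (cvec j)) (\<lambda>x l. ?T i x l + - coord j i x * ?T j x l)"
    by (rule lin_om_add[OF lin_om_tangent[OF j] lin_om_scale[OF lin_om_tangent[OF j] c]])
  then show ?thesis
  proof (rule lin_om_cong)
    fix x l assume x: "x \<in> affine_part (cvec j)" and l: "l \<in> log_fibre_dual n \<A> x"
    obtain v where v: "x = pclass v" "v \<in> vecs n" "v j = 1" by (rule normalised_representative[OF x j])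
    show "l (differential (coord j i)) = ?T i x l + - coord j i x * ?T j x l"
      using dual_coordinates(2)[of j v, OF j x[unfolded v(1)] v(3) l[unfolded v(1)] i]
      unfolding v(1) tangent_coord[of j v, OF j v(3)] using v(3) by (simp add: coord_pclass i j)
  qed
qed

lemma lin_om_dlog:
  assumes j: "j \<le> n" and H: "H \<in> \<A>"
  shows "lin_om (affine_part (cvec j)) (\<lambda>x l. l (dlog (local_equation n H (cvec j))))"
proof -
  let ?T = "\<lambda>i x l. \<Sum>H\<in>S. coord_eqn j H x * u H i * l (om H)"
  have c: "(\<lambda>x. - 1) \<in> reg (affine_part (cvec j))" by (rule reg_const[OF affine_part_sub])
  have "lin_om (affine_part (cvec j)) (\<lambda>x l. l (om H) + - 1 * ?T j x l)"
    by (rule lin_om_add[OF lin_om_om[OF affine_part_sub H] lin_om_scale[OF lin_om_tangent[OF j] c]])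
  then show ?thesis
  proof (rule lin_om_cong)
    fix x l assume x: "x \<in> affine_part (cvec j)" and l: "l \<in> log_fibre_dual n \<A> x"
    obtain v where v: "x = pclass v" "v \<in> vecs n" "v j = 1" by (rule normalised_representative[OF x j])
    show "l (dlog (local_equation n H (cvec j))) = l (om H) + - 1 * ?T j x l"
      using dual_coordinates(3)[of j v, OF j x[unfolded v(1)] v(3) l[unfolded v(1)] H]
      unfolding v(1) tangent_coord[of j v, OF j v(3)] by simp
  qed
qed

definition dehom :: "nat \<Rightarrow> nat \<Rightarrow> (vec \<Rightarrow> complex) \<Rightarrow> vec set \<Rightarrow> complex" where
  "dehom j m F x = F (SOME v. v \<in> x) / (SOME v. v \<in> x) j ^ m"

lemma dehom_pclass:
  assumes "hom_poly n m F"
  shows "dehom j m F (pclass v) = F v / v j ^ m"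
proof -
  obtain c where c: "c \<noteq> 0" "(SOME u. u \<in> pclass v) = (\<lambda>i. c * v i)" by (rule representative_pclass)
  have "dehom j m F (pclass v) = c ^ m * F v / (c ^ m * v j ^ m)"
    unfolding dehom_def c(2) hom_poly_scale[OF assms] by (simp add: power_mult_distrib)
  then show ?thesis using c(1) by simp
qed

lemma dehom_reg:
  assumes "hom_poly n m F" "j \<le> n"
  shows "dehom j m F \<in> reg (affine_part (cvec j))"
  by (rule regular_proj_space_fraction[OF assms(1) hom_poly_power[OF hom_poly_coord[OF assms(2)], of m, simplified]])
     (use affine_part_sub assms in \<open>auto simp: mem_affine_part lin_cvec dehom_pclass\<close>)

text \<open>Only coordinate functions need the computation with functionals. Sums and products
  follow by additivity and the Leibniz rule along the construction of \<open>F\<close>.\<close>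

lemma lin_om_dehom:
  assumes "hom_poly n m F" "j \<le> n"
  shows "lin_om (affine_part (cvec j)) (\<lambda>x l. l (differential (dehom j m F)))"
  using assms(1) unfolding hom_poly_def
proof (induction rule: homogeneous.induct)
  case (degree_zero c)
  then obtain k where k: "c = (\<lambda>_. k)" by blast
  have "dehom j 0 c = (\<lambda>_. k)" by (intro ext) (simp add: dehom_def k)
  moreover have "l (differential (\<lambda>_. k)) = 0" if "x \<in> affine_part (cvec j)" "l \<in> log_fibre_dual n \<A> x" for x l
    by (rule dual_differential_const[OF that(2) subsetD[OF affine_part_sub that(1)]])
  ultimately show ?case by (intro lin_om_cong[OF lin_om_zero[OF affine_part_sub]]) simp
next
  case (degree_one g)
  then obtain i where i: "i \<le> n" "g = (\<lambda>v. v i)" by blast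
  have h: "hom_poly n 1 g" unfolding i(2) by (rule hom_poly_coord[OF i(1)])
  show ?case
  proof (rule lin_om_cong[OF lin_om_coord[OF assms(2) i(1)]])
    fix x l assume x: "x \<in> affine_part (cvec j)" and l: "l \<in> log_fibre_dual n \<A> x"
    show "l (differential (dehom j 1 g)) = l (differential (coord j i))"
    proof (rule dual_differential_cong[OF pop_affine_part x dehom_reg[OF h assms(2)] l])
      fix y assume "y \<in> affine_part (cvec j)"
      then obtain v where "y = pclass v" by (rule affine_part_representative)
      then show "dehom j 1 g y = coord j i y" using dehom_pclass[OF h, of j v] i assms(2) by (simp add: coord_pclass)
    qed
  qed
next
  case (add m F F')
  have "hom_poly n m F" "hom_poly n m F'" using add.hyps by (simp_all add: hom_poly_def)
  note r = this[THEN dehom_reg, OF assms(2)]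
  have "dehom j m (\<lambda>v. F v + F' v) = (\<lambda>x. dehom j m F x + dehom j m F' x)"
    by (intro ext) (simp add: dehom_def add_divide_distrib)
  then show ?case
    using lin_om_cong[OF lin_om_add[OF add.IH]] dual_differential_add[OF pop_affine_part _ r] by simp
next
  case (mult m F k F')
  have "hom_poly n m F" "hom_poly n k F'" using mult.hyps by (simp_all add: hom_poly_def)
  note r = this[THEN dehom_reg, OF assms(2)]
  have "dehom j (m + k) (\<lambda>v. F v * F' v) = (\<lambda>x. dehom j m F x * dehom j k F' x)"
    by (intro ext) (simp add: dehom_def power_add)
  then show ?case
    using lin_om_cong[OF lin_om_add[OF lin_om_scale[OF mult.IH(1) r(2)] lin_om_scale[OF mult.IH(2) r(1)]]]
      dual_differential_mult[OF pop_affine_part _ r] by simp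
qed

text \<open>Locally \<open>g\<close> is F / G. The Leibniz rule for g G = F expresses the value on
  dg by those on dF and dG, after shrinking to the locus where \<open>G\<close> is nonzero.\<close>

lemma lin_om_differential:
  assumes j: "j \<le> n" and V: "pop V" "x0 \<in> V" "V \<subseteq> affine_part (cvec j)" and g: "g \<in> reg V"
  shows "\<exists>V'. pop V' \<and> x0 \<in> V' \<and> V' \<subseteq> V \<and> lin_om V' (\<lambda>x l. l (differential g))"
proof -
  obtain v0 where v0: "x0 = pclass v0" using affine_part_representative[OF subsetD[OF V(3,2)]] .
  have v0V: "pclass v0 \<in> V" using V(2) v0 by simp
  obtain m F G where F: "hom_poly n m F" "hom_poly n m G" "G v0 \<noteq> 0"
    "\<And>u. pclass u \<in> V \<Longrightarrow> pclass u \<in> proj_points n \<Longrightarrow> G u \<noteq> 0 \<Longrightarrow> g (pclass u) = F u / G u"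
    by (rule regular_proj_spaceE[OF g v0V]) (rule that)
  define V' where "V' = V \<inter> nonvanishing (proj_points n) G"
  have V': "pop V'" "V' \<subseteq> V" "V' \<subseteq> affine_part (cvec j)" "x0 \<in> V'"
    unfolding V'_def using V zopen_nonvanishing_proj_points[OF F(2)] v0 F(3) v0V
      pop_sub[OF V(1)] nonvanishing_proj_points[OF F(2), of v0] pclass_in_proj_points by auto
  have rep: "\<exists>v. x = pclass v \<and> pclass v \<in> proj_points n \<and> v j \<noteq> 0 \<and> G v \<noteq> 0 \<and> pclass v \<in> V" if "x \<in> V'" for x
  proof -
    have "x \<in> V" using that V'(2) by blast
    then have "x \<in> affine_part (cvec j)" using V(3) by blast
    then obtain v where v: "x = pclass v" "pclass v \<in> affine_part (cvec j)" by (metis affine_part_representative)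
    then show ?thesis using that \<open>x \<in> V\<close> affine_part_sub nonvanishing_proj_points[OF F(2), of v] j
      by (intro exI[of _ v]) (auto simp: V'_def mem_affine_part lin_cvec pclass_in_proj_points)
  qed
  have GR: "dehom j m G \<in> reg V'" and FR: "dehom j m F \<in> reg V'" and gR: "g \<in> reg V'"
    using reg_mono[OF dehom_reg[OF F(2) j] V'(3)] reg_mono[OF dehom_reg[OF F(1) j] V'(3)] reg_mono[OF g V'(2)] by auto
  have G0: "dehom j m G x \<noteq> 0" if "x \<in> V'" for x
    using rep[OF that] by (auto simp: dehom_pclass[OF F(2)])
  have gG: "g x * dehom j m G x = dehom j m F x" if "x \<in> V'" for x
    using rep[OF that] F(4) by (auto simp: dehom_pclass[OF F(2)] dehom_pclass[OF F(1)])
  have sub: "V' \<subseteq> proj_points n" by (rule pop_sub[OF V'(1)])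
  have "lin_om V' (\<lambda>x l. inverse (dehom j m G x) * (l (differential (dehom j m F)) + - g x * l (differential (dehom j m G))))"
    by (intro lin_om_scale lin_om_add lin_om_mono[OF lin_om_dehom[OF F(1) j] V'(3)] lin_om_mono[OF lin_om_dehom[OF F(2) j] V'(3)]
      reg_inverse GR G0 reg_minus[OF sub gR])
  then have "lin_om V' (\<lambda>x l. l (differential g))"
  proof (rule lin_om_cong)
    fix x l assume x: "x \<in> V'" and l: "l \<in> log_fibre_dual n \<A> x"
    have "l (differential (dehom j m F)) = l (differential (\<lambda>y. g y * dehom j m G y))"
      by (rule dual_differential_cong[OF V'(1) x FR l]) (simp add: gG)
    also have "\<dots> = dehom j m G x * l (differential g) + g x * l (differential (dehom j m G))"
      by (rule dual_differential_mult[OF V'(1) x gR GR l])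
    finally show "l (differential g) =
        inverse (dehom j m G x) * (l (differential (dehom j m F)) + - g x * l (differential (dehom j m G)))"
      using G0[OF x] by (simp add: field_simps)
  qed
  then show ?thesis using V' by blast
qed

text \<open>Local generation of the logarithmic cotangent sheaf by the forms \<open>om H\<close>, in
  the form visible to functionals. The finitely many \<open>g k\<close> of a representation are
  treated one at a time, each shrinking the neighbourhood.\<close>

lemma lin_om_log_form:
  assumes j: "j \<le> n" and \<omega>: "\<omega> \<in> log_stalk n \<A> x0" and x0: "x0 \<in> affine_part (cvec j)"
  shows "\<exists>V. pop V \<and> x0 \<in> V \<and> V \<subseteq> affine_part (cvec j) \<and> lin_om V (\<lambda>x l. l \<omega>)"
proof -
  obtain V N f g h where V: "pop V" "x0 \<in> V" "V \<subseteq> affine_part (cvec j)" and rep: "log_rep V (cvec j) N f g h \<omega>"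
    by (rule log_stalk_rep[OF \<omega> x0]) (rule that)
  have "\<exists>V'. pop V' \<and> x0 \<in> V' \<and> V' \<subseteq> V \<and> (\<forall>k<M. lin_om V' (\<lambda>x l. l (differential (g k))))" if "M \<le> N" for M
    using that
  proof (induction M)
    case 0
    show ?case using V by (intro exI[of _ V]) auto
  next
    case (Suc M)
    then obtain V' where V': "pop V'" "x0 \<in> V'" "V' \<subseteq> V" "\<forall>k<M. lin_om V' (\<lambda>x l. l (differential (g k)))" by auto
    have "g M \<in> reg V'" using reg_mono[OF log_rep_reg(2)[OF rep] V'(3)] Suc.prems by simp
    from lin_om_differential[OF j V'(1,2) _ this] V'(3) V(3)
    obtain V'' where V'': "pop V''" "x0 \<in> V''" "V'' \<subseteq> V'" "lin_om V'' (\<lambda>x l. l (differential (g M)))" by blast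
    have "lin_om V'' (\<lambda>x l. l (differential (g k)))" if "k < Suc M" for k
    proof (cases "k = M")
      case True
      then show ?thesis using V''(4) by simp
    next
      case False
      then have "k < M" using that by simp
      then have "lin_om V' (\<lambda>x l. l (differential (g k)))" using V'(4) by simp
      then show ?thesis by (rule lin_om_mono[OF _ V''(3)])
    qed
    then show ?case using V'' V'(3) by (intro exI[of _ V'']) auto
  qed
  then obtain V' where V': "pop V'" "x0 \<in> V'" "V' \<subseteq> V" "\<And>k. k < N \<Longrightarrow> lin_om V' (\<lambda>x l. l (differential (g k)))"
    by blast
  have V'j: "V' \<subseteq> affine_part (cvec j)" using V'(3) V(3) by blast
  have "lin_om V' (\<lambda>x l. (\<Sum>k<N. f k x * l (differential (g k))) + (\<Sum>H\<in>\<A>. h H x * l (dlog (local_equation n H (cvec j)))))"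
  proof (intro lin_om_add lin_om_sum pop_sub V' lin_om_scale)
    show "f k \<in> reg V'" if "k \<in> {..<N}" for k using reg_mono[OF log_rep_reg(1)[OF rep] V'(3)] that by simp
    show "h H \<in> reg V'" if "H \<in> \<A>" for H using reg_mono[OF log_rep_reg(3)[OF rep] V'(3)] that by simp
    show "lin_om V' (\<lambda>x l. l (dlog (local_equation n H (cvec j))))" if "H \<in> \<A>" for H
      by (rule lin_om_mono[OF lin_om_dlog[OF j that] V'j])
  qed simp
  then have "lin_om V' (\<lambda>x l. l \<omega>)"
    by (rule lin_om_cong) (rule dual_log_rep[OF V'(1) _ V'j log_rep_mono[OF rep V'(3)]])
  then show ?thesis using V' V'j by blast
qed

lemma dual_determined:
  assumes x: "x \<in> proj_points n" and l: "l \<in> log_fibre_dual n \<A> x" and 0: "\<And>H. H \<in> \<A> \<Longrightarrow> l (om H) = 0"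
  shows "l = (\<lambda>_. 0)"
proof
  fix \<omega>
  show "l \<omega> = 0"
  proof (cases "\<omega> \<in> log_stalk n \<A> x")
    case True
    obtain j where j: "j \<le> n" "x \<in> affine_part (cvec j)" by (rule in_affine_part[OF x])
    obtain V where V: "x \<in> V" "lin_om V (\<lambda>x l. l \<omega>)" using lin_om_log_form[OF j(1) True j(2)] by auto
    obtain c where c: "\<And>x l. x \<in> V \<Longrightarrow> l \<in> log_fibre_dual n \<A> x \<Longrightarrow> l \<omega> = (\<Sum>H\<in>\<A>. c H x * l (om H))"
      by (rule lin_omE[OF V(2)]) (rule that)
    show ?thesis using c[OF V(1) l] 0 by simp
  qed (rule dual_outside[OF l])
qed

lemma tangent_scale_point: "tangent (\<lambda>i. c * v i) Y = (\<lambda>i. c * tangent v Y i)"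
  by (simp add: tangent_def eqn_scale sum_distrib_left algebra_simps)

text \<open>Both sides are linear in \<open>v\<close>, so the representative with
  \<open>j\<close>-th coordinate 1 suffices, where \<open>dual_coordinates\<close> applies.\<close>

lemma dual_relation:
  assumes "pclass v \<in> proj_points n" "l \<in> log_fibre_dual n \<A> (pclass v)" "H \<in> \<A>"
  shows "eqn n H (tangent v (\<lambda>H. l (om H))) = eqn n H v * l (om H)"
proof -
  obtain j where j: "j \<le> n" "pclass v \<in> affine_part (cvec j)" by (rule in_affine_part[OF assms(1)])
  then have vj: "v j \<noteq> 0" by (simp add: mem_affine_part lin_cvec)
  define w where "w = (\<lambda>i. inverse (v j) * v i)"
  have pw: "pclass w = pclass v" unfolding w_def using vj by (intro pclass_scale) simp
  have "w j = 1" using vj by (simp add: w_def)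
  from dual_coordinates(1)[of j w l, OF j(1) _ this _ assms(3)] have
    "eqn n H (tangent w (\<lambda>H. l (om H))) = eqn n H w * l (om H)" using assms(2) j(2) pw by simp
  then show ?thesis using vj by (simp add: w_def tangent_scale_point eqn_scale)
qed

text \<open>A functional on the fibre over a point of the arrangement is obtained as a limit of tangent
  vectors along a line leaving the arrangement.\<close>

lemma dual_exists:
  assumes v: "pclass v \<in> proj_points n" and Y0: "Y H0 = 0"
    and rel: "\<And>H. H \<in> \<A> \<Longrightarrow> eqn n H (tangent v Y) = eqn n H v * Y H"
  shows "\<exists>l\<in>log_fibre_dual n \<A> (pclass v). \<forall>H\<in>\<A>. l (om H) = Y H"
proof -
  have vv: "v \<in> vecs n" "v \<noteq> (\<lambda>_. 0)" using v by (simp_all add: pclass_in_proj_points)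
  define w where "w = tangent v Y"
  have w: "w \<in> vecs n" unfolding w_def by (rule tangent_vecs)
  \<comment> \<open>These are the hyperplanes through the point. For them the quotient of
    \<open>eqn n H w\<close> by \<open>eqn n H v\<close> has the shape 0 / 0, and the value
    \<open>Y H\<close> has to be enforced by the choice of the line.\<close>
  define B where "B = {H \<in> \<A>. eqn n H v = 0}"
  have "card B \<le> n + 1"
  proof (rule ccontr)
    assume "\<not> card B \<le> n + 1"
    then have "n + 1 \<le> card B" by simp
    then obtain T where "T \<subseteq> B" "card T = n + 1" by (rule obtain_subset_with_card_n)
    then have "v = (\<lambda>_. 0)" by (intro general[of T] vv) (auto simp: B_def)
    then show False using vv by simp
  qed
  \<comment> \<open>Along the line, \<open>eqn n H (vt t) = t\<close> for \<open>H\<close> in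
    \<open>B\<close>, so it leaves these hyperplanes at once; the correction \<open>w'\<close> gives
    \<open>eqn n H (wt t) = t * Y H\<close>. Hence the quotient is constantly \<open>Y H\<close> for
    nonzero \<open>t\<close>.\<close>
  then obtain q w' where q: "q \<in> vecs n" "\<And>H. H \<in> B \<Longrightarrow> eqn n H q = 1" and w': "w' \<in> vecs n" "\<And>H. H \<in> B \<Longrightarrow> eqn n H w' = Y H"
    using interpolation[of B "\<lambda>_. 1"] interpolation[of B Y] by (auto simp: B_def)
  define vt where "vt t = (\<lambda>i. v i + t * q i)" for t
  define wt where "wt t = (\<lambda>i. w i + t * w' i)" for t
  have wtv: "wt t \<in> vecs n" for t unfolding wt_def by (rule vecs_line[OF w w'(1)])
  have inV: "\<forall>\<^sub>F t in at 0. pclass (vt t) \<in> V" if "pop V" "pclass v \<in> V" for V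
    unfolding vt_def using line_in_zopen[OF that q(1)] by (simp add: eventually_at_filter eventually_mono)
  have Bq: "eqn n H (vt t) = t" "eqn n H (wt t) = t * Y H" if "H \<in> B" for H t
    using that rel[of H] q(2) w'(2) by (simp_all add: vt_def wt_def eqn_line B_def w_def)
  have e: "(\<lambda>t. eqn n H (vt t)) \<midarrow>0\<rightarrow> eqn n H v" "(\<lambda>t. eqn n H (wt t)) \<midarrow>0\<rightarrow> eqn n H w" for H
    unfolding vt_def wt_def eqn_line by (auto intro!: tendsto_eq_intros)
  have lc: "(\<lambda>t. lin n b (vt t)) \<midarrow>0\<rightarrow> lin n b v" "(\<lambda>t. lin n b (wt t)) \<midarrow>0\<rightarrow> lin n b w" for b
    unfolding vt_def wt_def lin_line by (auto intro!: tendsto_eq_intros)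
  have ne: "\<forall>\<^sub>F t in at 0. eqn n H (vt t) \<noteq> 0" if "H \<in> \<A>" for H
  proof (cases "H \<in> B")
    case True
    then show ?thesis by (simp add: Bq eventually_neq_at_within)
  next
    case False
    then show ?thesis using that by (intro tendsto_imp_eventually_ne[OF e(1)]) (simp add: B_def)
  qed
  have out: "\<forall>\<^sub>F t in at 0. pclass (vt t) \<notin> arr_union n \<A>"
  proof -
    have "\<forall>\<^sub>F t in at 0. \<forall>H\<in>\<A>. eqn n H (vt t) \<noteq> 0" using ne arr(2) by (intro eventually_ball_finite) auto
    then show ?thesis using inV[OF pop_proj_points v]
      by eventually_elim (use arr(1) mem_hyperplane in \<open>auto simp: arr_union_def\<close>)
  qed
  have quot: "(\<lambda>t. eqn n H (wt t) / eqn n H (vt t)) \<midarrow>0\<rightarrow> Y H" if H: "H \<in> \<A>" for H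
  proof (cases "H \<in> B")
    case True
    have "\<forall>\<^sub>F t in at 0. Y H = eqn n H (wt t) / eqn n H (vt t)"
      using eventually_neq_at_within[of 0] by eventually_elim (simp add: Bq True)
    then show ?thesis by (rule Lim_transform_eventually[OF tendsto_const])
  next
    case False
    then have "eqn n H v \<noteq> 0" using H by (simp add: B_def)
    moreover from this have "Y H = eqn n H w / eqn n H v" using rel[OF H] by (simp add: w_def)
    ultimately show ?thesis using tendsto_divide[OF e(2) e(1)] by simp
  qed
  \<comment> \<open>In a local representation every ingredient converges: the coefficients and the
    differentials because they come from regular functions, the \<open>dlog\<close> terms by
    \<open>quot\<close>.\<close>
  have conv: "\<exists>L. (\<lambda>t. \<omega> (vt t) (wt t)) \<midarrow>0\<rightarrow> L" if \<omega>: "\<omega> \<in> log_stalk n \<A> (pclass v)" for \<omega>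
  proof -
    obtain j where j: "j \<le> n" "pclass v \<in> affine_part (cvec j)" by (rule in_affine_part[OF v])
    obtain V N f g h where V: "pop V" "pclass v \<in> V" "V \<subseteq> affine_part (cvec j)" and rep: "log_rep V (cvec j) N f g h \<omega>"
      by (rule log_stalk_rep[OF \<omega> j(2)]) (rule that)
    have "\<forall>k<N. \<exists>L. (\<lambda>t. differential (g k) (vt t) (wt t)) \<midarrow>0\<rightarrow> L"
      unfolding vt_def wt_def using differential_converges[OF V(1,2) log_rep_reg(2)[OF rep] q(1) w w'(1)] by blast
    then obtain D where D: "\<And>k. k < N \<Longrightarrow> (\<lambda>t. differential (g k) (vt t) (wt t)) \<midarrow>0\<rightarrow> D k" by metis
    have fh: "(\<lambda>t. p (pclass (vt t))) \<midarrow>0\<rightarrow> p (pclass v)" if "p \<in> reg V" for p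
      unfolding vt_def by (rule regular_line_tendsto[OF V(1,2) that q(1)])
    have b: "lin n (cvec j) v \<noteq> 0" by (rule log_rep_reg(4)[OF rep V(2)])
    have "(\<lambda>t. (\<Sum>k<N. f k (pclass (vt t)) * differential (g k) (vt t) (wt t)) +
       (\<Sum>H\<in>\<A>. h H (pclass (vt t)) * (eqn n H (wt t) / eqn n H (vt t) - lin n (cvec j) (wt t) / lin n (cvec j) (vt t)))) \<midarrow>0\<rightarrow>
       (\<Sum>k<N. f k (pclass v) * D k) + (\<Sum>H\<in>\<A>. h H (pclass v) * (Y H - lin n (cvec j) w / lin n (cvec j) v))"
      by (intro tendsto_add tendsto_sum tendsto_mult fh tendsto_diff quot tendsto_divide[OF lc(2) lc(1)] b)
         (auto intro: D log_rep_reg[OF rep])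
    moreover have "\<forall>\<^sub>F t in at 0. (\<Sum>k<N. f k (pclass (vt t)) * differential (g k) (vt t) (wt t)) +
       (\<Sum>H\<in>\<A>. h H (pclass (vt t)) * (eqn n H (wt t) / eqn n H (vt t) - lin n (cvec j) (wt t) / lin n (cvec j) (vt t))) =
       \<omega> (vt t) (wt t)"
      using inV[OF V(1,2)] out
    proof eventually_elim
      case (elim t)
      have "dlog (local_equation n H (cvec j)) (vt t) (wt t) =
         eqn n H (wt t) / eqn n H (vt t) - lin n (cvec j) (wt t) / lin n (cvec j) (vt t)" if "H \<in> \<A>" for H
        using eqn_nonzero[OF that DiffI[OF elim] V(1)] log_rep_reg(4)[OF rep elim(1)] by (rule dlog_local_equation[rotated])
      then show ?case using log_rep_agree[OF rep elim wtv] by simp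
    qed
    ultimately show ?thesis by (intro exI) (rule Lim_transform_eventually)
  qed
  \<comment> \<open>The value 0 outside the stalk is the convention built into
    \<open>log_fibre_dual\<close>.\<close>
  define l where "l \<omega> = (if \<omega> \<in> log_stalk n \<A> (pclass v) then Lim (at 0) (\<lambda>t. \<omega> (vt t) (wt t)) else 0)" for \<omega>
  have lim: "(\<lambda>t. \<omega> (vt t) (wt t)) \<midarrow>0\<rightarrow> l \<omega>" if \<omega>: "\<omega> \<in> log_stalk n \<A> (pclass v)" for \<omega>
    using conv[OF \<omega>] \<omega> tendsto_Lim[OF trivial_limit_at[of "0::complex"]] by (auto simp: l_def)
  have uniq: "l \<omega> = L" if "\<omega> \<in> log_stalk n \<A> (pclass v)" "(\<lambda>t. \<omega> (vt t) (wt t)) \<midarrow>0\<rightarrow> L" for \<omega> L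
    using LIM_unique[OF lim[OF that(1)] that(2)] .
  have "l \<in> log_fibre_dual n \<A> (pclass v)"
    unfolding log_fibre_dual_def
  proof (intro CollectI conjI ballI allI impI; (elim conjE)?)
    fix \<omega> \<omega>' assume \<omega>: "\<omega> \<in> log_stalk n \<A> (pclass v)" "\<omega>' \<in> log_stalk n \<A> (pclass v)"
    show "l (\<lambda>v w. \<omega> v w + \<omega>' v w) = l \<omega> + l \<omega>'"
      by (rule uniq[OF log_stalk_add[OF v \<omega>] tendsto_add[OF lim[OF \<omega>(1)] lim[OF \<omega>(2)]]])
  next
    fix \<omega> U f assume \<omega>: "\<omega> \<in> log_stalk n \<A> (pclass v)" and U: "pop U" "pclass v \<in> U" "f \<in> reg U"
    have "(\<lambda>t. f (pclass (vt t))) \<midarrow>0\<rightarrow> f (pclass v)"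
      unfolding vt_def by (rule regular_line_tendsto[OF U q(1)])
    from uniq[OF log_stalk_scale[OF v \<omega> U] tendsto_mult[OF this lim[OF \<omega>]]]
    show "l (\<lambda>v w. f (pclass v) * \<omega> v w) = f (pclass v) * l \<omega>" .
  next
    fix \<omega> \<omega>' U assume \<omega>: "\<omega> \<in> log_stalk n \<A> (pclass v)" "\<omega>' \<in> log_stalk n \<A> (pclass v)"
      and U: "pop U" "pclass v \<in> U" and agree: "forms_agree_on n (U - arr_union n \<A>) \<omega> \<omega>'"
    have "\<forall>\<^sub>F t in at 0. \<omega>' (vt t) (wt t) = \<omega> (vt t) (wt t)"
      using inV[OF U] out by eventually_elim (use agree wtv in \<open>simp add: forms_agree_on_def\<close>)
    from Lim_transform_eventually[OF lim[OF \<omega>(2)] this] show "l \<omega> = l \<omega>'" by (rule uniq[OF \<omega>(1)])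
  qed (simp add: l_def)
  moreover have "l (om H) = Y H" if H: "H \<in> \<A>" for H
    by (rule uniq[OF om_log_stalk[OF H v]])
       (use tendsto_diff[OF quot[OF H] quot[OF arr(3)]] Y0 in \<open>simp add: om_def\<close>)
  ultimately show ?thesis by blast
qed

section \<open>Charts of the projectivised bundle\<close>

lemma dual_smult:
  assumes "l \<in> log_fibre_dual n \<A> x"
  shows "(\<lambda>\<omega>. c * l \<omega>) \<in> log_fibre_dual n \<A> x"
  unfolding log_fibre_dual_def
proof (intro CollectI conjI ballI allI impI; (elim conjE)?)
  fix \<omega> \<omega>' assume "\<omega> \<in> log_stalk n \<A> x" "\<omega>' \<in> log_stalk n \<A> x"
  from dual_add[OF assms this] show "c * l (\<lambda>v w. \<omega> v w + \<omega>' v w) = c * l \<omega> + c * l \<omega>'"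
    by (simp add: algebra_simps)
next
  fix \<omega> U f assume "\<omega> \<in> log_stalk n \<A> x" "pop U" "x \<in> U" "f \<in> reg U"
  from dual_mult[OF assms this] show "c * l (\<lambda>v w. f (pclass v) * \<omega> v w) = f x * (c * l \<omega>)" by simp
next
  fix \<omega> \<omega>' U assume \<omega>: "\<omega> \<in> log_stalk n \<A> x" "\<omega>' \<in> log_stalk n \<A> x"
    and U: "pop U" "x \<in> U" and agree: "forms_agree_on n (U - arr_union n \<A>) \<omega> \<omega>'"
  have "l \<omega> = l \<omega>'" by (rule dual_agree[OF assms \<omega> U]) (use agree in \<open>auto simp: forms_agree_on_def\<close>)
  then show "c * l \<omega> = c * l \<omega>'" by simp
qed (simp add: dual_outside[OF assms])

section \<open>Points of the bundle and graded functions on it\<close>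

definition quotient_class :: "vec set \<Rightarrow> (form \<Rightarrow> complex) \<Rightarrow> (vec set \<times> (form \<Rightarrow> complex)) set" where
  "quotient_class x l = {(x, \<lambda>\<omega>. c * l \<omega>) | c. c \<noteq> 0}"

lemma log_quotients_iff:
  "\<zeta> \<in> log_quotients n \<A> U \<longleftrightarrow> (\<exists>x l. x \<in> U \<and> l \<in> log_fibre_dual n \<A> x \<and> l \<noteq> (\<lambda>_. 0) \<and> \<zeta> = quotient_class x l)"
  unfolding log_quotients_def quotient_class_def by auto

lemma log_quotientsE:
  assumes "\<zeta> \<in> log_quotients n \<A> U"
  obtains x l where "x \<in> U" "l \<in> log_fibre_dual n \<A> x" "l \<noteq> (\<lambda>_. 0)" "\<zeta> = quotient_class x l"
  using assms unfolding log_quotients_iff by (elim exE conjE)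

lemma quotient_classE:
  assumes "r \<in> quotient_class x l" obtains c where "c \<noteq> 0" "r = (x, \<lambda>\<omega>. c * l \<omega>)"
  using assms unfolding quotient_class_def by auto

lemma quotient_class_self: "(x, l) \<in> quotient_class x l"
  unfolding quotient_class_def by (auto intro!: exI[of _ 1])

lemma log_quotients_mem:
  assumes "\<zeta> \<in> log_quotients n \<A> U" "r \<in> \<zeta>"
  shows "fst r \<in> U" "snd r \<in> log_fibre_dual n \<A> (fst r)" "snd r \<noteq> (\<lambda>_. 0)"
proof -
  obtain x l where x: "x \<in> U" "l \<in> log_fibre_dual n \<A> x" "l \<noteq> (\<lambda>_. 0)" "\<zeta> = quotient_class x l"
    by (rule log_quotientsE[OF assms(1)])
  obtain c where c: "c \<noteq> 0" "r = (x, \<lambda>\<omega>. c * l \<omega>)" using assms(2) unfolding x(4) by (rule quotient_classE)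
  show "fst r \<in> U" "snd r \<in> log_fibre_dual n \<A> (fst r)" using x c dual_smult[OF x(2)] by simp_all
  show "snd r \<noteq> (\<lambda>_. 0)" using x(3) c by (auto simp: fun_eq_iff)
qed

lemma log_quotients_nonempty: "\<zeta> \<in> log_quotients n \<A> U \<Longrightarrow> (SOME r. r \<in> \<zeta>) \<in> \<zeta>"
  by (erule log_quotientsE) (rule someI[of "\<lambda>r. r \<in> _"], simp, rule quotient_class_self)

lemma log_quotients_scale:
  assumes "\<zeta> \<in> log_quotients n \<A> U" "r \<in> \<zeta>" "r' \<in> \<zeta>"
  shows "fst r' = fst r" "\<exists>c\<noteq>0. \<forall>\<omega>. snd r' \<omega> = c * snd r \<omega>"
proof -
  obtain x l where x: "\<zeta> = quotient_class x l" by (rule log_quotientsE[OF assms(1)])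
  obtain c where c: "c \<noteq> 0" "r = (x, \<lambda>\<omega>. c * l \<omega>)" using assms(2) unfolding x by (rule quotient_classE)
  obtain c' where c': "c' \<noteq> 0" "r' = (x, \<lambda>\<omega>. c' * l \<omega>)" using assms(3) unfolding x by (rule quotient_classE)
  show "fst r' = fst r" using c c' by simp
  show "\<exists>c\<noteq>0. \<forall>\<omega>. snd r' \<omega> = c * snd r \<omega>" using c c' by (intro exI[of _ "c' / c"]) auto
qed

lemma log_quotients_subI:
  assumes "\<zeta> \<in> log_quotients n \<A> U" "r \<in> \<zeta>" "fst r \<in> U'"
  shows "\<zeta> \<in> log_quotients n \<A> U'"
proof -
  obtain x l where x: "x \<in> U" "l \<in> log_fibre_dual n \<A> x" "l \<noteq> (\<lambda>_. 0)" "\<zeta> = quotient_class x l"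
    by (rule log_quotientsE[OF assms(1)])
  then have "fst r = x" using assms(2) by (auto elim: quotient_classE)
  then show ?thesis using x assms(3) unfolding log_quotients_iff by blast
qed

lemma log_quotients_mono: "U \<subseteq> U' \<Longrightarrow> log_quotients n \<A> U \<subseteq> log_quotients n \<A> U'"
  unfolding log_quotients_def by blast

lemma log_quotients_Int: "log_quotients n \<A> U \<inter> log_quotients n \<A> U' = log_quotients n \<A> (U \<inter> U')"
proof
  show "log_quotients n \<A> U \<inter> log_quotients n \<A> U' \<subseteq> log_quotients n \<A> (U \<inter> U')"
  proof
    fix \<zeta> assume *: "\<zeta> \<in> log_quotients n \<A> U \<inter> log_quotients n \<A> U'"
    then have r: "(SOME r. r \<in> \<zeta>) \<in> \<zeta>" using log_quotients_nonempty by blast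
    show "\<zeta> \<in> log_quotients n \<A> (U \<inter> U')"
      by (rule log_quotients_subI[OF _ r, of U]) (use * log_quotients_mem(1)[OF _ r] in auto)
  qed
qed (intro Int_greatest log_quotients_mono; blast)

abbreviation gens0 where "gens0 U \<equiv> {\<lambda>(x, l). f x | f. f \<in> regular (proj_space n) U} :: (vec set \<times> (form \<Rightarrow> complex) \<Rightarrow> complex) set"
abbreviation gens1 where "gens1 U \<equiv> {\<lambda>(x, l). l \<omega> | \<omega>. \<omega> \<in> log_forms n \<A> U} :: (vec set \<times> (form \<Rightarrow> complex) \<Rightarrow> complex) set"

lemma log_symmetric_iff:
  "(D, F) \<in> log_symmetric n \<A> m \<longleftrightarrow> (\<exists>U. D = log_quotients n \<A> U \<and> pop U \<and> homogeneous (gens0 U) (gens1 U) m F)"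
  unfolding log_symmetric_def by blast

lemma gens0I: "f \<in> reg U \<Longrightarrow> (\<lambda>r. f (fst r)) \<in> gens0 U"
  by (intro CollectI exI[of _ f]) (auto simp: fun_eq_iff)

lemma gens1I: "\<omega> \<in> log_forms n \<A> U \<Longrightarrow> (\<lambda>r. snd r \<omega>) \<in> gens1 U"
  by (intro CollectI exI[of _ \<omega>]) (auto simp: fun_eq_iff)

lemma gens_mono:
  assumes "pop U'" "U' \<subseteq> U"
  shows "gens0 U \<subseteq> gens0 U'" "gens1 U \<subseteq> gens1 U'"
  using reg_mono[OF _ assms(2)] log_forms_mono[OF _ assms] by blast+

lemma gens0_const: "U \<subseteq> proj_points n \<Longrightarrow> (\<lambda>_. c) \<in> gens0 U"
  by (rule gens0I[OF reg_const])

sublocale LS: proj_system "log_symmetric n \<A>"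
proof
  fix D F m D' F' m' assume "(D, F) \<in> log_symmetric n \<A> m" "(D', F') \<in> log_symmetric n \<A> m'"
  then obtain U U' where U: "D = log_quotients n \<A> U" "pop U" "homogeneous (gens0 U) (gens1 U) m F"
    "D' = log_quotients n \<A> U'" "pop U'" "homogeneous (gens0 U') (gens1 U') m' F'"
    unfolding log_symmetric_iff by blast
  have I: "pop (U \<inter> U')" using U by auto
  have "homogeneous (gens0 (U \<inter> U')) (gens1 (U \<inter> U')) m F" "homogeneous (gens0 (U \<inter> U')) (gens1 (U \<inter> U')) m' F'"
    using homogeneous_mono[OF U(3) gens_mono[OF I]] homogeneous_mono[OF U(6) gens_mono[OF I]] by auto
  then have "homogeneous (gens0 (U \<inter> U')) (gens1 (U \<inter> U')) (m + m') (\<lambda>r. F r * F' r)"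
    by (rule homogeneous.mult)
  then show "(D \<inter> D', \<lambda>r. F r * F' r) \<in> log_symmetric n \<A> (m + m')"
    unfolding log_symmetric_iff U(1,4) log_quotients_Int using I by blast
next
  fix D F m F' assume "(D, F) \<in> log_symmetric n \<A> m" "(D, F') \<in> log_symmetric n \<A> m"
  then obtain U U' where U: "D = log_quotients n \<A> U" "pop U" "homogeneous (gens0 U) (gens1 U) m F"
    "D = log_quotients n \<A> U'" "pop U'" "homogeneous (gens0 U') (gens1 U') m F'"
    unfolding log_symmetric_iff by blast
  have I: "pop (U \<inter> U')" using U by auto
  have "homogeneous (gens0 (U \<inter> U')) (gens1 (U \<inter> U')) m F" "homogeneous (gens0 (U \<inter> U')) (gens1 (U \<inter> U')) m F'"
    using homogeneous_mono[OF U(3) gens_mono[OF I]] homogeneous_mono[OF U(6) gens_mono[OF I]] by auto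
  then have "homogeneous (gens0 (U \<inter> U')) (gens1 (U \<inter> U')) m (\<lambda>r. F r + F' r)"
    by (rule homogeneous.add)
  \<comment> \<open>One domain \<open>D\<close> may be presented by two open sets. Both
    presentations restrict to the intersection, over which the domain is unchanged.\<close>
  moreover have "D = log_quotients n \<A> (U \<inter> U')" using log_quotients_Int[of U U'] U(1,4) by simp
  ultimately show "(D, \<lambda>r. F r + F' r) \<in> log_symmetric n \<A> m"
    unfolding log_symmetric_iff using I by blast
next
  fix D F m c assume "(D, F) \<in> log_symmetric n \<A> m"
  then obtain U where U: "D = log_quotients n \<A> U" "pop U" unfolding log_symmetric_iff by blast
  have "homogeneous (gens0 U) (gens1 U) 0 (\<lambda>_. c)"
    by (rule homogeneous.degree_zero[OF gens0_const[OF pop_sub[OF U(2)]]])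
  then show "(D, \<lambda>_. c) \<in> log_symmetric n \<A> 0" unfolding log_symmetric_iff using U by blast
qed

abbreviation X :: "(vec set \<times> (form \<Rightarrow> complex)) set fun_space" where
  "X \<equiv> Proj (log_symmetric n \<A>)"

definition yc :: "vec set \<Rightarrow> vec set \<times> (form \<Rightarrow> complex) \<Rightarrow> complex" where
  "yc H r = snd r (om H)"

lemma log_symmetric_deg0: "pop U \<Longrightarrow> f \<in> reg U \<Longrightarrow> (log_quotients n \<A> U, \<lambda>r. f (fst r)) \<in> log_symmetric n \<A> 0"
  unfolding log_symmetric_iff using homogeneous.degree_zero[OF gens0I, of f U "gens1 U"] by blast

lemma log_symmetric_yc: "pop U \<Longrightarrow> H \<in> \<A> \<Longrightarrow> (log_quotients n \<A> U, yc H) \<in> log_symmetric n \<A> 1"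
  unfolding log_symmetric_iff yc_def[abs_def]
  using homogeneous.degree_one[OF gens1I[OF log_forms_mono[OF om_log_forms _ pop_sub]], of H U "gens0 U"] by blast

lemma points_X: "points X = log_quotients n \<A> (proj_points n)"
proof
  show "points X \<subseteq> log_quotients n \<A> (proj_points n)"
  proof
    fix \<zeta> assume "\<zeta> \<in> points X"
    then obtain U where U: "\<zeta> \<in> log_quotients n \<A> U" "pop U"
      unfolding LS.points_Proj log_symmetric_iff by blast
    have r: "(SOME r. r \<in> \<zeta>) \<in> \<zeta>" by (rule log_quotients_nonempty[OF U(1)])
    show "\<zeta> \<in> log_quotients n \<A> (proj_points n)"
      using log_quotients_subI[OF U(1) r] log_quotients_mem(1)[OF U(1) r] pop_sub[OF U(2)] by blast
  qed
  show "log_quotients n \<A> (proj_points n) \<subseteq> points X"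
    unfolding LS.points_Proj using log_symmetric_deg0[OF pop_proj_points reg_const[OF subset_refl]] by blast
qed

section \<open>Affine charts and their equations\<close>

definition chart :: "nat \<Rightarrow> vec set \<Rightarrow> (vec set \<times> (form \<Rightarrow> complex)) set set" where
  "chart j K = nonvanishing (log_quotients n \<A> (affine_part (cvec j))) (yc K)"

text \<open>Affine coordinates on the chart: \<open>Inl i\<close> is \<open>v i / v j\<close> and \<open>Inr H\<close> is \<open>Y H / Y K\<close>.\<close>

definition idx :: "(nat + vec set) set" where
  "idx = Inl ` {..n} \<union> Inr ` \<A>"

definition zc :: "nat \<Rightarrow> vec set \<Rightarrow> (vec set \<times> (form \<Rightarrow> complex)) set \<Rightarrow> nat + vec set \<Rightarrow> complex" where
  "zc j K \<zeta> = case_sum (\<lambda>i. coord j i (fst (SOME r. r \<in> \<zeta>))) (\<lambda>H. yc H (SOME r. r \<in> \<zeta>) / yc K (SOME r. r \<in> \<zeta>))"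

lemma chart_open: "K \<in> \<A> \<Longrightarrow> zopen X (chart j K)"
  unfolding chart_def by (rule LS.zopen_nonvanishing[OF log_symmetric_yc[OF pop_affine_part]])

lemma chart_sub: "chart j K \<subseteq> points X"
  unfolding chart_def nonvanishing_def points_X using log_quotients_mono[OF affine_part_sub] by blast

lemma points_mem:
  assumes "\<zeta> \<in> points X" "r \<in> \<zeta>"
  shows "fst r \<in> proj_points n" "snd r \<in> log_fibre_dual n \<A> (fst r)" "snd r \<noteq> (\<lambda>_. 0)"
  using log_quotients_mem[OF assms(1)[unfolded points_X] assms(2)] .

lemma points_some: "\<zeta> \<in> points X \<Longrightarrow> (SOME r. r \<in> \<zeta>) \<in> \<zeta>"
  unfolding points_X by (rule log_quotients_nonempty)

lemma points_scale:
  assumes "\<zeta> \<in> points X" "r \<in> \<zeta>" "r' \<in> \<zeta>"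
  shows "fst r' = fst r" "\<exists>c\<noteq>0. \<forall>\<omega>. snd r' \<omega> = c * snd r \<omega>"
  using log_quotients_scale[OF assms(1)[unfolded points_X] assms(2,3)] .

lemma chart_mem:
  assumes "\<zeta> \<in> chart j K" "r \<in> \<zeta>"
  shows "fst r \<in> affine_part (cvec j)" "yc K r \<noteq> 0"
  using assms log_quotients_mem(1)[of \<zeta> "affine_part (cvec j)" r] by (auto simp: chart_def nonvanishing_def)

lemma chartI:
  assumes "\<zeta> \<in> points X" "r \<in> \<zeta>" "fst r \<in> affine_part (cvec j)" "yc K r \<noteq> 0"
  shows "\<zeta> \<in> chart j K"
proof -
  have "yc K r' \<noteq> 0" if "r' \<in> \<zeta>" for r'
    using points_scale(2)[OF assms(1,2) that] assms(4) by (auto simp: yc_def)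
  moreover have "\<zeta> \<in> log_quotients n \<A> (affine_part (cvec j))"
    using log_quotients_subI[OF assms(1)[unfolded points_X] assms(2,3)] .
  ultimately show ?thesis by (simp add: chart_def nonvanishing_def)
qed

lemma zc_eq:
  assumes "\<zeta> \<in> points X" "r \<in> \<zeta>"
  shows "zc j K \<zeta> (Inl i) = coord j i (fst r)" "zc j K \<zeta> (Inr H) = yc H r / yc K r"
proof -
  have s: "(SOME r. r \<in> \<zeta>) \<in> \<zeta>" by (rule points_some[OF assms(1)])
  show "zc j K \<zeta> (Inl i) = coord j i (fst r)" using points_scale(1)[OF assms(1) assms(2) s] by (simp add: zc_def)
  obtain c where "c \<noteq> 0" "\<forall>\<omega>. snd (SOME r. r \<in> \<zeta>) \<omega> = c * snd r \<omega>" using points_scale(2)[OF assms(1) assms(2) s] by blast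
  then show "zc j K \<zeta> (Inr H) = yc H r / yc K r" by (simp add: zc_def yc_def)
qed

definition vz :: "(nat + vec set \<Rightarrow> complex) \<Rightarrow> vec" where
  "vz a = (\<lambda>i. if i \<le> n then a (Inl i) else 0)"

lemma vz_vecs: "vz a \<in> vecs n"
  by (simp add: vz_def vecs_def)

lemma pclass_vz:
  assumes "\<zeta> \<in> chart j K" "r \<in> \<zeta>" "j \<le> n"
  shows "pclass (vz (zc j K \<zeta>)) = fst r" "vz (zc j K \<zeta>) j = 1"
proof -
  have p: "\<zeta> \<in> points X" using assms(1) chart_sub by blast
  obtain v where v: "fst r = pclass v" "v \<in> vecs n" "v j = 1"
    by (rule normalised_representative[OF chart_mem(1)[OF assms(1,2)] assms(3)])
  have "vz (zc j K \<zeta>) = v" using v(2,3) assms(3)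
    by (auto simp: vz_def zc_eq[OF p assms(2)] v(1) coord_pclass vecs_def fun_eq_iff)
  then show "pclass (vz (zc j K \<zeta>)) = fst r" "vz (zc j K \<zeta>) j = 1" using v by simp_all
qed

lemma pol_vz_eqn: "pol idx (\<lambda>a. eqn n H (vz a))"
proof -
  have "pol idx (\<lambda>a. \<Sum>i\<in>{..n}. (SOME a. a \<in> H) i * a (Inl i))"
    by (intro pol_intros) (auto simp: idx_def)
  then show ?thesis by (simp add: eqn_def lin_def vz_def)
qed

lemma pol_Inr: "H \<in> \<A> \<Longrightarrow> pol idx (\<lambda>a. a (Inr H))"
  by (rule pol.var) (simp add: idx_def)

lemma pol_Inl: "i \<le> n \<Longrightarrow> pol idx (\<lambda>a. a (Inl i))"
  by (rule pol.var) (simp add: idx_def)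

lemma pol_hom_poly: "hom_poly n m F \<Longrightarrow> pol idx (\<lambda>a. F (vz a))"
  unfolding hom_poly_def
proof (induction rule: homogeneous.induct)
  case (degree_one g)
  then obtain i where "i \<le> n" "g = (\<lambda>v. v i)" by blast
  then show ?case by (simp add: vz_def pol_Inl)
qed (auto intro: pol_intros)

lemma countable_idx: "countable idx"
  using arr(2) by (simp add: idx_def countable_finite)

text \<open>The vector \<open>w\<close> of the incidence relation is eliminated:
  \<open>tangent\<close> supplies it as a polynomial in \<open>v\<close> and \<open>Y\<close>, so
  that the chart is a closed subset of an affine space in the coordinates \<open>zc\<close> alone.
  The first three equations are the normalisations.\<close>

definition chart_eqs :: "nat \<Rightarrow> vec set \<Rightarrow> ((nat + vec set \<Rightarrow> complex) \<Rightarrow> complex) set" where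
  "chart_eqs j K = {\<lambda>a. a (Inl j) - 1, \<lambda>a. a (Inr K) - 1, \<lambda>a. a (Inr H0)} \<union>
     (\<lambda>H a. eqn n H (tangent (vz a) (\<lambda>H. a (Inr H))) - eqn n H (vz a) * a (Inr H)) ` \<A>"

lemma chart_eqs_pol:
  assumes "j \<le> n" "K \<in> \<A>" "e \<in> chart_eqs j K"
  shows "pol idx e"
proof -
  have "pol idx (\<lambda>a. eqn n H (tangent (vz a) (\<lambda>H. a (Inr H))) - eqn n H (vz a) * a (Inr H))" if "H \<in> \<A>" for H
    unfolding tangent_def eqn_sum using that S(1) by (intro pol_intros pol_vz_eqn pol_Inr) auto
  moreover have "pol idx (\<lambda>a. a (Inl j) - 1)" "pol idx (\<lambda>a. a (Inr K) - 1)" "pol idx (\<lambda>a. a (Inr H0))"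
    by (intro pol_diff pol.const pol_Inr pol_Inl assms arr(3))+
  ultimately show ?thesis using assms(3) unfolding chart_eqs_def by blast
qed

lemma chart_eqs_vanish:
  assumes "j \<le> n" "K \<in> \<A>" "\<zeta> \<in> chart j K" "e \<in> chart_eqs j K"
  shows "e (zc j K \<zeta>) = 0"
proof -
  have p: "\<zeta> \<in> points X" using assms(3) chart_sub by blast
  define r where "r = (SOME r. r \<in> \<zeta>)"
  have r: "r \<in> \<zeta>" unfolding r_def by (rule points_some[OF p])
  define v where "v = vz (zc j K \<zeta>)"
  have v: "pclass v = fst r" "v j = 1" unfolding v_def by (rule pclass_vz[OF assms(3) r assms(1)])+
  have "zc j K \<zeta> (Inl j) = 1" using v(2) assms(1) by (simp add: v_def vz_def)
  moreover have "zc j K \<zeta> (Inr K) = 1" using chart_mem(2)[OF assms(3) r] by (simp add: zc_eq(2)[OF p r])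
  moreover have "zc j K \<zeta> (Inr H0) = 0"
    using dual_zero[OF points_mem(2,1)[OF p r]] by (simp add: zc_eq(2)[OF p r] yc_def om_H0)
  moreover have "eqn n H (tangent v (\<lambda>H. zc j K \<zeta> (Inr H))) = eqn n H v * zc j K \<zeta> (Inr H)" if "H \<in> \<A>" for H
  proof -
    have "eqn n H (tangent v (\<lambda>H. snd r (om H))) = eqn n H v * snd r (om H)"
      by (rule dual_relation[OF _ _ that]) (use v points_mem(1,2)[OF p r] in simp_all)
    moreover have "tangent v (\<lambda>H. snd r (om H) / yc K r) = (\<lambda>i. inverse (yc K r) * tangent v (\<lambda>H. snd r (om H)) i)"
      by (simp add: tangent_def sum_distrib_left field_simps)
    ultimately have "eqn n H (tangent v (\<lambda>H. snd r (om H) / yc K r)) = inverse (yc K r) * (eqn n H v * snd r (om H))"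
      by (simp only: eqn_scale)
    then show ?thesis unfolding zc_eq(2)[OF p r] by (simp add: yc_def field_simps)
  qed
  ultimately show ?thesis using assms(4) by (auto simp: chart_eqs_def v_def)
qed

text \<open>By \<open>dual_exists\<close> a solution comes from a functional, which is nonzero
  because its value on \<open>om K\<close> is 1.\<close>

lemma chart_eqs_zeros:
  assumes "j \<le> n" "K \<in> \<A>" and 0: "\<forall>e\<in>chart_eqs j K. e a = 0"
  shows "\<exists>\<zeta>\<in>chart j K. \<forall>i\<in>idx. zc j K \<zeta> i = a i"
proof -
  define v where "v = vz a"
  define Y where "Y = (\<lambda>H. a (Inr H))"
  have 1: "a (Inl j) = 1" "a (Inr K) = 1" "Y H0 = 0" using 0 by (simp_all add: chart_eqs_def Y_def)
  have rel: "eqn n H (tangent v Y) = eqn n H v * Y H" if "H \<in> \<A>" for H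
    using 0 that by (simp add: chart_eqs_def v_def Y_def)
  have vj: "v j = 1" "v \<in> vecs n" using 1 assms(1) vz_vecs by (simp_all add: v_def vz_def)
  then have "v \<noteq> (\<lambda>_. 0)" by auto
  then have p: "pclass v \<in> proj_points n" "pclass v \<in> affine_part (cvec j)"
    using vj assms(1) by (simp_all add: pclass_in_proj_points mem_affine_part lin_cvec)
  obtain l where l: "l \<in> log_fibre_dual n \<A> (pclass v)" "\<And>H. H \<in> \<A> \<Longrightarrow> l (om H) = Y H"
    using dual_exists[OF p(1) 1(3) rel] by blast
  define \<zeta> where "\<zeta> = quotient_class (pclass v) l"
  have r: "(pclass v, l) \<in> \<zeta>" unfolding \<zeta>_def by (rule quotient_class_self)
  have yK: "yc K (pclass v, l) = 1" using l(2)[OF assms(2)] 1(2) by (simp add: yc_def Y_def)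
  then have "l \<noteq> (\<lambda>_. 0)" by (auto simp: yc_def)
  then have \<zeta>: "\<zeta> \<in> points X" unfolding points_X log_quotients_iff \<zeta>_def using p(1) l(1) by blast
  then have "\<zeta> \<in> chart j K" using r by (rule chartI) (use p yK in auto)
  moreover have "zc j K \<zeta> i = a i" if i: "i \<in> idx" for i
  proof -
    consider i' where "i = Inl i'" "i' \<le> n" | H where "i = Inr H" "H \<in> \<A>" using i unfolding idx_def by blast
    then show ?thesis
    proof cases
      case 1
      then show ?thesis using assms(1) vj(1)
        by (simp add: zc_eq(1)[OF \<zeta> r] coord_pclass) (simp add: v_def vz_def)
    next
      case 2
      then show ?thesis using l(2)[OF 2(2)] yK by (simp add: zc_eq(2)[OF \<zeta> r]) (simp add: yc_def Y_def)
    qed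
  qed
  ultimately show ?thesis by blast
qed

section \<open>Algebraic functions on a chart\<close>

lemma chart_quasi_compact:
  assumes "j \<le> n" "K \<in> \<A>" and H: "\<And>h. h \<in> \<H> \<Longrightarrow> pol idx h"
    and cover: "\<And>\<zeta>. \<zeta> \<in> chart j K \<Longrightarrow> \<exists>h\<in>\<H>. h (zc j K \<zeta>) \<noteq> 0"
  obtains \<H>0 where "finite \<H>0" "\<H>0 \<subseteq> \<H>" "\<And>\<zeta>. \<zeta> \<in> chart j K \<Longrightarrow> \<exists>h\<in>\<H>0. h (zc j K \<zeta>) \<noteq> 0"
proof (rule affine_quasi_compact[where W = "chart j K" and z = "zc j K" and E = "chart_eqs j K" and I = idx and H = \<H>])
  show "\<exists>\<zeta>\<in>chart j K. \<forall>i\<in>idx. zc j K \<zeta> i = a i" if "\<forall>e\<in>chart_eqs j K. e a = 0" for a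
    by (rule chart_eqs_zeros[OF assms(1,2) that])
  show "e (zc j K \<zeta>) = 0" if "\<zeta> \<in> chart j K" "e \<in> chart_eqs j K" for \<zeta> e
    by (rule chart_eqs_vanish[OF assms(1,2) that])
qed (use countable_idx chart_eqs_pol[OF assms(1,2)] H cover that in auto)

lemma chart_regular:
  assumes "j \<le> n" "K \<in> \<A>" "pol idx g"
    and "\<And>\<zeta>. \<zeta> \<in> chart j K \<Longrightarrow> g (zc j K \<zeta>) \<noteq> 0 \<Longrightarrow> \<exists>P Q. pol idx P \<and> pol idx Q \<and> Q (zc j K \<zeta>) \<noteq> 0 \<and>
      (\<forall>\<zeta>'\<in>chart j K. g (zc j K \<zeta>') \<noteq> 0 \<longrightarrow> Q (zc j K \<zeta>') \<noteq> 0 \<longrightarrow> \<phi> \<zeta>' * Q (zc j K \<zeta>') = P (zc j K \<zeta>'))"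
  shows "\<exists>k a. pol idx a \<and> (\<forall>\<zeta>\<in>chart j K. g (zc j K \<zeta>) \<noteq> 0 \<longrightarrow> g (zc j K \<zeta>) ^ k * \<phi> \<zeta> = a (zc j K \<zeta>))"
proof (rule affine_regular_function[where W = "chart j K" and z = "zc j K" and E = "chart_eqs j K" and I = idx])
  show "\<exists>\<zeta>\<in>chart j K. \<forall>i\<in>idx. zc j K \<zeta> i = a i" if "\<forall>e\<in>chart_eqs j K. e a = 0" for a
    by (rule chart_eqs_zeros[OF assms(1,2) that])
  show "e (zc j K \<zeta>) = 0" if "\<zeta> \<in> chart j K" "e \<in> chart_eqs j K" for \<zeta> e
    by (rule chart_eqs_vanish[OF assms(1,2) that])
qed (rule countable_idx chart_eqs_pol[OF assms(1,2)] assms(3,4); assumption)+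

text \<open>Dehomogenisation: a function of degree \<open>m\<close> on representatives descends to
  the chart after division by \<open>yc K r ^ m\<close>, and what descends is to be a quotient of
  polynomials in the chart coordinates near \<open>\<zeta>0\<close>.\<close>

definition rational_at where
  "rational_at j K \<zeta>0 m F \<longleftrightarrow> (\<exists>P Q. pol idx P \<and> pol idx Q \<and> Q (zc j K \<zeta>0) \<noteq> 0 \<and>
     (\<forall>\<zeta>\<in>chart j K. Q (zc j K \<zeta>) \<noteq> 0 \<longrightarrow> (\<forall>r\<in>\<zeta>. F r = yc K r ^ m * (P (zc j K \<zeta>) / Q (zc j K \<zeta>)))))" for m :: nat

lemma rational_atE:
  assumes "rational_at j K \<zeta>0 m F"
  obtains P Q where "pol idx P" "pol idx Q" "Q (zc j K \<zeta>0) \<noteq> 0"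
    "\<And>\<zeta> r. \<zeta> \<in> chart j K \<Longrightarrow> Q (zc j K \<zeta>) \<noteq> 0 \<Longrightarrow> r \<in> \<zeta> \<Longrightarrow> F r = yc K r ^ m * (P (zc j K \<zeta>) / Q (zc j K \<zeta>))"
  using assms unfolding rational_at_def by (elim exE conjE) (rule that, auto)

lemma rational_atI:
  assumes "pol idx P" "pol idx Q" "Q (zc j K \<zeta>0) \<noteq> 0"
    "\<And>\<zeta> r. \<zeta> \<in> chart j K \<Longrightarrow> Q (zc j K \<zeta>) \<noteq> 0 \<Longrightarrow> r \<in> \<zeta> \<Longrightarrow> F r = yc K r ^ m * (P (zc j K \<zeta>) / Q (zc j K \<zeta>))"
  shows "rational_at j K \<zeta>0 m F"
  unfolding rational_at_def by (rule exI[of _ P], rule exI[of _ Q]) (use assms in auto)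

text \<open>The open condition given by \<open>h\<close> is absorbed by expanding the fraction with
  \<open>h\<close>.\<close>

lemma rational_at_cong:
  assumes "rational_at j K \<zeta>0 m F" "pol idx h" "h (zc j K \<zeta>0) \<noteq> 0"
    "\<And>\<zeta> r. \<zeta> \<in> chart j K \<Longrightarrow> h (zc j K \<zeta>) \<noteq> 0 \<Longrightarrow> r \<in> \<zeta> \<Longrightarrow> F' r = F r"
  shows "rational_at j K \<zeta>0 m F'"
proof -
  obtain P Q where *: "pol idx P" "pol idx Q" "Q (zc j K \<zeta>0) \<noteq> 0"
    "\<And>\<zeta> r. \<zeta> \<in> chart j K \<Longrightarrow> Q (zc j K \<zeta>) \<noteq> 0 \<Longrightarrow> r \<in> \<zeta> \<Longrightarrow> F r = yc K r ^ m * (P (zc j K \<zeta>) / Q (zc j K \<zeta>))"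
    by (rule rational_atE[OF assms(1)]) (rule that)
  show ?thesis
    by (rule rational_atI[of "\<lambda>a. h a * P a" "\<lambda>a. h a * Q a"]) (use * assms(2-) in \<open>auto intro: pol.mult\<close>)
qed

lemma rational_at_add:
  assumes "rational_at j K \<zeta>0 m F" "rational_at j K \<zeta>0 m F'"
  shows "rational_at j K \<zeta>0 m (\<lambda>r. F r + F' r)"
proof -
  obtain P Q where 1: "pol idx P" "pol idx Q" "Q (zc j K \<zeta>0) \<noteq> 0"
    "\<And>\<zeta> r. \<zeta> \<in> chart j K \<Longrightarrow> Q (zc j K \<zeta>) \<noteq> 0 \<Longrightarrow> r \<in> \<zeta> \<Longrightarrow> F r = yc K r ^ m * (P (zc j K \<zeta>) / Q (zc j K \<zeta>))"
    by (rule rational_atE[OF assms(1)]) (rule that)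
  obtain P' Q' where 2: "pol idx P'" "pol idx Q'" "Q' (zc j K \<zeta>0) \<noteq> 0"
    "\<And>\<zeta> r. \<zeta> \<in> chart j K \<Longrightarrow> Q' (zc j K \<zeta>) \<noteq> 0 \<Longrightarrow> r \<in> \<zeta> \<Longrightarrow> F' r = yc K r ^ m * (P' (zc j K \<zeta>) / Q' (zc j K \<zeta>))"
    by (rule rational_atE[OF assms(2)]) (rule that)
  show ?thesis
  proof (rule rational_atI[of "\<lambda>a. P a * Q' a + P' a * Q a" "\<lambda>a. Q a * Q' a"])
    fix \<zeta> r assume *: "\<zeta> \<in> chart j K" "Q (zc j K \<zeta>) * Q' (zc j K \<zeta>) \<noteq> 0" "r \<in> \<zeta>"
    then have "F r = yc K r ^ m * (P (zc j K \<zeta>) / Q (zc j K \<zeta>))" "F' r = yc K r ^ m * (P' (zc j K \<zeta>) / Q' (zc j K \<zeta>))"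
      using 1(4)[OF *(1) _ *(3)] 2(4)[OF *(1) _ *(3)] by auto
    with *(2) show "F r + F' r = yc K r ^ m * ((P (zc j K \<zeta>) * Q' (zc j K \<zeta>) + P' (zc j K \<zeta>) * Q (zc j K \<zeta>)) / (Q (zc j K \<zeta>) * Q' (zc j K \<zeta>)))"
      by (simp add: add_frac_eq algebra_simps)
  qed (use 1 2 in \<open>auto intro!: pol_intros\<close>)
qed

lemma rational_at_mult:
  assumes "rational_at j K \<zeta>0 m F" "rational_at j K \<zeta>0 k F'"
  shows "rational_at j K \<zeta>0 (m + k) (\<lambda>r. F r * F' r)"
proof -
  obtain P Q where 1: "pol idx P" "pol idx Q" "Q (zc j K \<zeta>0) \<noteq> 0"
    "\<And>\<zeta> r. \<zeta> \<in> chart j K \<Longrightarrow> Q (zc j K \<zeta>) \<noteq> 0 \<Longrightarrow> r \<in> \<zeta> \<Longrightarrow> F r = yc K r ^ m * (P (zc j K \<zeta>) / Q (zc j K \<zeta>))"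
    by (rule rational_atE[OF assms(1)]) (rule that)
  obtain P' Q' where 2: "pol idx P'" "pol idx Q'" "Q' (zc j K \<zeta>0) \<noteq> 0"
    "\<And>\<zeta> r. \<zeta> \<in> chart j K \<Longrightarrow> Q' (zc j K \<zeta>) \<noteq> 0 \<Longrightarrow> r \<in> \<zeta> \<Longrightarrow> F' r = yc K r ^ k * (P' (zc j K \<zeta>) / Q' (zc j K \<zeta>))"
    by (rule rational_atE[OF assms(2)]) (rule that)
  show ?thesis
  proof (rule rational_atI[of "\<lambda>a. P a * P' a" "\<lambda>a. Q a * Q' a"])
    fix \<zeta> r assume *: "\<zeta> \<in> chart j K" "Q (zc j K \<zeta>) * Q' (zc j K \<zeta>) \<noteq> 0" "r \<in> \<zeta>"
    then show "F r * F' r = yc K r ^ (m + k) * (P (zc j K \<zeta>) * P' (zc j K \<zeta>) / (Q (zc j K \<zeta>) * Q' (zc j K \<zeta>)))"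
      using 1(4)[OF *(1) _ *(3)] 2(4)[OF *(1) _ *(3)] by (simp add: power_add)
  qed (use 1 2 in \<open>auto intro!: pol_intros\<close>)
qed

lemma rational_at_sum:
  assumes "\<And>i. i \<in> A \<Longrightarrow> rational_at j K \<zeta>0 m (F i)"
  shows "rational_at j K \<zeta>0 m (\<lambda>r. \<Sum>i\<in>A. F i r)"
  using assms
proof (induction A rule: infinite_finite_induct)
  case (insert i A)
  then show ?case using rational_at_add[of j K \<zeta>0 m "F i" "\<lambda>r. \<Sum>i\<in>A. F i r"] by simp
qed (auto intro!: rational_atI[of "\<lambda>_. 0" "\<lambda>_. 1"] pol.const)

lemma rational_at_yc: "H \<in> \<A> \<Longrightarrow> rational_at j K \<zeta>0 1 (yc H)"
proof (rule rational_atI[of "\<lambda>a. a (Inr H)" "\<lambda>_. 1"])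
  fix \<zeta> r assume \<zeta>: "\<zeta> \<in> chart j K" "r \<in> \<zeta>"
  then show "yc H r = yc K r ^ 1 * (zc j K \<zeta> (Inr H) / 1)"
    using chart_mem(2)[OF \<zeta>] zc_eq(2)[OF subsetD[OF chart_sub \<zeta>(1)] \<zeta>(2)] by simp
qed (auto intro: pol_Inr pol.const)

lemma base_open_chart:
  assumes j: "j \<le> n" and \<zeta>0: "\<zeta>0 \<in> chart j K" "r0 \<in> \<zeta>0" and V: "pop V" "fst r0 \<in> V"
  obtains h where "pol idx h" "h (zc j K \<zeta>0) \<noteq> 0"
    "\<And>\<zeta> r. \<zeta> \<in> chart j K \<Longrightarrow> h (zc j K \<zeta>) \<noteq> 0 \<Longrightarrow> r \<in> \<zeta> \<Longrightarrow> fst r \<in> V"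
proof -
  have v0: "pclass (vz (zc j K \<zeta>0)) \<in> V" using pclass_vz(1)[OF \<zeta>0 j] V(2) by simp
  obtain m F where F: "hom_poly n m F" "F (vz (zc j K \<zeta>0)) \<noteq> 0" "nonvanishing (proj_points n) F \<subseteq> V"
    by (rule zopen_proj_space_basis[OF V(1) v0]) (rule that)
  show ?thesis
  proof (rule that[of "\<lambda>a. F (vz a)"])
    fix \<zeta> r assume \<zeta>: "\<zeta> \<in> chart j K" "F (vz (zc j K \<zeta>)) \<noteq> 0" "r \<in> \<zeta>"
    have p: "pclass (vz (zc j K \<zeta>)) = fst r" by (rule pclass_vz(1)[OF \<zeta>(1,3) j])
    have "fst r \<in> proj_points n" using chart_mem(1)[OF \<zeta>(1,3)] affine_part_sub by blast
    then have "pclass (vz (zc j K \<zeta>)) \<in> nonvanishing (proj_points n) F"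
      unfolding nonvanishing_proj_points[OF F(1)] using \<zeta>(2) p pclass_in_proj_points[of "vz (zc j K \<zeta>)" n] by simp
    then show "fst r \<in> V" using F(3) p by auto
  qed (use F pol_hom_poly in auto)
qed

lemma rational_at_base:
  assumes j: "j \<le> n" and \<zeta>0: "\<zeta>0 \<in> chart j K" "r0 \<in> \<zeta>0" and V: "pop V" "fst r0 \<in> V" and f: "f \<in> reg V"
  shows "rational_at j K \<zeta>0 0 (\<lambda>r. f (fst r))"
proof -
  obtain h where h: "pol idx h" "h (zc j K \<zeta>0) \<noteq> 0"
    "\<And>\<zeta> r. \<zeta> \<in> chart j K \<Longrightarrow> h (zc j K \<zeta>) \<noteq> 0 \<Longrightarrow> r \<in> \<zeta> \<Longrightarrow> fst r \<in> V"
    by (rule base_open_chart[OF j \<zeta>0 V]) (rule that)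
  have v0: "pclass (vz (zc j K \<zeta>0)) \<in> V" using pclass_vz(1)[OF \<zeta>0 j] V(2) by simp
  obtain m F G where F: "hom_poly n m F" "hom_poly n m G" "G (vz (zc j K \<zeta>0)) \<noteq> 0"
    "\<And>u. pclass u \<in> V \<Longrightarrow> pclass u \<in> proj_points n \<Longrightarrow> G u \<noteq> 0 \<Longrightarrow> f (pclass u) = F u / G u"
    by (rule regular_proj_spaceE[OF f v0]) (rule that)
  show ?thesis
  proof (rule rational_atI[of "\<lambda>a. h a * F (vz a)" "\<lambda>a. h a * G (vz a)"])
    fix \<zeta> r assume \<zeta>: "\<zeta> \<in> chart j K" "h (zc j K \<zeta>) * G (vz (zc j K \<zeta>)) \<noteq> 0" "r \<in> \<zeta>"
    have p: "pclass (vz (zc j K \<zeta>)) = fst r" by (rule pclass_vz(1)[OF \<zeta>(1,3) j])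
    have "fst r \<in> V" using h(3)[OF \<zeta>(1) _ \<zeta>(3)] \<zeta>(2) by simp
    then show "f (fst r) = yc K r ^ 0 * (h (zc j K \<zeta>) * F (vz (zc j K \<zeta>)) / (h (zc j K \<zeta>) * G (vz (zc j K \<zeta>))))"
      using F(4)[of "vz (zc j K \<zeta>)"] p pop_sub[OF V(1)] \<zeta>(2) by auto
  qed (use h F pol_hom_poly in \<open>auto intro!: pol.mult\<close>)
qed

text \<open>By \<open>lin_om_log_form\<close>, the value on \<omega> is locally a combination of the
  \<open>yc H\<close> with coefficients from the base, and all of these are rational on the
  chart.\<close>

lemma rational_at_form:
  assumes j: "j \<le> n" and \<zeta>0: "\<zeta>0 \<in> chart j K" "r0 \<in> \<zeta>0" and U: "pop U" "fst r0 \<in> U" and \<omega>: "\<omega> \<in> log_forms n \<A> U"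
  shows "rational_at j K \<zeta>0 1 (\<lambda>r. snd r \<omega>)"
proof -
  obtain V where V: "pop V" "fst r0 \<in> V" "lin_om V (\<lambda>x l. l \<omega>)"
    using lin_om_log_form[OF j log_stalkI[OF \<omega> U] chart_mem(1)[OF \<zeta>0]] by blast
  obtain c where c: "\<And>H. H \<in> \<A> \<Longrightarrow> c H \<in> reg V"
    "\<And>x l. x \<in> V \<Longrightarrow> l \<in> log_fibre_dual n \<A> x \<Longrightarrow> l \<omega> = (\<Sum>H\<in>\<A>. c H x * l (om H))"
    by (rule lin_omE[OF V(3)]) (rule that)
  obtain h where h: "pol idx h" "h (zc j K \<zeta>0) \<noteq> 0"
    "\<And>\<zeta> r. \<zeta> \<in> chart j K \<Longrightarrow> h (zc j K \<zeta>) \<noteq> 0 \<Longrightarrow> r \<in> \<zeta> \<Longrightarrow> fst r \<in> V"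
    by (rule base_open_chart[OF j \<zeta>0 V(1,2)]) (rule that)
  have "rational_at j K \<zeta>0 (0 + 1) (\<lambda>r. c H (fst r) * yc H r)" if "H \<in> \<A>" for H
    by (rule rational_at_mult[OF rational_at_base[OF j \<zeta>0 V(1,2) c(1)[OF that]] rational_at_yc[OF that]])
  then have "rational_at j K \<zeta>0 1 (\<lambda>r. \<Sum>H\<in>\<A>. c H (fst r) * yc H r)"
    by (intro rational_at_sum) simp
  then show ?thesis
  proof (rule rational_at_cong[OF _ h(1,2)])
    fix \<zeta> r assume \<zeta>: "\<zeta> \<in> chart j K" "h (zc j K \<zeta>) \<noteq> 0" "r \<in> \<zeta>"
    show "snd r \<omega> = (\<Sum>H\<in>\<A>. c H (fst r) * yc H r)"
      using c(2)[OF h(3)[OF \<zeta>] points_mem(2)[OF subsetD[OF chart_sub \<zeta>(1)] \<zeta>(3)]] by (simp add: yc_def)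
  qed
qed

lemma rational_at_homogeneous:
  assumes j: "j \<le> n" and \<zeta>0: "\<zeta>0 \<in> chart j K" "r0 \<in> \<zeta>0" and U: "pop U" "fst r0 \<in> U"
    and F: "homogeneous (gens0 U) (gens1 U) m F"
  shows "rational_at j K \<zeta>0 m F"
  using F
proof induction
  case (degree_zero c)
  then obtain f where "f \<in> reg U" "c = (\<lambda>(x, l). f x)" by blast
  then have "f \<in> reg U" "c = (\<lambda>r. f (fst r))" by (auto simp: fun_eq_iff)
  then show ?case using rational_at_base[OF j \<zeta>0 U] by simp
next
  case (degree_one g)
  then obtain \<omega> where "\<omega> \<in> log_forms n \<A> U" "g = (\<lambda>(x, l). l \<omega>)" by blast
  then have "\<omega> \<in> log_forms n \<A> U" "g = (\<lambda>r. snd r \<omega>)" by (auto simp: fun_eq_iff)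
  then show ?case using rational_at_form[OF j \<zeta>0 U] by simp
qed (auto intro: rational_at_add rational_at_mult)

text \<open>A basic neighbourhood is given by some \<open>F\<close>, which near the point equals a
  power of \<open>yc K\<close> times P / Q. So it is nonzero where \<open>P\<close> and
  \<open>Q\<close> are; the factor \<open>h\<close> keeps the base point in the open set over which
  \<open>F\<close> is defined.\<close>

lemma open_chart:
  assumes j: "j \<le> n" and \<zeta>0: "\<zeta>0 \<in> chart j K" and W: "zopen X W" "\<zeta>0 \<in> W"
  obtains h where "pol idx h" "h (zc j K \<zeta>0) \<noteq> 0"
    "\<And>\<zeta>. \<zeta> \<in> chart j K \<Longrightarrow> h (zc j K \<zeta>) \<noteq> 0 \<Longrightarrow> \<zeta> \<in> W"
proof -
  obtain D F m where F: "(D, F) \<in> log_symmetric n \<A> m" "\<zeta>0 \<in> nonvanishing D F" "nonvanishing D F \<subseteq> W"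
    by (rule LS.zopen_basis[OF W]) (rule that)
  obtain U where U: "D = log_quotients n \<A> U" "pop U" "homogeneous (gens0 U) (gens1 U) m F"
    using F(1) unfolding log_symmetric_iff by blast
  have p: "\<zeta>0 \<in> points X" using \<zeta>0 chart_sub by blast
  define r0 where "r0 = (SOME r. r \<in> \<zeta>0)"
  have r0: "r0 \<in> \<zeta>0" unfolding r0_def by (rule points_some[OF p])
  have Ur0: "fst r0 \<in> U" using log_quotients_mem(1)[OF _ r0] F(2) by (auto simp: U(1) nonvanishing_def)
  obtain h where h: "pol idx h" "h (zc j K \<zeta>0) \<noteq> 0"
    "\<And>\<zeta> r. \<zeta> \<in> chart j K \<Longrightarrow> h (zc j K \<zeta>) \<noteq> 0 \<Longrightarrow> r \<in> \<zeta> \<Longrightarrow> fst r \<in> U"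
    by (rule base_open_chart[OF j \<zeta>0 r0 U(2) Ur0]) (rule that)
  obtain P Q where Q: "pol idx P" "pol idx Q" "Q (zc j K \<zeta>0) \<noteq> 0"
    "\<And>\<zeta> r. \<zeta> \<in> chart j K \<Longrightarrow> Q (zc j K \<zeta>) \<noteq> 0 \<Longrightarrow> r \<in> \<zeta> \<Longrightarrow> F r = yc K r ^ m * (P (zc j K \<zeta>) / Q (zc j K \<zeta>))"
    by (rule rational_atE[OF rational_at_homogeneous[OF j \<zeta>0 r0 U(2) Ur0 U(3)]]) (rule that)
  have "F r0 \<noteq> 0" using F(2) r0 by (auto simp: nonvanishing_def)
  then have P0: "P (zc j K \<zeta>0) \<noteq> 0" using Q(4)[OF \<zeta>0 Q(3) r0] by auto
  show ?thesis
  proof (rule that[of "\<lambda>a. h a * (P a * Q a)"])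
    fix \<zeta> assume \<zeta>: "\<zeta> \<in> chart j K" "h (zc j K \<zeta>) * (P (zc j K \<zeta>) * Q (zc j K \<zeta>)) \<noteq> 0"
    have \<zeta>p: "\<zeta> \<in> points X" using \<zeta>(1) chart_sub by blast
    have "F r \<noteq> 0" if "r \<in> \<zeta>" for r using Q(4)[OF \<zeta>(1) _ that] \<zeta>(2) chart_mem(2)[OF \<zeta>(1) that] by simp
    moreover have "\<zeta> \<in> D" unfolding U(1)
      using log_quotients_subI[OF \<zeta>p[unfolded points_X] points_some[OF \<zeta>p]] h(3)[OF \<zeta>(1) _ points_some[OF \<zeta>p]] \<zeta>(2) by simp
    ultimately show "\<zeta> \<in> W" using F(3) by (auto simp: nonvanishing_def)
  qed (use h Q P0 in \<open>auto intro!: pol.mult\<close>)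
qed

lemma regular_chart:
  assumes j: "j \<le> n" and \<phi>: "\<phi> \<in> regular X W" and \<zeta>0: "\<zeta>0 \<in> chart j K" "\<zeta>0 \<in> W"
  obtains P Q where "pol idx P" "pol idx Q" "Q (zc j K \<zeta>0) \<noteq> 0"
    "\<And>\<zeta>. \<zeta> \<in> chart j K \<Longrightarrow> \<zeta> \<in> W \<Longrightarrow> Q (zc j K \<zeta>) \<noteq> 0 \<Longrightarrow> \<phi> \<zeta> * Q (zc j K \<zeta>) = P (zc j K \<zeta>)"
proof -
  obtain m D F G where F: "(D, F) \<in> log_symmetric n \<A> m" "(D, G) \<in> log_symmetric n \<A> m" "\<zeta>0 \<in> nonvanishing D G"
    "\<And>\<eta> r. \<eta> \<in> W \<Longrightarrow> \<eta> \<in> nonvanishing D G \<Longrightarrow> r \<in> \<eta> \<Longrightarrow> \<phi> \<eta> = F r / G r"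
    by (rule LS.regularE[OF \<phi> \<zeta>0(2)]) (rule that)
  obtain h where h: "pol idx h" "h (zc j K \<zeta>0) \<noteq> 0"
    "\<And>\<zeta>. \<zeta> \<in> chart j K \<Longrightarrow> h (zc j K \<zeta>) \<noteq> 0 \<Longrightarrow> \<zeta> \<in> nonvanishing D G"
    by (rule open_chart[OF j \<zeta>0(1) LS.zopen_nonvanishing[OF F(2)] F(3)]) (rule that)
  have p: "\<zeta>0 \<in> points X" using \<zeta>0 chart_sub by blast
  define r0 where "r0 = (SOME r. r \<in> \<zeta>0)"
  have r0: "r0 \<in> \<zeta>0" unfolding r0_def by (rule points_some[OF p])
  have rat: "rational_at j K \<zeta>0 m F'" if F': "(D, F') \<in> log_symmetric n \<A> m" for F'
  proof -
    obtain U where U: "D = log_quotients n \<A> U" "pop U" "homogeneous (gens0 U) (gens1 U) m F'"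
      using F' unfolding log_symmetric_iff by blast
    have "fst r0 \<in> U" using log_quotients_mem(1)[OF _ r0] F(3) by (auto simp: U(1) nonvanishing_def)
    then show ?thesis by (rule rational_at_homogeneous[OF j \<zeta>0(1) r0 U(2) _ U(3)])
  qed
  obtain P Q where P: "pol idx P" "pol idx Q" "Q (zc j K \<zeta>0) \<noteq> 0"
    "\<And>\<zeta> r. \<zeta> \<in> chart j K \<Longrightarrow> Q (zc j K \<zeta>) \<noteq> 0 \<Longrightarrow> r \<in> \<zeta> \<Longrightarrow> F r = yc K r ^ m * (P (zc j K \<zeta>) / Q (zc j K \<zeta>))"
    by (rule rational_atE[OF rat[OF F(1)]]) (rule that)
  obtain P' Q' where P': "pol idx P'" "pol idx Q'" "Q' (zc j K \<zeta>0) \<noteq> 0"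
    "\<And>\<zeta> r. \<zeta> \<in> chart j K \<Longrightarrow> Q' (zc j K \<zeta>) \<noteq> 0 \<Longrightarrow> r \<in> \<zeta> \<Longrightarrow> G r = yc K r ^ m * (P' (zc j K \<zeta>) / Q' (zc j K \<zeta>))"
    by (rule rational_atE[OF rat[OF F(2)]]) (rule that)
  have "G r0 \<noteq> 0" using F(3) r0 by (auto simp: nonvanishing_def)
  then have P0: "P' (zc j K \<zeta>0) \<noteq> 0" using P'(4)[OF \<zeta>0(1) P'(3) r0] by auto
  show ?thesis
  \<comment> \<open>Dividing P / Q by P' / Q' gives P Q' / (Q P'). The additional factors
    \<open>Q'\<close> and \<open>h\<close> ensure that all formulas used are valid wherever the new
    denominator is nonzero.\<close>
  proof (rule that[of "\<lambda>a. h a * (P a * Q' a * Q' a)" "\<lambda>a. h a * (Q a * P' a * Q' a)"])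
    fix \<zeta> assume \<zeta>: "\<zeta> \<in> chart j K" "\<zeta> \<in> W" "h (zc j K \<zeta>) * (Q (zc j K \<zeta>) * P' (zc j K \<zeta>) * Q' (zc j K \<zeta>)) \<noteq> 0"
    have r: "(SOME r. r \<in> \<zeta>) \<in> \<zeta>" (is "?r \<in> _") using \<zeta>(1) chart_sub points_some by blast
    have "\<phi> \<zeta> = F ?r / G ?r" using F(4)[OF \<zeta>(2) h(3)[OF \<zeta>(1)] r] \<zeta>(3) by simp
    also have "\<dots> = (P (zc j K \<zeta>) * Q' (zc j K \<zeta>)) / (Q (zc j K \<zeta>) * P' (zc j K \<zeta>))"
      using P(4)[OF \<zeta>(1) _ r] P'(4)[OF \<zeta>(1) _ r] \<zeta>(3) chart_mem(2)[OF \<zeta>(1) r] by simp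
    finally show "\<phi> \<zeta> * (h (zc j K \<zeta>) * (Q (zc j K \<zeta>) * P' (zc j K \<zeta>) * Q' (zc j K \<zeta>))) =
        h (zc j K \<zeta>) * (P (zc j K \<zeta>) * Q' (zc j K \<zeta>) * Q' (zc j K \<zeta>))" using \<zeta>(3) by simp
  qed (use h P P' P0 in \<open>auto intro!: pol.mult\<close>)
qed

lemma pol_regular:
  assumes K: "K \<in> \<A>" and P: "pol idx P"
  shows "(\<lambda>\<zeta>. P (zc j K \<zeta>)) \<in> regular X (chart j K)"
  using P
proof induction
  case (const c)
  show ?case by (rule LS.regular_const[OF chart_sub])
next
  case (var i)
  then consider i' where "i = Inl i'" | H where "i = Inr H" "H \<in> \<A>" by (auto simp: idx_def)
  then show ?case
  proof cases
    case 1
    show ?thesis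
    proof (rule LS.regular_fraction[OF log_symmetric_deg0[OF pop_affine_part coord_reg] log_symmetric_deg0[OF pop_affine_part reg_const[OF affine_part_sub]]])
      show "chart j K \<subseteq> nonvanishing (log_quotients n \<A> (affine_part (cvec j))) (\<lambda>r. 1)"
        by (auto simp: chart_def nonvanishing_def)
      show "zc j K \<zeta> i = coord j i' (fst r) / 1" if "\<zeta> \<in> chart j K" "r \<in> \<zeta>" for \<zeta> r
        using zc_eq(1)[OF subsetD[OF chart_sub that(1)] that(2)] 1 by simp
    qed
  next
    case 2
    show ?thesis
    proof (rule LS.regular_fraction[OF log_symmetric_yc[OF pop_affine_part 2(2)] log_symmetric_yc[OF pop_affine_part K]])
      show "chart j K \<subseteq> nonvanishing (log_quotients n \<A> (affine_part (cvec j))) (yc K)"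
        by (simp add: chart_def)
      show "zc j K \<zeta> i = yc H r / yc K r" if "\<zeta> \<in> chart j K" "r \<in> \<zeta>" for \<zeta> r
        using zc_eq(2)[OF subsetD[OF chart_sub that(1)] that(2)] 2 by simp
    qed
  qed
qed (auto intro: LS.regular_add LS.regular_mult)

lemma in_chart:
  assumes "\<zeta> \<in> points X"
  obtains j K where "j \<le> n" "K \<in> \<A>" "\<zeta> \<in> chart j K"
proof -
  have r: "(SOME r. r \<in> \<zeta>) \<in> \<zeta>" (is "?r \<in> _") by (rule points_some[OF assms])
  obtain j where j: "j \<le> n" "fst ?r \<in> affine_part (cvec j)" by (rule in_affine_part[OF points_mem(1)[OF assms r]])
  \<comment> \<open>Otherwise the functional would vanish on all \<open>om H\<close>, and
    \<open>dual_determined\<close> would make it zero.\<close>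
  obtain K where "K \<in> \<A>" "snd ?r (om K) \<noteq> 0"
    using dual_determined[OF points_mem(1,2)[OF assms r]] points_mem(3)[OF assms r] by blast
  then show ?thesis using that[OF j(1) _ chartI[OF assms r j(2)]] by (simp add: yc_def)
qed

section \<open>Separation of points over the complement\<close>

text \<open>The products w' v and w v' of linear forms on the dual space agree on the arrangement,
  both being \<open>Y H\<close> times the product of the values of v and v'; so they agree
  identically. Comparing coefficients replaces unique factorisation: \<open>v' j = 0\<close> forces
  \<open>w' j = 0\<close>, then w' = c v', and finally the product of v' with the nonzero vector w -
  c v is zero. The condition \<open>v' j = 0\<close> removes the evident solutions, the multiples of
  (v, w).\<close>

lemma quadric_kernel:
  assumes quad: "\<forall>Q. hom_poly n 2 Q \<longrightarrow> (\<forall>H\<in>\<A>. \<forall>a\<in>H. Q a = 0) \<longrightarrow> (\<forall>a\<in>vecs n. Q a = 0)"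
    and Y: "\<And>H. H \<in> \<A> \<Longrightarrow> eqn n H w = Y H * eqn n H v" "\<And>H. H \<in> \<A> \<Longrightarrow> eqn n H w' = Y H * eqn n H v'"
    and j: "j \<le> n" "v j \<noteq> 0" "v' j = 0" and indep: "\<And>c. \<exists>i\<le>n. w i \<noteq> c * v i"
    and i: "i \<le> n"
  shows "v' i = 0" "w' i = 0"
proof -
  define Q where "Q = (\<lambda>a. lin n w' a * lin n v a - lin n w a * lin n v' a)"
  have Q: "hom_poly n 2 Q"
  proof -
    have "homogeneous {\<lambda>_. c |c. True} {\<lambda>v. v i |i. i \<le> n} (1 + 1) (\<lambda>a. lin n w' a * lin n v a - lin n w a * lin n v' a)"
      by (intro homogeneous_diff homogeneous.mult hom_poly_lin[unfolded hom_poly_def]) auto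
    then show ?thesis by (simp add: Q_def hom_poly_def numeral_2_eq_2)
  qed
  have "\<forall>H\<in>\<A>. \<forall>a\<in>H. Q a = 0"
  proof (intro ballI)
    fix H a assume H: "H \<in> \<A>" and a: "a \<in> H"
    obtain c where c: "\<And>u. lin n a u = c * eqn n H u" using lin_mem_proj_points[OF subsetD[OF arr(1) H] a] by auto
    have "lin n u a = c * eqn n H u" for u using c[of u] lin_commute[of n a u] by simp
    then show "Q a = 0" unfolding Q_def by (simp add: Y[OF H])
  qed
  then have Q0: "Q a = 0" if "a \<in> vecs n" for a using quad Q that by blast
  \<comment> \<open>Polarisation: \<open>Q\<close> vanishes at two unit vectors and at their
    sum.\<close>
  have cross: "w' i * v k + w' k * v i = w i * v' k + w k * v' i" if "i \<le> n" "k \<le> n" for i k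
  proof -
    have l: "lin n b (\<lambda>x. cvec i x + cvec k x) = b i + b k" "lin n b (cvec i) = b i" "lin n b (cvec k) = b k" for b
      using lin_line[of n b "cvec i" 1 "cvec k"] lin_cvec[OF that(1), of b] lin_cvec[OF that(2), of b]
      by (simp_all add: lin_commute[of n b])
    have "Q (\<lambda>x. cvec i x + cvec k x) = 0" "Q (cvec i) = 0" "Q (cvec k) = 0"
      using that by (auto intro!: Q0 simp: vecs_def)
    then have "(w' i + w' k) * (v i + v k) - (w i + w k) * (v' i + v' k) = 0" "w' i * v i - w i * v' i = 0"
      "w' k * v k - w k * v' k = 0" unfolding Q_def l by simp_all
    then show ?thesis by (simp add: algebra_simps)
  qed
  have w'j: "w' j = 0" using cross[OF j(1) j(1)] j by simp
  define c where "c = w j / v j"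
  have w': "w' i = c * v' i" if "i \<le> n" for i
    using cross[OF that j(1)] j w'j by (simp add: c_def field_simps)
  have prod: "v' i * (w k - c * v k) + v' k * (w i - c * v i) = 0" if "i \<le> n" "k \<le> n" for i k
    using cross[OF that] unfolding w'[OF that(1)] w'[OF that(2)] by (simp add: algebra_simps)
  obtain k where k: "k \<le> n" "w k - c * v k \<noteq> 0" using indep[of c] by auto
  have "v' k = 0" using prod[OF k(1) k(1)] k(2) by simp
  then show "v' i = 0" using prod[OF i k(1)] k(2) by simp
  then show "w' i = 0" using w'[OF i] by simp
qed

section \<open>Polynomials in the global coordinates\<close>

abbreviation "consts_Y \<equiv> {\<lambda>_. c | c. True} :: (vec set \<times> (form \<Rightarrow> complex) \<Rightarrow> complex) set"

text \<open>In contrast to general elements of \<open>log_symmetric\<close>, these are defined on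
  the whole bundle: they are global sections of the \<open>q\<close>-th power of O(1).\<close>

definition hom_Y :: "nat \<Rightarrow> (vec set \<times> (form \<Rightarrow> complex) \<Rightarrow> complex) \<Rightarrow> bool" where
  "hom_Y q F \<longleftrightarrow> homogeneous consts_Y (yc ` \<A>) q F"

lemma hom_Y_const: "hom_Y 0 (\<lambda>_. c)"
  unfolding hom_Y_def by (rule homogeneous.degree_zero) blast

lemma hom_Y_yc: "H \<in> \<A> \<Longrightarrow> hom_Y 1 (yc H)"
  unfolding hom_Y_def by (rule homogeneous.degree_one) blast

lemma hom_Y_mult: "hom_Y m F \<Longrightarrow> hom_Y k G \<Longrightarrow> hom_Y (m + k) (\<lambda>r. F r * G r)"
  unfolding hom_Y_def by (rule homogeneous.mult)

lemma hom_Y_add: "hom_Y m F \<Longrightarrow> hom_Y m G \<Longrightarrow> hom_Y m (\<lambda>r. F r + G r)"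
  unfolding hom_Y_def by (rule homogeneous.add)

lemma hom_Y_power: "hom_Y m F \<Longrightarrow> hom_Y (k * m) (\<lambda>r. F r ^ k)"
  unfolding hom_Y_def by (rule homogeneous_power) auto

lemma hom_Y_chart:
  assumes "hom_Y q F" "K \<in> \<A>"
  shows "\<exists>P. pol idx P \<and> (\<forall>\<zeta>\<in>chart j K. \<forall>r\<in>\<zeta>. F r = yc K r ^ q * P (zc j K \<zeta>))"
  using assms(1) unfolding hom_Y_def
proof induction
  case (degree_zero c)
  then obtain k where "c = (\<lambda>_. k)" by blast
  then show ?case by (intro exI[of _ "\<lambda>_. k"]) (auto intro: pol.const)
next
  case (degree_one g)
  then obtain H where H: "H \<in> \<A>" "g = yc H" by blast
  have "yc H r = yc K r ^ 1 * zc j K \<zeta> (Inr H)" if "\<zeta> \<in> chart j K" "r \<in> \<zeta>" for \<zeta> r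
    using chart_mem(2)[OF that] zc_eq(2)[OF subsetD[OF chart_sub that(1)] that(2)] by simp
  then show ?case using H by (intro exI[of _ "\<lambda>a. a (Inr H)"]) (auto intro: pol_Inr)
next
  case (add m F F')
  from add.IH(1) obtain P where P: "pol idx P" "\<And>\<zeta> r. \<zeta> \<in> chart j K \<Longrightarrow> r \<in> \<zeta> \<Longrightarrow> F r = yc K r ^ m * P (zc j K \<zeta>)" by auto
  from add.IH(2) obtain P' where P': "pol idx P'" "\<And>\<zeta> r. \<zeta> \<in> chart j K \<Longrightarrow> r \<in> \<zeta> \<Longrightarrow> F' r = yc K r ^ m * P' (zc j K \<zeta>)" by auto
  show ?case by (rule exI[of _ "\<lambda>a. P a + P' a"]) (auto simp: P(2) P'(2) distrib_left intro: pol.add P(1) P'(1))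
next
  case (mult m F k F')
  from mult.IH(1) obtain P where P: "pol idx P" "\<And>\<zeta> r. \<zeta> \<in> chart j K \<Longrightarrow> r \<in> \<zeta> \<Longrightarrow> F r = yc K r ^ m * P (zc j K \<zeta>)" by auto
  from mult.IH(2) obtain P' where P': "pol idx P'" "\<And>\<zeta> r. \<zeta> \<in> chart j K \<Longrightarrow> r \<in> \<zeta> \<Longrightarrow> F' r = yc K r ^ k * P' (zc j K \<zeta>)" by auto
  show ?case by (rule exI[of _ "\<lambda>a. P a * P' a"]) (auto simp: P(2) P'(2) power_add intro: pol.mult P(1) P'(1))
qed

text \<open>Row \<open>H\<close> of the matrix of the linear system; the columns
  \<open>Inl i\<close> belong to the coordinates of \<open>v\<close>, the columns
  \<open>Inr i\<close> to those of \<open>w\<close>.\<close>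

abbreviation rows :: "vec set \<Rightarrow> nat + nat \<Rightarrow> vec set \<times> (form \<Rightarrow> complex) \<Rightarrow> complex" where
  "rows H c r \<equiv> case_sum (\<lambda>i. - (SOME a. a \<in> H) i * yc H r) (\<lambda>i. (SOME a. a \<in> H) i) c"

lemma rows_sum:
  "(\<Sum>c\<in>Inl ` {..n} \<union> Inr ` {..n}. rows H c r * x c) = eqn n H (\<lambda>i. x (Inr i)) - yc H r * eqn n H (\<lambda>i. x (Inl i))"
proof -
  have "(\<Sum>c\<in>Inl ` {..n} \<union> Inr ` {..n}. rows H c r * x c) = (\<Sum>c\<in>Inl ` {..n}. rows H c r * x c) + (\<Sum>c\<in>Inr ` {..n}. rows H c r * x c)"
    by (rule sum.union_disjoint) auto
  also have "\<dots> = (\<Sum>i\<le>n. rows H (Inl i) r * x (Inl i)) + (\<Sum>i\<le>n. rows H (Inr i) r * x (Inr i))"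
    by (simp add: sum.reindex)
  also have "\<dots> = eqn n H (\<lambda>i. x (Inr i)) - yc H r * eqn n H (\<lambda>i. x (Inl i))"
    by (simp add: eqn_def lin_def sum_distrib_left sum_negf algebra_simps)
  finally show ?thesis .
qed

text \<open>Near a point over the complement, the base point is a rational function of the functional:
  solving the linear system \<open>eqn n H w = Y H * eqn n H v\<close> for \<open>v\<close> and \<open>w\<close>.\<close>

lemma base_point_elimination:
  assumes j: "j \<le> n" and i: "i \<le> n" and K: "K \<in> \<A>" "yc K r0 \<noteq> 0"
    and kernel: "\<And>v' w'. (\<And>H. H \<in> \<A> \<Longrightarrow> eqn n H w' = yc H r0 * eqn n H v') \<Longrightarrow> v' j = 0 \<Longrightarrow> (\<forall>i\<le>n. v' i = 0 \<and> w' i = 0)"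
  shows "\<exists>m \<alpha> \<beta>. hom_Y m \<alpha> \<and> hom_Y m \<beta> \<and> \<alpha> r0 \<noteq> 0 \<and>
    (\<forall>r v w. (\<forall>H\<in>\<A>. eqn n H w = yc H r * eqn n H v) \<longrightarrow> \<alpha> r * v i = \<beta> r * v j)"
proof (cases "i = j")
  case True
  \<comment> \<open>The relation is trivial here; \<open>yc K\<close> is taken as a coefficient that
    does not vanish at \<open>r0\<close>.\<close>
  show ?thesis
    by (rule exI[of _ 1], rule exI[of _ "yc K"], rule exI[of _ "yc K"]) (use K hom_Y_yc[OF K(1)] True in auto)
next
  case False
  define full :: "(nat + nat) set" where "full = Inl ` {..n} \<union> Inr ` {..n}"
  define J where "J = full - {Inl i, Inl j}"
  have ins: "insert (Inl i) (insert (Inl j) J) = full" using i j by (auto simp: J_def full_def)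
  \<comment> \<open>Column weights: the entries in the columns of \<open>v\<close> are linear in
    \<open>Y\<close>, those in the columns of \<open>w\<close> are constants. As
    \<open>Inl i\<close> and \<open>Inl j\<close> both have weight 1, the two coefficients receive
    the same degree \<open>m + 1\<close>.\<close>
  define e :: "nat + nat \<Rightarrow> nat" where "e = case_sum (\<lambda>_. 1) (\<lambda>_. 0)"
  have hom: "homogeneous consts_Y (yc ` \<A>) (0 + e c) (rows H c)" if "H \<in> \<A>" for H c
  proof (cases c)
    case (Inl k)
    have "homogeneous consts_Y (yc ` \<A>) 1 (\<lambda>r. - (SOME a. a \<in> H) k * yc H r)"
      using homogeneous_scale[OF homogeneous.degree_one[of "yc H" "yc ` \<A>" consts_Y], of "- (SOME a. a \<in> H) k"] that by auto
    then show ?thesis by (simp add: Inl e_def)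
  next
    case (Inr k)
    have "homogeneous consts_Y (yc ` \<A>) 0 (\<lambda>r. (SOME a. a \<in> H) k)" by (rule homogeneous.degree_zero) blast
    then show ?thesis by (simp add: Inr e_def)
  qed
  have "\<exists>m \<alpha> \<beta>. homogeneous consts_Y (yc ` \<A>) (m + e (Inl i)) \<alpha> \<and> homogeneous consts_Y (yc ` \<A>) (m + e (Inl j)) \<beta> \<and> \<alpha> r0 \<noteq> 0 \<and>
           (\<forall>p x. (\<forall>H\<in>\<A>. (\<Sum>c\<in>insert (Inl i) (insert (Inl j) J). rows H c p * x c) = 0) \<longrightarrow> \<alpha> p * x (Inl i) = \<beta> p * x (Inl j))"
  proof (rule homogeneous_elimination[where r = "\<lambda>_. 0"])
    show "\<forall>c\<in>insert (Inl i) J. x c = 0"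
      if x: "\<And>H. H \<in> \<A> \<Longrightarrow> (\<Sum>c\<in>insert (Inl i) (insert (Inl j) J). rows H c r0 * x c) = 0" "x (Inl j) = 0" for x
    proof -
      have "\<forall>i\<le>n. x (Inl i) = 0 \<and> x (Inr i) = 0"
      proof (rule kernel)
        show "eqn n H (\<lambda>i. x (Inr i)) = yc H r0 * eqn n H (\<lambda>i. x (Inl i))" if "H \<in> \<A>" for H
          using x(1)[OF that] unfolding ins full_def rows_sum by simp
      qed (rule x(2))
      then show ?thesis using i by (auto simp: J_def full_def)
    qed
  qed (use False hom in \<open>auto simp: J_def full_def\<close>)
  then obtain m \<alpha> \<beta> where m: "hom_Y (m + e (Inl i)) \<alpha>" "hom_Y (m + e (Inl j)) \<beta>" "\<alpha> r0 \<noteq> 0"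
    "\<And>p x. (\<forall>H\<in>\<A>. (\<Sum>c\<in>full. rows H c p * x c) = 0) \<Longrightarrow> \<alpha> p * x (Inl i) = \<beta> p * x (Inl j)"
    unfolding ins hom_Y_def by auto
  have "\<alpha> r * v i = \<beta> r * v j" if "\<forall>H\<in>\<A>. eqn n H w = yc H r * eqn n H v" for r v w
    using m(4)[of r "case_sum v w"] that unfolding full_def rows_sum by simp
  then show ?thesis using m(1-3) by (intro exI[of _ "m + 1"] exI[of _ \<alpha>] exI[of _ \<beta>]) (simp add: e_def)
qed

text \<open>A variable of the first kind needs a factor \<open>A\<close>, one of the second kind a
  factor \<open>yc K\<close>. Clearing both with \<open>A * yc K\<close>, of degree
  \<open>m + 1\<close>, keeps the degrees uniform.\<close>

lemma homogenise:
  assumes A: "hom_Y m A" and \<Delta>: "\<And>i. i \<le> n \<Longrightarrow> hom_Y m (\<Delta> i)" and K: "K \<in> \<A>" and P: "pol idx P"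
  shows "\<exists>k G. hom_Y (k * (m + 1)) G \<and> (\<forall>r. A r \<noteq> 0 \<longrightarrow> yc K r \<noteq> 0 \<longrightarrow>
    G r = (A r * yc K r) ^ k * P (case_sum (\<lambda>i. \<Delta> i r / A r) (\<lambda>H. yc H r / yc K r)))"
  using P
proof induction
  case (const c)
  show ?case by (rule exI[of _ 0], rule exI[of _ "\<lambda>_. c"]) (use hom_Y_const in simp)
next
  case (var c)
  then consider i where "c = Inl i" "i \<le> n" | H where "c = Inr H" "H \<in> \<A>" by (auto simp: idx_def)
  then show ?case
  proof cases
    case 1
    show ?thesis
      by (rule exI[of _ 1], rule exI[of _ "\<lambda>r. \<Delta> i r * yc K r"])
         (use hom_Y_mult[OF \<Delta>[OF 1(2)] hom_Y_yc[OF K]] 1 in simp)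
  next
    case 2
    show ?thesis
      by (rule exI[of _ 1], rule exI[of _ "\<lambda>r. A r * yc H r"])
         (use hom_Y_mult[OF A hom_Y_yc[OF 2(2)]] 2 in simp)
  qed
next
  case (add P Q)
  let ?z = "\<lambda>r. case_sum (\<lambda>i. \<Delta> i r / A r) (\<lambda>H. yc H r / yc K r)"
  from add.IH(1) obtain k G where G: "hom_Y (k * (m + 1)) G"
    "\<And>r. A r \<noteq> 0 \<Longrightarrow> yc K r \<noteq> 0 \<Longrightarrow> G r = (A r * yc K r) ^ k * P (?z r)" by auto
  from add.IH(2) obtain l G' where G': "hom_Y (l * (m + 1)) G'"
    "\<And>r. A r \<noteq> 0 \<Longrightarrow> yc K r \<noteq> 0 \<Longrightarrow> G' r = (A r * yc K r) ^ l * Q (?z r)" by auto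
  have pw: "hom_Y (k * (m + 1)) (\<lambda>r. (A r * yc K r) ^ k)" for k
    by (rule hom_Y_power[OF hom_Y_mult[OF A hom_Y_yc[OF K]]])
  have "hom_Y (l * (m + 1) + k * (m + 1)) (\<lambda>r. (A r * yc K r) ^ l * G r)"
    "hom_Y (k * (m + 1) + l * (m + 1)) (\<lambda>r. (A r * yc K r) ^ k * G' r)"
    by (rule hom_Y_mult[OF pw G(1)], rule hom_Y_mult[OF pw G'(1)])
  then have "hom_Y ((k + l) * (m + 1)) (\<lambda>r. (A r * yc K r) ^ l * G r + (A r * yc K r) ^ k * G' r)"
    by (intro hom_Y_add) (simp_all only: distrib_right add.commute)
  then show ?case
    by (intro exI[of _ "k + l"] exI[of _ "\<lambda>r. (A r * yc K r) ^ l * G r + (A r * yc K r) ^ k * G' r"])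
       (auto simp: G(2) G'(2) power_add algebra_simps)
next
  case (mult P Q)
  let ?z = "\<lambda>r. case_sum (\<lambda>i. \<Delta> i r / A r) (\<lambda>H. yc H r / yc K r)"
  from mult.IH(1) obtain k G where G: "hom_Y (k * (m + 1)) G"
    "\<And>r. A r \<noteq> 0 \<Longrightarrow> yc K r \<noteq> 0 \<Longrightarrow> G r = (A r * yc K r) ^ k * P (?z r)" by auto
  from mult.IH(2) obtain l G' where G': "hom_Y (l * (m + 1)) G'"
    "\<And>r. A r \<noteq> 0 \<Longrightarrow> yc K r \<noteq> 0 \<Longrightarrow> G' r = (A r * yc K r) ^ l * Q (?z r)" by auto
  have "hom_Y ((k + l) * (m + 1)) (\<lambda>r. G r * G' r)"
    using hom_Y_mult[OF G(1) G'(1)] by (simp only: distrib_right)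
  then show ?case
    by (intro exI[of _ "k + l"] exI[of _ "\<lambda>r. G r * G' r"]) (auto simp: G(2) G'(2) power_add algebra_simps)
qed

lemma hom_Y_prod:
  assumes "finite B" "\<And>i. i \<in> B \<Longrightarrow> hom_Y (m i) (F i)"
  shows "hom_Y (sum m B) (\<lambda>r. \<Prod>i\<in>B. F i r)"
  using homogeneous_prod[OF assms(1), of consts_Y "yc ` \<A>" m F] assms(2) unfolding hom_Y_def by auto

text \<open>Near \<xi> the base coordinates are fractions \<Delta> i / A of polynomials in the
  \<open>yc H\<close>. They are substituted into a polynomial whose nonvanishing on the chart
  implies membership in \<open>W\<close>; clearing denominators then yields a global
  \<open>F\<close>.\<close>

lemma separating_section:
  assumes quad: "\<forall>Q. hom_poly n 2 Q \<longrightarrow> (\<forall>H\<in>\<A>. \<forall>a\<in>H. Q a = 0) \<longrightarrow> (\<forall>a\<in>vecs n. Q a = 0)"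
    and \<xi>: "\<xi> \<in> points X" and out: "\<And>r. r \<in> \<xi> \<Longrightarrow> fst r \<notin> arr_union n \<A>"
    and W: "zopen X W" "\<xi> \<in> W"
  shows "\<exists>q F. hom_Y q F \<and> (\<forall>r\<in>\<xi>. F r \<noteq> 0) \<and> (\<forall>\<zeta>\<in>points X. \<forall>r\<in>\<zeta>. F r \<noteq> 0 \<longrightarrow> \<zeta> \<in> W)"
proof -
  define r0 where "r0 = (SOME r. r \<in> \<xi>)"
  have r0: "r0 \<in> \<xi>" unfolding r0_def by (rule points_some[OF \<xi>])
  obtain j K where jK: "j \<le> n" "K \<in> \<A>" "\<xi> \<in> chart j K" by (rule in_chart[OF \<xi>])
  have K: "yc K r0 \<noteq> 0" by (rule chart_mem(2)[OF jK(3) r0])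
  obtain v where v: "fst r0 = pclass v" "v \<in> vecs n" "v j = 1"
    by (rule normalised_representative[OF chart_mem(1)[OF jK(3) r0] jK(1)])
  define w where "w = tangent v (\<lambda>H. yc H r0)"
  have relation: "eqn n H (tangent u (\<lambda>H. yc H r)) = yc H r * eqn n H u"
    if "\<zeta> \<in> points X" "r \<in> \<zeta>" "fst r = pclass u" "H \<in> \<A>" for \<zeta> r u H
    using dual_relation[OF _ _ that(4), of u "snd r"] points_mem(1,2)[OF that(1,2)] that(3)
    by (simp add: yc_def mult.commute)
  have nz: "eqn n H v \<noteq> 0" if "H \<in> \<A>" for H
    using eqn_nonzero[OF that _ pop_proj_points, of v] out[OF r0] points_mem(1)[OF \<xi> r0] v(1) by simp
  have indep: "\<exists>i\<le>n. w i \<noteq> c * v i" for c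
  \<comment> \<open>If \<open>w\<close> were \<open>c\<close> times \<open>v\<close>, all
    \<open>yc H r0\<close> would equal \<open>c\<close>, since no \<open>eqn n H v\<close> vanishes
    off the arrangement. The normalisation at \<open>H0\<close> gives \<open>c = 0\<close>, but
    \<open>yc K r0\<close> is nonzero.\<close>
  proof (rule ccontr)
    assume "\<not> ?thesis"
    then have "w i = c * v i" for i
      using v(2) tangent_vecs[of v] by (cases "i \<le> n") (auto simp: w_def vecs_def)
    then have "w = (\<lambda>i. c * v i)" by blast
    then have Yc: "yc H r0 = c" if "H \<in> \<A>" for H
      using relation[OF \<xi> r0 v(1) that] nz[OF that] by (simp add: w_def[symmetric] eqn_scale)
    have "yc H0 r0 = 0" using dual_zero[OF points_mem(2,1)[OF \<xi> r0]] by (simp add: yc_def om_H0)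
    then show False using Yc[OF arr(3)] Yc[OF jK(2)] K by simp
  qed
  have kernel: "\<forall>i\<le>n. v' i = 0 \<and> w' i = 0"
    if "\<And>H. H \<in> \<A> \<Longrightarrow> eqn n H w' = yc H r0 * eqn n H v'" "v' j = 0" for v' w'
  proof (intro allI impI)
    fix i assume i: "i \<le> n"
    have "v j \<noteq> 0" using v(3) by simp
    then show "v' i = 0 \<and> w' i = 0"
      using quadric_kernel[where Y = "\<lambda>H. yc H r0" and v = v and w = w and v' = v' and w' = w' and j = j,
        OF quad relation[OF \<xi> r0 v(1), folded w_def] that(1) jK(1) _ that(2) indep i] by simp
  qed
  have "\<forall>i\<in>{..n}. \<exists>m \<alpha> \<beta>. hom_Y m \<alpha> \<and> hom_Y m \<beta> \<and> \<alpha> r0 \<noteq> 0 \<and>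
    (\<forall>r v w. (\<forall>H\<in>\<A>. eqn n H w = yc H r * eqn n H v) \<longrightarrow> \<alpha> r * v i = \<beta> r * v j)"
    using base_point_elimination[OF jK(1) _ jK(2) K kernel] by simp
  then obtain m \<alpha> \<beta> where *: "\<forall>i\<in>{..n}. hom_Y (m i) (\<alpha> i) \<and> hom_Y (m i) (\<beta> i) \<and> \<alpha> i r0 \<noteq> 0 \<and>
    (\<forall>r v w. (\<forall>H\<in>\<A>. eqn n H w = yc H r * eqn n H v) \<longrightarrow> \<alpha> i r * v i = \<beta> i r * v j)"
    unfolding bchoice_iff by (elim exE) (rule that)
  have \<alpha>: "hom_Y (m i) (\<alpha> i)" "hom_Y (m i) (\<beta> i)" "\<alpha> i r0 \<noteq> 0"
    "\<forall>r v w. (\<forall>H\<in>\<A>. eqn n H w = yc H r * eqn n H v) \<longrightarrow> \<alpha> i r * v i = \<beta> i r * v j" if "i \<le> n" for i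
    using bspec[OF *, of i] that by auto
  \<comment> \<open>The fractions \<beta> i / \<alpha> i are brought to a common denominator, so
    that all numerators have the degree \<open>M\<close> of \<open>A\<close>.\<close>
  define A where "A r = (\<Prod>i\<le>n. \<alpha> i r)" for r
  define \<Delta> where "\<Delta> i r = \<beta> i r * (\<Prod>i'\<in>{..n} - {i}. \<alpha> i' r)" for i r
  define M where "M = (\<Sum>i\<le>n. m i)"
  have A: "hom_Y M A" unfolding M_def A_def[abs_def] by (rule hom_Y_prod) (auto intro: \<alpha>)
  have \<Delta>: "hom_Y M (\<Delta> i)" if "i \<le> n" for i
  proof -
    have "hom_Y (m i + sum m ({..n} - {i})) (\<Delta> i)"
      unfolding \<Delta>_def[abs_def] using that by (intro hom_Y_mult hom_Y_prod \<alpha>) auto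
    then show ?thesis unfolding M_def using that by (simp add: sum.remove[of "{..n}" i m])
  qed
  have A0: "A r0 \<noteq> 0" unfolding A_def using \<alpha>(3) by simp
  have proportional: "\<Delta> i r * u j = A r * u i"
    if "\<zeta> \<in> points X" "r \<in> \<zeta>" "fst r = pclass u" "i \<le> n" for \<zeta> r u i
  proof -
    have "\<alpha> i r * u i = \<beta> i r * u j" using \<alpha>(4)[OF that(4), rule_format, of "tangent u (\<lambda>H. yc H r)" r u] relation[OF that(1-3)] by simp
    then have "\<Delta> i r * u j = (\<Prod>i'\<in>{..n} - {i}. \<alpha> i' r) * (\<alpha> i r * u i)" by (simp add: \<Delta>_def)
    also have "\<dots> = A r * u i" unfolding A_def using that(4) by (simp add: prod.remove[of "{..n}" i])
    finally show ?thesis .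
  qed
  \<comment> \<open>Where \<open>A\<close> is nonzero, a vanishing coordinate \<open>u j\<close>
    would make all coordinates of \<open>u\<close> vanish. So this locus lies over the patch
    \<open>j\<close>, and \<Delta> i / A are the coordinates there.\<close>
  have base: "fst r \<in> affine_part (cvec j) \<and> (\<forall>i\<le>n. coord j i (fst r) = \<Delta> i r / A r)"
    if \<zeta>: "\<zeta> \<in> points X" "r \<in> \<zeta>" and Ar: "A r \<noteq> 0" for \<zeta> r
  proof -
    obtain u where u: "fst r = pclass u" "u \<in> vecs n" "u \<noteq> (\<lambda>_. 0)" using points_mem(1)[OF \<zeta>] by (auto simp: proj_points_def)
    have "u j \<noteq> 0"
    proof
      assume "u j = 0"
      then have "u i = 0" if "i \<le> n" for i using proportional[OF \<zeta> u(1) that] Ar by simp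
      then have "u = (\<lambda>_. 0)" using u(2) by (intro ext) (metis (mono_tags, lifting) mem_Collect_eq not_le vecs_def)
      then show False using u(3) by simp
    qed
    then show ?thesis using u jK(1) proportional[OF \<zeta> u(1)] Ar
      by (auto simp: mem_affine_part lin_cvec coord_pclass field_simps)
  qed
  obtain P where P: "pol idx P" "P (zc j K \<xi>) \<noteq> 0" "\<And>\<zeta>. \<zeta> \<in> chart j K \<Longrightarrow> P (zc j K \<zeta>) \<noteq> 0 \<Longrightarrow> \<zeta> \<in> W"
    by (rule open_chart[OF jK(1,3) W]) (rule that)
  obtain k G where G: "hom_Y (k * (M + 1)) G"
    "\<And>r. A r \<noteq> 0 \<Longrightarrow> yc K r \<noteq> 0 \<Longrightarrow> G r = (A r * yc K r) ^ k * P (case_sum (\<lambda>i. \<Delta> i r / A r) (\<lambda>H. yc H r / yc K r))"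
    using homogenise[of M A \<Delta> K P, OF A \<Delta> jK(2) P(1)] by auto
  have GP: "G r = (A r * yc K r) ^ k * P (zc j K \<zeta>)"
    if "\<zeta> \<in> points X" "r \<in> \<zeta>" "A r \<noteq> 0" "yc K r \<noteq> 0" for \<zeta> r
  proof -
    have "P (case_sum (\<lambda>i. \<Delta> i r / A r) (\<lambda>H. yc H r / yc K r)) = P (zc j K \<zeta>)"
      by (rule pol_cong[OF P(1)]) (use base[OF that(1-3)] zc_eq[OF that(1,2)] in \<open>auto simp: idx_def\<close>)
    then show ?thesis using G(2)[OF that(3,4)] by simp
  qed
  \<comment> \<open>The added factor makes nonvanishing of \<open>F\<close> imply that of
    \<open>A\<close> and \<open>yc K\<close>; where one of these is zero, the formula for
    \<open>G\<close> gives no information.\<close>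
  define F where "F = (\<lambda>r. G r * (A r * yc K r))"
  have F: "hom_Y (k * (M + 1) + (M + 1)) F"
    unfolding F_def by (intro hom_Y_mult G A hom_Y_yc jK)
  have "F r0 \<noteq> 0" unfolding F_def using GP[OF \<xi> r0 A0 K] P(2) A0 K by simp
  moreover obtain P' where "\<And>r. r \<in> \<xi> \<Longrightarrow> F r = yc K r ^ (k * (M + 1) + (M + 1)) * P' (zc j K \<xi>)"
    using hom_Y_chart[OF F jK(2), of j] jK(3) by blast
  ultimately have "\<forall>r\<in>\<xi>. F r \<noteq> 0" using r0 chart_mem(2)[OF jK(3)] by auto
  moreover have "\<zeta> \<in> W" if \<zeta>: "\<zeta> \<in> points X" "r \<in> \<zeta>" and "F r \<noteq> 0" for \<zeta> r
  proof -
    have nz: "A r \<noteq> 0" "yc K r \<noteq> 0" "G r \<noteq> 0" using that(3) by (auto simp: F_def)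
    then have "P (zc j K \<zeta>) \<noteq> 0" using GP[OF \<zeta>] by auto
    moreover have "\<zeta> \<in> chart j K" using chartI[OF \<zeta> _ nz(2)] base[OF \<zeta> nz(1)] by blast
    ultimately show ?thesis using P(3) by blast
  qed
  ultimately show ?thesis using F by blast
qed

section \<open>Extending sections\<close>

lemma zopen_nonzero:
  assumes U: "zopen X U" and \<phi>: "\<phi> \<in> regular X U"
  shows "zopen X {\<zeta> \<in> U. \<phi> \<zeta> \<noteq> 0}"
proof (subst openin_subopen, intro ballI)
  fix \<xi> assume "\<xi> \<in> {\<zeta> \<in> U. \<phi> \<zeta> \<noteq> 0}"
  then have \<xi>: "\<xi> \<in> U" "\<phi> \<xi> \<noteq> 0" by auto
  obtain m D F G where F: "(D, F) \<in> log_symmetric n \<A> m" "(D, G) \<in> log_symmetric n \<A> m" "\<xi> \<in> nonvanishing D G"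
    "\<And>\<eta> r. \<eta> \<in> U \<Longrightarrow> \<eta> \<in> nonvanishing D G \<Longrightarrow> r \<in> \<eta> \<Longrightarrow> \<phi> \<eta> = F r / G r"
    by (rule LS.regularE[OF \<phi> \<xi>(1)]) (rule that)
  define T where "T = U \<inter> nonvanishing D (\<lambda>r. F r * G r)"
  have T: "zopen X T" unfolding T_def by (intro openin_Int U LS.zopen_nonvanishing[OF LS.mult'[OF F(1,2)]])
  have "F r \<noteq> 0" if "r \<in> \<xi>" for r using F(4)[OF \<xi>(1) F(3) that] \<xi>(2) by auto
  then have "\<xi> \<in> T" using F(3) \<xi>(1) by (simp add: T_def nonvanishing_def)
  moreover have "T \<subseteq> {\<zeta> \<in> U. \<phi> \<zeta> \<noteq> 0}"
  proof
    fix \<zeta> assume \<zeta>: "\<zeta> \<in> T"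
    then have U\<zeta>: "\<zeta> \<in> U" "\<zeta> \<in> nonvanishing D G" by (auto simp: T_def nonvanishing_def)
    have r: "(SOME r. r \<in> \<zeta>) \<in> \<zeta>" using openin_subset[OF U] U\<zeta>(1) by (intro points_some) blast
    have "F (SOME r. r \<in> \<zeta>) * G (SOME r. r \<in> \<zeta>) \<noteq> 0" using \<zeta> r by (simp add: T_def nonvanishing_def)
    then show "\<zeta> \<in> {\<zeta> \<in> U. \<phi> \<zeta> \<noteq> 0}" using F(4)[OF U\<zeta> r] U\<zeta>(1) by simp
  qed
  ultimately show "\<exists>T. zopen X T \<and> \<xi> \<in> T \<and> T \<subseteq> {\<zeta> \<in> U. \<phi> \<zeta> \<noteq> 0}" using T by blast
qed

lemma homogeneous_fibre_scale:
  assumes "homogeneous (gens0 U) (gens1 U) m F" "fst r' = fst r" "\<And>\<omega>. snd r' \<omega> = c * snd r \<omega>"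
  shows "F r' = c ^ m * F r"
  using assms(1)
proof induction
  case (degree_zero g)
  then obtain f where "g = (\<lambda>(x, l). f x)" by blast
  then show ?case using assms(2) by (simp add: case_prod_beta)
next
  case (degree_one g)
  then obtain \<omega> where "g = (\<lambda>(x, l). l \<omega>)" by blast
  then show ?case using assms(3) by (simp add: case_prod_beta)
qed (simp_all add: distrib_left power_add)

text \<open>Changing the representative multiplies numerator and denominator by the same power of a
  nonzero constant.\<close>

lemma log_symmetric_ratio:
  assumes "(D, F) \<in> log_symmetric n \<A> m" "(D, G) \<in> log_symmetric n \<A> m" "\<zeta> \<in> D" "r \<in> \<zeta>"
  shows "F (SOME r. r \<in> \<zeta>) / G (SOME r. r \<in> \<zeta>) = F r / G r"
proof -
  obtain U U' where U: "D = log_quotients n \<A> U" "homogeneous (gens0 U) (gens1 U) m F" "homogeneous (gens0 U') (gens1 U') m G"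
    using assms(1,2) unfolding log_symmetric_iff by blast
  have \<zeta>: "\<zeta> \<in> log_quotients n \<A> U" using assms(3) U(1) by simp
  define r' where "r' = (SOME r. r \<in> \<zeta>)"
  have r': "r' \<in> \<zeta>" unfolding r'_def by (rule log_quotients_nonempty[OF \<zeta>])
  have 1: "fst r' = fst r" by (rule log_quotients_scale(1)[OF \<zeta> assms(4) r'])
  obtain c where c: "c \<noteq> 0" "\<And>\<omega>. snd r' \<omega> = c * snd r \<omega>" using log_quotients_scale(2)[OF \<zeta> assms(4) r'] by blast
  show ?thesis unfolding r'_def[symmetric]
    using homogeneous_fibre_scale[OF U(2) 1 c(2)] homogeneous_fibre_scale[OF U(3) 1 c(2)] c(1) by simp
qed

text \<open>Around each point of the chart, \<open>nbd A \<eta>\<close> supplies a frame of the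
  bundle and \<open>h\<close> a principal neighbourhood. There the transition function from \<xi>
  becomes a polynomial after multiplication by a power of \<open>h * f\<close> with exponent at most
  \<open>N\<close>; since \<open>h\<close> is invertible on this neighbourhood, the pole lies along
  \<open>f = 0\<close>.\<close>

definition pole_order_le where
  "pole_order_le A \<xi> j K f N \<longleftrightarrow> (\<forall>\<zeta>0\<in>chart j K. \<exists>h \<eta> k a. k \<le> N \<and> \<eta> \<in> points X \<and> pol idx h \<and> pol idx a \<and> h (zc j K \<zeta>0) \<noteq> 0 \<and>
    (\<forall>\<zeta>\<in>chart j K. h (zc j K \<zeta>) \<noteq> 0 \<longrightarrow> \<zeta> \<in> nbd A \<eta> \<and>
       (f (zc j K \<zeta>) \<noteq> 0 \<longrightarrow> (h (zc j K \<zeta>) * f (zc j K \<zeta>)) ^ k * trans A \<xi> \<eta> \<zeta> = a (zc j K \<zeta>))))"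
    for N :: nat

text \<open>On a chart, \<open>f\<close> is the local expression of \<open>F\<close>. A trivialisation of the line bundle over \<open>nbd A \<xi>\<close>
  acquires poles of bounded order along the zeros of \<open>F\<close>.\<close>

lemma pole_order_chart:
  assumes A: "line_bundle X A" and \<xi>: "\<xi> \<in> points X" and jK: "j \<le> n" "K \<in> \<A>"
    and f: "pol idx f" "\<And>\<zeta>. \<zeta> \<in> chart j K \<Longrightarrow> f (zc j K \<zeta>) \<noteq> 0 \<Longrightarrow> \<zeta> \<in> nbd A \<xi>"
  shows "\<exists>N. pole_order_le A \<xi> j K f N"
proof -
  define good where "good h k \<longleftrightarrow> pol idx h \<and> (\<exists>\<eta>\<in>points X. \<exists>a. pol idx a \<and>
    (\<forall>\<zeta>\<in>chart j K. h (zc j K \<zeta>) \<noteq> 0 \<longrightarrow> \<zeta> \<in> nbd A \<eta> \<and>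
       (f (zc j K \<zeta>) \<noteq> 0 \<longrightarrow> (h (zc j K \<zeta>) * f (zc j K \<zeta>)) ^ k * trans A \<xi> \<eta> \<zeta> = a (zc j K \<zeta>))))" for h k
  have cover: "\<exists>h\<in>{h. \<exists>k. good h k}. h (zc j K \<zeta>0) \<noteq> 0" if \<zeta>0: "\<zeta>0 \<in> chart j K" for \<zeta>0
  proof -
    have p: "\<zeta>0 \<in> points X" using \<zeta>0 chart_sub by blast
    have nb: "zopen X (nbd A \<zeta>0)" "\<zeta>0 \<in> nbd A \<zeta>0" using A p by (auto simp: line_bundle_def)
    have tr: "trans A \<xi> \<zeta>0 \<in> regular X (nbd A \<xi> \<inter> nbd A \<zeta>0)" using A p \<xi> by (simp add: line_bundle_def)
    obtain h where h: "pol idx h" "h (zc j K \<zeta>0) \<noteq> 0"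
      "\<And>\<zeta>. \<zeta> \<in> chart j K \<Longrightarrow> h (zc j K \<zeta>) \<noteq> 0 \<Longrightarrow> \<zeta> \<in> nbd A \<zeta>0"
      by (rule open_chart[OF jK(1) \<zeta>0 nb]) (rule that)
    \<comment> \<open>Where \<open>h * f\<close> is nonzero, both trivialisations are defined and
      the transition function is regular, hence a polynomial divided by a power of
      \<open>h * f\<close>.\<close>
    have "\<exists>k a. pol idx a \<and> (\<forall>\<zeta>\<in>chart j K. h (zc j K \<zeta>) * f (zc j K \<zeta>) \<noteq> 0 \<longrightarrow>
        (h (zc j K \<zeta>) * f (zc j K \<zeta>)) ^ k * trans A \<xi> \<zeta>0 \<zeta> = a (zc j K \<zeta>))"
    proof (rule chart_regular[OF jK pol.mult[OF h(1) f(1)]])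
      fix \<zeta> assume \<zeta>: "\<zeta> \<in> chart j K" "h (zc j K \<zeta>) * f (zc j K \<zeta>) \<noteq> 0"
      have inW: "\<zeta>' \<in> nbd A \<xi> \<inter> nbd A \<zeta>0" if "\<zeta>' \<in> chart j K" "h (zc j K \<zeta>') * f (zc j K \<zeta>') \<noteq> 0" for \<zeta>'
        using that f(2) h(3) by auto
      obtain P Q where "pol idx P" "pol idx Q" "Q (zc j K \<zeta>) \<noteq> 0"
        "\<And>\<zeta>'. \<zeta>' \<in> chart j K \<Longrightarrow> \<zeta>' \<in> nbd A \<xi> \<inter> nbd A \<zeta>0 \<Longrightarrow> Q (zc j K \<zeta>') \<noteq> 0 \<Longrightarrow> trans A \<xi> \<zeta>0 \<zeta>' * Q (zc j K \<zeta>') = P (zc j K \<zeta>')"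
        by (rule regular_chart[OF jK(1) tr \<zeta>(1) inW[OF \<zeta>]]) (rule that)
      then show "\<exists>P Q. pol idx P \<and> pol idx Q \<and> Q (zc j K \<zeta>) \<noteq> 0 \<and>
          (\<forall>\<zeta>'\<in>chart j K. h (zc j K \<zeta>') * f (zc j K \<zeta>') \<noteq> 0 \<longrightarrow> Q (zc j K \<zeta>') \<noteq> 0 \<longrightarrow>
            trans A \<xi> \<zeta>0 \<zeta>' * Q (zc j K \<zeta>') = P (zc j K \<zeta>'))"
        using inW by (intro exI[of _ P] exI[of _ Q]) auto
    qed
    then obtain k a where a: "pol idx a" "\<And>\<zeta>. \<zeta> \<in> chart j K \<Longrightarrow> h (zc j K \<zeta>) * f (zc j K \<zeta>) \<noteq> 0 \<Longrightarrow>
        (h (zc j K \<zeta>) * f (zc j K \<zeta>)) ^ k * trans A \<xi> \<zeta>0 \<zeta> = a (zc j K \<zeta>)" by auto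
    have "good h k" unfolding good_def
      by (intro conjI h(1) bexI[OF _ p] exI[of _ a] a(1)) (use a(2) h(3) in auto)
    then show ?thesis using h(2) by blast
  qed
  \<comment> \<open>Finitely many \<open>h\<close> cover the chart, so the sum of their exponents
    bounds all pole orders.\<close>
  obtain \<H>0 where H0: "finite \<H>0" "\<H>0 \<subseteq> {h. \<exists>k. good h k}" "\<And>\<zeta>. \<zeta> \<in> chart j K \<Longrightarrow> \<exists>h\<in>\<H>0. h (zc j K \<zeta>) \<noteq> 0"
    by (rule chart_quasi_compact[OF jK, of "{h. \<exists>k. good h k}"]) (use cover in \<open>auto simp: good_def\<close>)
  have "\<forall>h\<in>\<H>0. \<exists>k. good h k" using H0(2) by blast
  then obtain \<kappa> where \<kappa>: "\<forall>h\<in>\<H>0. good h (\<kappa> h)" unfolding bchoice_iff ..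
  show ?thesis
    unfolding pole_order_le_def
  proof (rule exI[of _ "sum \<kappa> \<H>0"], rule ballI)
    fix \<zeta>0 assume "\<zeta>0 \<in> chart j K"
    then obtain h where h: "h \<in> \<H>0" "h (zc j K \<zeta>0) \<noteq> 0" using H0(3) by blast
    have "\<kappa> h \<le> sum \<kappa> \<H>0" using H0(1) h(1) by (intro member_le_sum) auto
    moreover obtain \<eta> a where "pol idx h" "\<eta> \<in> points X" "pol idx a"
      "\<forall>\<zeta>\<in>chart j K. h (zc j K \<zeta>) \<noteq> 0 \<longrightarrow> \<zeta> \<in> nbd A \<eta> \<and>
       (f (zc j K \<zeta>) \<noteq> 0 \<longrightarrow> (h (zc j K \<zeta>) * f (zc j K \<zeta>)) ^ \<kappa> h * trans A \<xi> \<eta> \<zeta> = a (zc j K \<zeta>))"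
      using bspec[OF \<kappa> h(1)] unfolding good_def by (elim conjE bexE exE) (rule that)
    ultimately show "\<exists>h \<eta> k a. k \<le> sum \<kappa> \<H>0 \<and> \<eta> \<in> points X \<and> pol idx h \<and> pol idx a \<and> h (zc j K \<zeta>0) \<noteq> 0 \<and>
      (\<forall>\<zeta>\<in>chart j K. h (zc j K \<zeta>) \<noteq> 0 \<longrightarrow> \<zeta> \<in> nbd A \<eta> \<and>
         (f (zc j K \<zeta>) \<noteq> 0 \<longrightarrow> (h (zc j K \<zeta>) * f (zc j K \<zeta>)) ^ k * trans A \<xi> \<eta> \<zeta> = a (zc j K \<zeta>)))"
      using h(2) by (intro exI[of _ h] exI[of _ \<eta>] exI[of _ "\<kappa> h"] exI[of _ a] conjI)
  qed
qed

lemma degree_one_frame: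
  assumes "\<eta> \<in> points X"
  obtains D G where "degree_one_frame (log_symmetric n \<A>) \<eta> = (D, G)" "(D, G) \<in> log_symmetric n \<A> 1" "\<eta> \<in> nonvanishing D G"
proof -
  obtain j K where jK: "j \<le> n" "K \<in> \<A>" "\<eta> \<in> chart j K" by (rule in_chart[OF assms])
  have "\<exists>p. case p of (D, G) \<Rightarrow> (D, G) \<in> log_symmetric n \<A> 1 \<and> \<eta> \<in> nonvanishing D G"
    using log_symmetric_yc[OF pop_affine_part jK(2), of "cvec j"] jK(3) unfolding chart_def by blast
  from someI_ex[OF this] show ?thesis using that unfolding degree_one_frame_def by (auto split: prod.splits)
qed

lemma line_bundleD:
  assumes "line_bundle X A" "\<xi> \<in> points X" "\<eta> \<in> points X"
  shows "zopen X (nbd A \<xi>)" "\<xi> \<in> nbd A \<xi>" "trans A \<xi> \<eta> \<in> regular X (nbd A \<xi> \<inter> nbd A \<eta>)"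
    "\<zeta> \<in> nbd A \<xi> \<Longrightarrow> \<zeta> \<in> nbd A \<eta> \<Longrightarrow> trans A \<xi> \<eta> \<zeta> \<noteq> 0"
    "\<theta> \<in> points X \<Longrightarrow> \<zeta> \<in> nbd A \<xi> \<Longrightarrow> \<zeta> \<in> nbd A \<eta> \<Longrightarrow> \<zeta> \<in> nbd A \<theta> \<Longrightarrow> trans A \<xi> \<eta> \<zeta> * trans A \<eta> \<theta> \<zeta> = trans A \<xi> \<theta> \<zeta>"
  using assms unfolding line_bundle_def by auto

text \<open>The section is the trivialisation of the dual of \<open>A\<close> over
  \<open>nbd A \<xi>\<close>, multiplied by a power of \<open>F\<close> that exceeds all its pole
  orders and extended by 0 along the zeros of \<open>F\<close>.\<close>

lemma section_extension:
  assumes A: "line_bundle X A" and \<xi>: "\<xi> \<in> points X" and F: "hom_Y q F" "\<And>r. r \<in> \<xi> \<Longrightarrow> F r \<noteq> 0"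
    and FW: "\<And>\<zeta> r. \<zeta> \<in> points X \<Longrightarrow> r \<in> \<zeta> \<Longrightarrow> F r \<noteq> 0 \<Longrightarrow> \<zeta> \<in> nbd A \<xi>"
  defines "L \<equiv> twisting_bundle (log_symmetric n \<A>)"
  shows "\<exists>m s. is_section X (lb_tensor (lb_power L m) (lb_dual A)) s \<and> s \<xi> \<xi> \<noteq> 0"
proof -
  have "\<forall>j\<in>{..n}. \<forall>K\<in>\<A>. \<exists>f. pol idx f \<and> (\<forall>\<zeta>\<in>chart j K. \<forall>r\<in>\<zeta>. F r = yc K r ^ q * f (zc j K \<zeta>))"
    using hom_Y_chart[OF F(1)] by blast
  then obtain f where *: "\<forall>j\<in>{..n}. \<forall>K\<in>\<A>. pol idx (f j K) \<and> (\<forall>\<zeta>\<in>chart j K. \<forall>r\<in>\<zeta>. F r = yc K r ^ q * f j K (zc j K \<zeta>))"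
    unfolding bchoice_iff by (elim exE) (rule that)
  have f: "\<And>j K. j \<le> n \<Longrightarrow> K \<in> \<A> \<Longrightarrow> pol idx (f j K)"
    "\<And>j K \<zeta> r. j \<le> n \<Longrightarrow> K \<in> \<A> \<Longrightarrow> \<zeta> \<in> chart j K \<Longrightarrow> r \<in> \<zeta> \<Longrightarrow> F r = yc K r ^ q * f j K (zc j K \<zeta>)"
    using * by blast+
  have fW: "\<zeta> \<in> nbd A \<xi>" if "j \<le> n" "K \<in> \<A>" "\<zeta> \<in> chart j K" "f j K (zc j K \<zeta>) \<noteq> 0" for j K \<zeta>
  proof -
    have p: "\<zeta> \<in> points X" using that(3) chart_sub by blast
    have "F (SOME r. r \<in> \<zeta>) \<noteq> 0"
      using f(2)[OF that(1-3) points_some[OF p]] chart_mem(2)[OF that(3) points_some[OF p]] that(4) by simp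
    then show ?thesis by (rule FW[OF p points_some[OF p]])
  qed
  have "\<forall>j\<in>{..n}. \<forall>K\<in>\<A>. \<exists>N. pole_order_le A \<xi> j K (f j K) N"
    using pole_order_chart[OF A \<xi> _ _ f(1) fW] by simp
  then obtain N where N: "\<forall>j\<in>{..n}. \<forall>K\<in>\<A>. pole_order_le A \<xi> j K (f j K) (N j K)"
    unfolding bchoice_iff by (elim exE) (rule that)
  \<comment> \<open>The sum bounds the pole orders on all charts. \<open>Suc\<close> makes the bound
    strict, so that a positive power of \<open>f\<close> is left over and the extension by 0 is
    regular.\<close>
  define e where "e = Suc (\<Sum>j\<le>n. \<Sum>K\<in>\<A>. N j K)"
  have Ne: "N j K < e" if "j \<le> n" "K \<in> \<A>" for j K
  proof -
    have "N j K \<le> (\<Sum>K\<in>\<A>. N j K)" using that arr(2) by (intro member_le_sum) auto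
    also have "\<dots> \<le> (\<Sum>j\<le>n. \<Sum>K\<in>\<A>. N j K)" using that(1) by (intro member_le_sum[of j "{..n}" "\<lambda>j. \<Sum>K\<in>\<A>. N j K"]) auto
    finally show ?thesis by (simp add: e_def)
  qed
  define rp where "rp \<zeta> = (SOME r. r \<in> \<zeta>)" for \<zeta> :: "(vec set \<times> (form \<Rightarrow> complex)) set"
  have rp: "rp \<zeta> \<in> \<zeta>" if "\<zeta> \<in> points X" for \<zeta> unfolding rp_def by (rule points_some[OF that])
  define G where "G \<eta> = snd (degree_one_frame (log_symmetric n \<A>) \<eta>)" for \<eta>
  define D where "D \<eta> = fst (degree_one_frame (log_symmetric n \<A>) \<eta>)" for \<eta>
  have G: "(D \<eta>, G \<eta>) \<in> log_symmetric n \<A> 1" "\<eta> \<in> nonvanishing (D \<eta>) (G \<eta>)" if "\<eta> \<in> points X" for \<eta>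
    using degree_one_frame[OF that] unfolding G_def D_def by (metis fst_conv snd_conv)+
  have nbdL: "nbd L \<eta> = nonvanishing (D \<eta>) (G \<eta>)" for \<eta>
    by (simp add: L_def twisting_bundle_def G_def D_def case_prod_beta)
  have transL: "trans L \<eta> \<eta>' \<zeta> = G \<eta>' (rp \<zeta>) / G \<eta> (rp \<zeta>)" for \<eta> \<eta>' \<zeta>
    by (simp add: L_def twisting_bundle_def G_def rp_def)
  define m where "m = q * e"
  \<comment> \<open>\<open>F ^ e\<close> has degree \<open>m = q * e\<close> and is divided by the
    \<open>m\<close>-th power of the frame of O(1). The factor \<open>trans A \<xi> \<eta>\<close>
    is the expression over \<open>nbd A \<eta>\<close> of the section of the dual that is 1 in the
    trivialisation at \<xi>: the dual has inverse transition functions.\<close>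
  define s where "s \<eta> \<zeta> = (if F (rp \<zeta>) = 0 then 0 else F (rp \<zeta>) ^ e / G \<eta> (rp \<zeta>) ^ m * trans A \<xi> \<eta> \<zeta>)" for \<eta> \<zeta>
  let ?B = "lb_tensor (lb_power L m) (lb_dual A)"
  have nbdB: "nbd ?B \<eta> = nbd L \<eta> \<inter> nbd A \<eta>" for \<eta>
    by (simp add: lb_tensor_def lb_power_def lb_dual_def)
  have transB: "trans ?B \<eta> \<eta>' \<zeta> = (G \<eta>' (rp \<zeta>) / G \<eta> (rp \<zeta>)) ^ m * inverse (trans A \<eta> \<eta>' \<zeta>)" for \<eta> \<eta>' \<zeta>
    by (simp add: lb_tensor_def lb_power_def lb_dual_def transL)
  have Lsub: "nbd L \<eta> \<subseteq> points X" if "\<eta> \<in> points X" for \<eta>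
    unfolding nbdL using openin_subset[OF LS.zopen_nonvanishing[OF G(1)[OF that]]] .
  have Gnz: "G \<eta> (rp \<zeta>) \<noteq> 0" if "\<eta> \<in> points X" "\<zeta> \<in> nbd L \<eta>" for \<eta> \<zeta>
    using that rp[OF subsetD[OF Lsub[OF that(1)] that(2)]] by (simp add: nbdL nonvanishing_def)
  have cocycle: "s \<eta> \<zeta> = trans ?B \<eta> \<eta>' \<zeta> * s \<eta>' \<zeta>"
    if \<eta>: "\<eta> \<in> points X" "\<eta>' \<in> points X" and \<zeta>: "\<zeta> \<in> nbd ?B \<eta> \<inter> nbd ?B \<eta>'" for \<eta> \<eta>' \<zeta>
  proof (cases "F (rp \<zeta>) = 0")
    case False
    have n: "\<zeta> \<in> nbd L \<eta>" "\<zeta> \<in> nbd A \<eta>" "\<zeta> \<in> nbd L \<eta>'" "\<zeta> \<in> nbd A \<eta>'" using \<zeta> by (auto simp: nbdB)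
    have p: "\<zeta> \<in> points X" using Lsub[OF \<eta>(1)] n(1) by blast
    have \<xi>n: "\<zeta> \<in> nbd A \<xi>" by (rule FW[OF p rp[OF p] False])
    have "trans A \<xi> \<eta> \<zeta> * trans A \<eta> \<eta>' \<zeta> = trans A \<xi> \<eta>' \<zeta>"
      by (rule line_bundleD(5)[OF A \<xi> \<eta> \<xi>n n(2) n(4)])
    then show ?thesis
      using False Gnz[OF \<eta>(1) n(1)] Gnz[OF \<eta>(2) n(3)] line_bundleD(4)[OF A \<eta> n(2) n(4)]
      by (simp add: s_def transB power_divide field_simps)
  qed (simp add: s_def)
  have reg: "s \<eta> \<in> regular X (nbd ?B \<eta>)" if \<eta>: "\<eta> \<in> points X" for \<eta>
  proof (rule LS.regular_local)
    fix \<zeta>0 assume \<zeta>0: "\<zeta>0 \<in> nbd ?B \<eta>"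
    then have "\<zeta>0 \<in> points X" using Lsub[OF \<eta>] by (auto simp: nbdB)
    then obtain j K where jK: "j \<le> n" "K \<in> \<A>" "\<zeta>0 \<in> chart j K" by (rule in_chart)
    obtain h \<theta> k a where h: "k \<le> N j K" "\<theta> \<in> points X" "pol idx h" "pol idx a" "h (zc j K \<zeta>0) \<noteq> 0"
      and ha: "\<forall>\<zeta>\<in>chart j K. h (zc j K \<zeta>) \<noteq> 0 \<longrightarrow> \<zeta> \<in> nbd A \<theta> \<and>
       (f j K (zc j K \<zeta>) \<noteq> 0 \<longrightarrow> (h (zc j K \<zeta>) * f j K (zc j K \<zeta>)) ^ k * trans A \<xi> \<theta> \<zeta> = a (zc j K \<zeta>))"
      using bspec[OF bspec[OF bspec[OF N] jK(2), unfolded pole_order_le_def] jK(3), OF iffD2[OF atMost_iff jK(1)]]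
      by (elim exE conjE) (rule that)
    have ke: "k < e" using h(1) Ne[OF jK(1,2)] by simp
    define V where "V = {\<zeta> \<in> chart j K. h (zc j K \<zeta>) \<noteq> 0}"
    have V: "zopen X V" unfolding V_def by (rule zopen_nonzero[OF chart_open[OF jK(2)] pol_regular[OF jK(2) h(3)]])
    define W where "W = nbd ?B \<eta> \<inter> V"
    have W: "W \<subseteq> chart j K" "W \<subseteq> nbd L \<eta>" "W \<subseteq> nbd A \<theta> \<inter> nbd A \<eta>" "W \<subseteq> points X"
      using ha chart_sub by (auto simp: W_def V_def nbdB)
    have Kreg: "(\<lambda>\<zeta>. yc K (rp \<zeta>) / G \<eta> (rp \<zeta>)) \<in> regular X W"
    proof -
      obtain U where U: "D \<eta> = log_quotients n \<A> U" "pop U" using G(1)[OF \<eta>] unfolding log_symmetric_iff by blast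
      have K: "(D \<eta>, yc K) \<in> log_symmetric n \<A> 1" unfolding U(1) by (rule log_symmetric_yc[OF U(2) jK(2)])
      show ?thesis
      proof (rule LS.regular_fraction[OF K G(1)[OF \<eta>]])
        show "W \<subseteq> nonvanishing (D \<eta>) (G \<eta>)" using W(2) by (simp add: nbdL)
        show "yc K (rp \<zeta>) / G \<eta> (rp \<zeta>) = yc K r / G \<eta> r" if "\<zeta> \<in> W" "r \<in> \<zeta>" for \<zeta> r
          unfolding rp_def using that W(2) by (intro log_symmetric_ratio[OF K G(1)[OF \<eta>]]) (auto simp: nbdL nonvanishing_def)
      qed
    qed
    have preg: "(\<lambda>\<zeta>. P (zc j K \<zeta>)) \<in> regular X W" if "pol idx P" for P
      by (rule LS.regular_mono[OF pol_regular[OF jK(2) that] W(1)])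
    have hreg: "(\<lambda>\<zeta>. inverse (h (zc j K \<zeta>) ^ k)) \<in> regular X W"
      by (rule LS.regular_inverse[OF LS.regular_power[OF W(4) preg[OF h(3)]]]) (auto simp: W_def V_def)
    have treg: "trans A \<theta> \<eta> \<in> regular X W"
      by (rule LS.regular_mono[OF line_bundleD(3)[OF A h(2) \<eta>] W(3)])
    \<comment> \<open>The expression for \<open>s \<eta>\<close> without a pole: \<open>F\<close> is
      \<open>yc K ^ q * f\<close>, and \<open>k\<close> of the \<open>e\<close> factors
      \<open>f\<close> are absorbed by \<open>a\<close>, which stands for the transition function
      with its denominator cleared. The remaining power of \<open>f\<close> is positive and vanishes
      with \<open>F\<close>.\<close>
    define \<phi> where "\<phi> = (\<lambda>\<zeta>. (yc K (rp \<zeta>) / G \<eta> (rp \<zeta>)) ^ m * (f j K (zc j K \<zeta>) ^ (e - k) * (a (zc j K \<zeta>) *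
      (inverse (h (zc j K \<zeta>) ^ k) * trans A \<theta> \<eta> \<zeta>))))"
    have "\<phi> \<in> regular X W" unfolding \<phi>_def
      by (intro LS.regular_mult LS.regular_power[OF W(4)] Kreg preg h f(1) jK hreg treg)
    moreover have "\<phi> \<zeta> = s \<eta> \<zeta>" if \<zeta>: "\<zeta> \<in> W" for \<zeta>
    proof -
      have c: "\<zeta> \<in> chart j K" "h (zc j K \<zeta>) \<noteq> 0" "\<zeta> \<in> nbd A \<theta>" "\<zeta> \<in> nbd A \<eta>" "\<zeta> \<in> points X" "\<zeta> \<in> nbd L \<eta>"
        using \<zeta> W by (auto simp: W_def V_def)
      have Fr: "F (rp \<zeta>) = yc K (rp \<zeta>) ^ q * f j K (zc j K \<zeta>)" by (rule f(2)[OF jK(1,2) c(1) rp[OF c(5)]])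
      have yK: "yc K (rp \<zeta>) \<noteq> 0" by (rule chart_mem(2)[OF c(1) rp[OF c(5)]])
      show ?thesis
      proof (cases "f j K (zc j K \<zeta>) = 0")
        case True
        then show ?thesis using ke by (simp add: \<phi>_def s_def Fr)
      next
        case False
        have \<xi>n: "\<zeta> \<in> nbd A \<xi>" by (rule fW[OF jK(1,2) c(1) False])
        have a: "a (zc j K \<zeta>) = (h (zc j K \<zeta>) * f j K (zc j K \<zeta>)) ^ k * trans A \<xi> \<theta> \<zeta>" using ha c False by simp
        have t: "trans A \<xi> \<theta> \<zeta> * trans A \<theta> \<eta> \<zeta> = trans A \<xi> \<eta> \<zeta>" by (rule line_bundleD(5)[OF A \<xi> h(2) \<eta> \<xi>n c(3,4)])
        have p: "f j K (zc j K \<zeta>) ^ (e - k) * f j K (zc j K \<zeta>) ^ k = f j K (zc j K \<zeta>) ^ e"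
          using ke by (simp add: power_add[symmetric])
        have "\<phi> \<zeta> = (yc K (rp \<zeta>) / G \<eta> (rp \<zeta>)) ^ m * ((f j K (zc j K \<zeta>) ^ (e - k) * f j K (zc j K \<zeta>) ^ k) *
            (trans A \<xi> \<theta> \<zeta> * trans A \<theta> \<eta> \<zeta>))"
          using c(2) by (simp add: \<phi>_def a power_mult_distrib)
        also have "\<dots> = s \<eta> \<zeta>"
          unfolding p t using False yK by (simp add: s_def Fr m_def power_divide power_mult_distrib power_mult[symmetric])
        finally show ?thesis .
      qed
    qed
    ultimately have "s \<eta> \<in> regular X W" by (rule LS.regular_cong)
    then show "\<exists>V. zopen X V \<and> \<zeta>0 \<in> V \<and> s \<eta> \<in> regular X (nbd ?B \<eta> \<inter> V)"
      using V jK(3) h(5) unfolding W_def by (intro exI[of _ V]) (auto simp: V_def)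
  qed
  have "is_section X ?B s" unfolding is_section_def using cocycle reg by blast
  moreover have "s \<xi> \<xi> \<noteq> 0"
  proof -
    have "\<xi> \<in> nbd L \<xi>" unfolding nbdL by (rule G(2)[OF \<xi>])
    then show ?thesis using F(2)[OF rp[OF \<xi>]] Gnz[OF \<xi>] line_bundleD(4)[OF A \<xi> \<xi> line_bundleD(2)[OF A \<xi> \<xi>] line_bundleD(2)[OF A \<xi> \<xi>]]
      by (simp add: s_def)
  qed
  ultimately show ?thesis by blast
qed

lemma bundle_proj_eq: "\<xi> \<in> points X \<Longrightarrow> r \<in> \<xi> \<Longrightarrow> bundle_proj \<xi> = fst r"
proof -
  assume \<xi>: "\<xi> \<in> points X" "r \<in> \<xi>"
  have "fst ` \<xi> \<subseteq> {fst r}"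
  proof (rule image_subsetI)
    show "fst r' \<in> {fst r}" if "r' \<in> \<xi>" for r' using points_scale(1)[OF \<xi> that] by simp
  qed
  moreover have "fst r \<in> fst ` \<xi>" using \<xi>(2) by (rule imageI)
  ultimately have "fst ` \<xi> = {fst r}" by blast
  then show ?thesis by (simp add: bundle_proj_def)
qed

end

theorem theoremA:
  fixes n d :: nat
    and \<A> :: "vec set set"
    and A :: "(vec set \<times> (form \<Rightarrow> complex)) set cocycle"
  assumes "n \<ge> 1"
    and "\<A> \<subseteq> proj_points n" and "finite \<A>" and "card \<A> = d"
    and "d \<ge> (n + 2) choose 2"
    and "general_position_hyperplanes n \<A>"
    and "general_position_quadrics n \<A>"
    and "ample (proj_log_cotangent n \<A>) A"
  shows "bundle_proj ` augmented_base_locus (proj_log_cotangent n \<A>) (log_O1 n \<A>) A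
           \<subseteq> arr_union n \<A>"
proof -
  have "n + 1 \<le> (n + 2) choose 2"
    using assms(1) by (simp add: choose_two algebra_simps)
  then have card: "n + 1 \<le> card \<A>" using assms(4,5) by simp
  then obtain H0 where H0: "H0 \<in> \<A>" by fastforce
  have eqn_mem: "lin n b a = 0" if H: "H \<in> \<A>" "a \<in> H" and b: "b \<in> pclass v" "eqn n H v = 0" for H a b v
  proof -
    obtain c where "\<forall>u. lin n a u = c * eqn n H u" using lin_mem_proj_points H assms(2) by blast
    moreover obtain c' where "b = (\<lambda>i. c' * v i)" using b(1) by (auto elim: mem_pclassE)
    ultimately show ?thesis using b(2) lin_commute[of n b a] by (simp add: eqn_scale)
  qed
  interpret arrangement n \<A> H0
  proof
    fix T v assume T: "T \<subseteq> \<A>" "card T = n + 1" and v: "v \<in> vecs n" and 0: "\<And>H. H \<in> T \<Longrightarrow> eqn n H v = 0"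
    show "v = (\<lambda>_. 0)"
    proof (rule ccontr)
      assume "v \<noteq> (\<lambda>_. 0)"
      then have p: "pclass v \<in> proj_points n" using v by (simp add: pclass_in_proj_points)
      \<comment> \<open>Duality: a vector killed by the forms in \<open>T\<close> is itself a linear
        form on the dual space, and its hyperplane contains \<open>T\<close>.\<close>
      have "T \<subseteq> hyperplane n (pclass v)"
        unfolding hyperplane_def using T(1) assms(2) eqn_mem[OF _ _ _ 0] by auto
      then show False using assms(6) T p unfolding general_position_hyperplanes_def is_hyperplane_def by blast
    qed
  qed (use assms H0 card in auto)
  obtain S where S: "S \<subseteq> \<A>" "card S = n + 1" using obtain_subset_with_card_n[OF card] by metis
  obtain u where u: "\<forall>H\<in>S. u H \<in> vecs n \<and> (\<forall>H'\<in>S. eqn n H' (u H) = (if H' = H then 1 else 0))"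
    using interpolation_basis[OF S] ..
  interpret arrangement_basis n \<A> H0 S u
    by unfold_locales (use S u in auto)
  have quad: "\<forall>Q. hom_poly n 2 Q \<longrightarrow> (\<forall>H\<in>\<A>. \<forall>a\<in>H. Q a = 0) \<longrightarrow> (\<forall>a\<in>vecs n. Q a = 0)"
  proof (intro allI impI ballI, rule ccontr)
    fix Q a assume Q: "hom_poly n 2 Q" "\<forall>H\<in>\<A>. \<forall>a\<in>H. Q a = 0" "a \<in> vecs n" "Q a \<noteq> 0"
    have "(n + 2) choose 2 \<le> card \<A>" using assms(4,5) by simp
    \<comment> \<open>A nonzero quadric through the whole arrangement would contain any binom(n+2,2)
      of its points.\<close>
    then obtain T where T: "T \<subseteq> \<A>" "card T = (n + 2) choose 2" using obtain_subset_with_card_n by metis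
    have "is_quadric n {x \<in> proj_points n. \<forall>v\<in>x. Q v = 0}" unfolding is_quadric_def using Q by blast
    moreover have "T \<subseteq> {x \<in> proj_points n. \<forall>v\<in>x. Q v = 0}" using T(1) assms(2) Q(2) by blast
    ultimately show False using assms(7) T unfolding general_position_quadrics_def by blast
  qed
  have A: "line_bundle X A" using assms(8) by (simp add: ample_def proj_log_cotangent_def)
  show ?thesis
  proof (rule image_subsetI, rule ccontr)
    fix \<xi> assume \<xi>: "\<xi> \<in> augmented_base_locus (proj_log_cotangent n \<A>) (log_O1 n \<A>) A"
      and out: "bundle_proj \<xi> \<notin> arr_union n \<A>"
    \<comment> \<open>Membership is evaluated at the multiple 1, for all \<open>m\<close>.\<close>
    have base: "\<xi> \<in> base_locus X (lb_power (lb_tensor (lb_power (log_O1 n \<A>) m) (lb_dual A)) 1)" for m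
      using \<xi> unfolding augmented_base_locus_def stable_base_locus_def proj_log_cotangent_def by auto
    then have p: "\<xi> \<in> points X" by (simp add: base_locus_def)
    \<comment> \<open>The open set to be reached is the one over which the given cocycle is
      trivialised at \<xi>, so that the dual of \<open>A\<close> has a frame wherever
      \<open>F\<close> is nonzero.\<close>
    have "\<exists>q F. hom_Y q F \<and> (\<forall>r\<in>\<xi>. F r \<noteq> 0) \<and> (\<forall>\<zeta>\<in>points X. \<forall>r\<in>\<zeta>. F r \<noteq> 0 \<longrightarrow> \<zeta> \<in> nbd A \<xi>)"
      by (rule separating_section[OF quad p _ line_bundleD(1,2)[OF A p p]]) (use out bundle_proj_eq[OF p] in simp)
    then obtain q F where F: "hom_Y q F" "\<And>r. r \<in> \<xi> \<Longrightarrow> F r \<noteq> 0"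
      "\<And>\<zeta> r. \<zeta> \<in> points X \<Longrightarrow> r \<in> \<zeta> \<Longrightarrow> F r \<noteq> 0 \<Longrightarrow> \<zeta> \<in> nbd A \<xi>" by blast
    have "\<exists>m s. is_section X (lb_tensor (lb_power (log_O1 n \<A>) m) (lb_dual A)) s \<and> s \<xi> \<xi> \<noteq> 0"
      unfolding log_O1_def by (rule section_extension[OF A p F(1)]) (fact F(2), rule F(3))
    then obtain m s where s: "is_section X (lb_tensor (lb_power (log_O1 n \<A>) m) (lb_dual A)) s" "s \<xi> \<xi> \<noteq> 0"
      by blast
    have "lb_power (lb_tensor (lb_power (log_O1 n \<A>) m) (lb_dual A)) 1 = lb_tensor (lb_power (log_O1 n \<A>) m) (lb_dual A)"
      by (simp add: lb_power_def lb_tensor_def)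
    then show False using base[of m] s by (simp add: base_locus_def)
  qed
qed

end
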